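(* There is an algorithm that, given two $S_d$-graphs $G$ and $H$ on $n$ vertices (no representations given) in which every clique has at most $p$ vertices, correctly decides whether $G$ and $H$ are isomorphic in time $f(p)\cdot n^{\mathcal{O}(1)}$ for some computable function $f$ (the running time does not depend on $d$), i.e., in \textbf{FPT}-time parameterized by the maximum clique size $p$.
   Context: A subdivision of a graph $H$ is obtained by repeatedly replacing an edge by a path of length two through a new vertex. An $H$-graph is the intersection graph of a collection of connected subgraphs of some subdivision of $H$. $S_d$ is the star $K_{1,d}$ with $d$ rays. *)

theory Defs
  imports "Graph_Theory.Graph_Theory"
begin

section \<open>H-graphs\<close>

text \<open>
  Finite simple undirected graphs are the \<^locale>\<open>pair_graph\<close>s of the graph library, i.e. the finite,
  loop-free, symmetric digraphs without parallel arcs.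
\<close>

definition clique :: "'a pair_pre_digraph \<Rightarrow> 'a set \<Rightarrow> bool" where
  "clique G C \<longleftrightarrow> C \<subseteq> pverts G \<and> (\<forall>u\<in>C. \<forall>v\<in>C. u \<noteq> v \<longrightarrow> (u, v) \<in> parcs G)"

text \<open>
  The representation is indexed by the vertices of \<open>G\<close>, so different vertices may be assigned
  the same subgraph. Connected graphs are nonempty in the library. The vertices of \<open>H\<close> are taken
  from an infinite type so that fresh subdivision vertices are always available.
\<close>

definition is_H_graph :: "nat pair_pre_digraph \<Rightarrow> 'a pair_pre_digraph \<Rightarrow> bool" where
  "is_H_graph H G \<longleftrightarrow> pair_graph G \<and>
     (\<exists>H' T. subdivision_pair H H' \<and>
        (\<forall>v\<in>pverts G. pair_graph (T v) \<and> subgraph (with_proj (T v)) (with_proj H') \<and>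
            Digraph_Component.connected (with_proj (T v))) \<and>
        (\<forall>u\<in>pverts G. \<forall>v\<in>pverts G. u \<noteq> v \<longrightarrow>
            ((u, v) \<in> parcs G \<longleftrightarrow> pverts (T u) \<inter> pverts (T v) \<noteq> {})))"

definition star :: "nat \<Rightarrow> nat pair_pre_digraph" where
  "star d = \<lparr>pverts = {0..d}, parcs = {0} \<times> {1..d} \<union> {1..d} \<times> {0}\<rparr>"

lemma star_complete_bipartite: "complete_bipartite_digraph 1 d (with_proj (star d))"
  unfolding complete_bipartite_digraph_pair_def
proof (intro conjI exI)
  show "finite (pverts (star d))" by (simp add: star_def)
  show "pverts (star d) = {0} \<union> {1..d}" by (auto simp: star_def)
  show "parcs (star d) = {0} \<times> {1..d} \<union> {1..d} \<times> {0}" by (simp add: star_def)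
qed auto


section \<open>Random access machines\<close>

text \<open>
  The model of computation is the random access machine with uniform cost measure and the operations
  addition, cut-off subtraction and halving, which is the standard one in parameterized complexity.
  It is polynomially equivalent to the Turing machine: since one operation at most doubles the
  largest number in use, the numbers occurring within \<open>t\<close> steps have length \<open>O(t)\<close> plus the length
  of the input numbers. Multiplication is excluded because it would break this.
  Programs are written with structured control flow instead of jumps. The memory is a family of
  registers holding natural numbers; \<open>Load e\<close> reads the register whose address is the value of \<open>e\<close>,
  which provides indirect addressing.
\<close>

type_synonym mem = "nat \<Rightarrow> nat"

datatype exp =
    Const nat
  | Load exp
  | Add exp exp
  | Monus exp exp
  | Half exp

datatype prog =
    Skip
  | Store exp exp
  | Seq prog prog
  | Cond exp prog prog
  | While exp prog

primrec val :: "exp \<Rightarrow> mem \<Rightarrow> nat" where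
  "val (Const k) m = k"
| "val (Load e) m = m (val e m)"
| "val (Add e1 e2) m = val e1 m + val e2 m"
| "val (Monus e1 e2) m = val e1 m - val e2 m"
| "val (Half e) m = val e m div 2"

primrec cost :: "exp \<Rightarrow> nat" where
  "cost (Const k) = 1"
| "cost (Load e) = cost e + 1"
| "cost (Add e1 e2) = cost e1 + cost e2 + 1"
| "cost (Monus e1 e2) = cost e1 + cost e2 + 1"
| "cost (Half e) = cost e + 1"

text \<open>
  \<open>exec P m t m'\<close>: started in memory \<open>m\<close>, program \<open>P\<close> halts after \<open>t\<close> steps in memory \<open>m'\<close>.
\<close>

inductive exec :: "prog \<Rightarrow> mem \<Rightarrow> nat \<Rightarrow> mem \<Rightarrow> bool" where
  Skip: "exec Skip m 1 m"
| Store: "exec (Store a e) m (cost a + cost e + 1) (m(val a m := val e m))"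
| Seq: "exec P m t m' \<Longrightarrow> exec Q m' t' m'' \<Longrightarrow> exec (Seq P Q) m (t + t') m''"
| CondTrue: "val b m \<noteq> 0 \<Longrightarrow> exec P m t m' \<Longrightarrow> exec (Cond b P Q) m (cost b + 1 + t) m'"
| CondFalse: "val b m = 0 \<Longrightarrow> exec Q m t m' \<Longrightarrow> exec (Cond b P Q) m (cost b + 1 + t) m'"
| WhileFalse: "val b m = 0 \<Longrightarrow> exec (While b P) m (cost b + 1) m"
| WhileTrue: "val b m \<noteq> 0 \<Longrightarrow> exec P m t m' \<Longrightarrow> exec (While b P) m' t' m'' \<Longrightarrow>
    exec (While b P) m (cost b + 1 + t + t') m''"

inductive_cases exec_SkipE: "exec Skip m t m'"
inductive_cases exec_StoreE: "exec (Store a e) m t m'"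
inductive_cases exec_SeqE: "exec (Seq P Q) m t m'"
inductive_cases exec_CondE: "exec (Cond b P Q) m t m'"
inductive_cases exec_WhileE: "exec (While b P) m t m'"

lemma exec_deterministic:
  "exec P m t m' \<Longrightarrow> exec P m u m'' \<Longrightarrow> u = t \<and> m'' = m'"
proof (induction arbitrary: u m'' rule: exec.induct)
  case (Skip m)
  then show ?case by (rule exec_SkipE) simp
next
  case (Store a e m)
  then show ?case by (rule exec_StoreE) simp
next
  case (Seq P m t m1 Q t' m2)
  from Seq.prems show ?case
    by (rule exec_SeqE) (auto dest!: Seq.IH)
next
  case (CondTrue b m P t m1 Q)
  from CondTrue.prems show ?case
    by (rule exec_CondE) (use CondTrue.hyps(1) in \<open>auto dest!: CondTrue.IH\<close>)
next
  case (CondFalse b m Q t m1 P)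
  from CondFalse.prems show ?case
    by (rule exec_CondE) (use CondFalse.hyps(1) in \<open>auto dest!: CondFalse.IH\<close>)
next
  case (WhileFalse b m P)
  from WhileFalse.prems show ?case
    by (rule exec_WhileE) (use WhileFalse.hyps in simp_all)
next
  case (WhileTrue b m P t m1 t' m2)
  from WhileTrue.prems show ?case
    by (rule exec_WhileE) (use WhileTrue.hyps(1) in \<open>auto dest!: WhileTrue.IH\<close>)
qed

definition input_mem :: "nat list \<Rightarrow> mem" where
  "input_mem xs = (\<lambda>i. if i < length xs then xs ! i else 0)"

text \<open>Register 0 holds the output.\<close>

definition outputs_within :: "prog \<Rightarrow> nat list \<Rightarrow> nat \<Rightarrow> nat \<Rightarrow> bool" where
  "outputs_within P xs y b \<longleftrightarrow> (\<exists>t m. exec P (input_mem xs) t m \<and> m 0 = y \<and> t \<le> b)"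

definition computable :: "(nat \<Rightarrow> nat) \<Rightarrow> bool" where
  "computable f \<longleftrightarrow> (\<exists>P. \<forall>x. \<exists>b. outputs_within P [x] (f x) b)"

text \<open>
  Graphs on the vertex set \<open>{..<n}\<close> are given to a program by their adjacency matrices, row by row.
\<close>

definition adj_matrix :: "nat \<Rightarrow> nat pair_pre_digraph \<Rightarrow> nat list" where
  "adj_matrix n G =
     concat (map (\<lambda>i. map (\<lambda>j. of_bool ((i, j) \<in> parcs G)) [0..<n]) [0..<n])"

definition encode_pair :: "nat \<Rightarrow> nat pair_pre_digraph \<Rightarrow> nat pair_pre_digraph \<Rightarrow> nat list" where
  "encode_pair n G H = n # adj_matrix n G @ adj_matrix n H"

end

theory Submission
  imports Defs "HOL-Library.Multiset"
begin

text \<open>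
  \<open>G\<close> and \<open>H\<close> are intersection graphs of subtrees of trees. Let \<open>U\<close> be their disjoint union, where an
  apex is added to either part. For an ordered clique \<open>q = x # s\<close> let \<open>D\<close> be the component of \<open>x\<close> in
  \<open>U - s\<close>. By the Helly property, each component \<open>E\<close> of \<open>D - x\<close> contains a full vertex \<open>y\<close>, that is, one
  that is adjacent to all vertices of \<open>q\<close> with a neighbour in \<open>E\<close>. The subsequence of these
  vertices together with \<open>y\<close> is again an ordered clique, with the smaller component \<open>E\<close>. Hence the
  isomorphism type of \<open>D \<union> s\<close> with \<open>q\<close> pointwise fixed is determined recursively by the multiset of
  the types of these smaller cliques over all full \<open>y\<close>. Counting the full vertices
  instead of the components suffices, since isomorphic components have equally many full vertices of each type.
  After \<open>|U|\<close> rounds of the corresponding colour refinement, \<open>G\<close> and \<open>H\<close> are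
  isomorphic iff the two apices have the same colour.

  Each clique consists of subtrees that contain the topmost node of one of its members, and the
  subtrees through a node form a clique. So with cliques of at most \<open>p\<close> vertices in \<open>G\<close> and \<open>H\<close> there are at most
  \<open>|U| * 2^((p + 2)^2)\<close> ordered cliques in \<open>U\<close>, and the refinement is polynomial in this number.
\<close>

section \<open>Colour refinement on ordered cliques\<close>

text \<open>The cliques are ordered because local isomorphisms must be glued: each of them is
  prescribed on a list, so those of different components agree on \<open>q\<close> without further
  choice. A component has no canonical full vertex, so all its full vertices enter the colour. The
  price is that a single common colour must be shown to identify whole components before components
  can be matched.

  An apex makes each part connected, so each graph with its apex is the region of a one-element
  clique; represented by the whole tree, the apex keeps the graph an intersection graph of subtrees.
  It raises the clique size to \<open>P = p + 1\<close>. At each node there are at most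
  \<open>(P + 1) ^ (P + 1)\<close> lists, which is the origin of the exponent
  \<open>(p + 2) * (p + 2)\<close>.

  The program knows neither the trees nor \<open>d\<close> nor \<open>p\<close>; they serve its
  analysis. Its shape is dictated by the machine: without multiplication, table rows need stored
  offsets; the number of cliques is unknown until they are enumerated; and the memory is not clean,
  since the input initially occupies registers of many arrays.\<close>

text \<open>One shared element forces two blocks to be equal. So a block \<open>T' b\<close> that
  contains an element of \<open>T a\<close> cancels against \<open>T a\<close>, and induction
  handles the rest. This turns equal multisets of colours of full vertices into a matching of
  components.\<close>

lemma match_blocks:
  assumes "finite A" "finite B"
    and "\<And>a. a \<in> A \<Longrightarrow> T a \<noteq> {#}" "\<And>b. b \<in> B \<Longrightarrow> T' b \<noteq> {#}"
    and "(\<Sum>a\<in>A. T a) = (\<Sum>b\<in>B. T' b)"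
    and "\<And>a b c. a \<in> A \<Longrightarrow> b \<in> B \<Longrightarrow> c \<in># T a \<Longrightarrow> c \<in># T' b \<Longrightarrow> T a = T' b"
  shows "\<exists>h. bij_betw h A B \<and> (\<forall>a\<in>A. T' (h a) = T a)"
  using assms
proof (induction A arbitrary: B rule: finite_induct)
  case empty
  then have "B = {}" by (auto simp: sum_eq_empty_iff)
  then show ?case by (auto simp: bij_betw_def)
next
  case (insert a A)
  from insert.prems(2)[of a] obtain c where c: "c \<in># T a" by fastforce
  then have "c \<in># (\<Sum>b\<in>B. T' b)"
    using insert.hyps insert.prems(4) by (metis sum.insert union_iff)
  then obtain b where b: "b \<in> B" "c \<in># T' b" using insert.prems(1) by (auto simp: set_mset_sum)
  have eq: "T a = T' b" using insert.prems(5) b c by blast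
  have "(\<Sum>b\<in>B. T' b) = T' b + (\<Sum>b\<in>B - {b}. T' b)" using b insert.prems(1) by (simp add: sum.remove)
  then have s: "(\<Sum>a\<in>A. T a) = (\<Sum>b\<in>B - {b}. T' b)"
    using insert.prems(4) insert.hyps eq by simp
  have "\<exists>h. bij_betw h A (B - {b}) \<and> (\<forall>a\<in>A. T' (h a) = T a)"
    by (rule insert.IH) (use insert.prems s in auto)
  then obtain h where h: "bij_betw h A (B - {b})" "\<And>x. x \<in> A \<Longrightarrow> T' (h x) = T x" by blast
  have "bij_betw (h(a := b)) A (B - {b})"
    using h(1) insert.hyps(2) by (subst bij_betw_cong[of _ _ h]) auto
  then have "bij_betw (h(a := b)) (A \<union> {a}) ((B - {b}) \<union> {b})"
    by (rule bij_betw_combine) (auto simp: bij_betw_def)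
  moreover have "A \<union> {a} = insert a A" "(B - {b}) \<union> {b} = B" using b by auto
  ultimately have "bij_betw (h(a := b)) (insert a A) B" by simp
  moreover have "\<forall>x\<in>insert a A. T' ((h(a := b)) x) = T x" using h(2) eq insert.hyps by auto
  ultimately show ?case by blast
qed

lemma image_mset_bij:
  assumes "bij_betw h A B" "\<And>a. a \<in> A \<Longrightarrow> g (h a) = f a"
  shows "image_mset f (mset_set A) = image_mset g (mset_set B)"
proof -
  have "image_mset g (mset_set B) = image_mset g (image_mset h (mset_set A))"
    using assms(1) by (metis bij_betw_def image_mset_mset_set)
  also have "\<dots> = image_mset f (mset_set A)"
  proof (cases "finite A")
    case True
    then show ?thesis using assms(2) by (simp add: multiset.map_comp) (rule image_mset_cong, simp)
  qed simp
  finally show ?thesis by simp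
qed

lemma mset_set_disjoint_UN:
  assumes "finite I" "\<And>i. i \<in> I \<Longrightarrow> finite (A i)"
    "\<And>i j. i \<in> I \<Longrightarrow> j \<in> I \<Longrightarrow> i \<noteq> j \<Longrightarrow> A i \<inter> A j = {}"
  shows "mset_set (\<Union>i\<in>I. A i) = (\<Sum>i\<in>I. mset_set (A i))"
  using assms
proof (induction I rule: finite_induct)
  case (insert i I)
  have "A i \<inter> (\<Union>j\<in>I. A j) = {}" using insert.prems(2) insert.hyps(2) by auto
  moreover have "mset_set (\<Union>j\<in>I. A j) = (\<Sum>j\<in>I. mset_set (A j))"
    by (rule insert.IH) (use insert.prems in auto)
  ultimately show ?case using insert by (simp add: mset_set_Union)
qed simp

lemma image_mset_sum: "image_mset f (\<Sum>i\<in>I. A i) = (\<Sum>i\<in>I. image_mset f (A i))"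
  by (induction I rule: infinite_finite_induct) auto

lemma filter_map_cong:
  assumes "map f q = q'" "map P q = map P' q'"
  shows "map f (filter P q) = filter P' q'"
  using assms by (induction q arbitrary: q') auto

text \<open>The Boolean list records to which positions of the clique a kid is adjacent. It tells
  how the smaller clique lies inside the larger one, which the colour of the smaller clique cannot
  express.\<close>

datatype colour = Colour "(bool list \<times> colour) multiset"

locale sgraph =
  fixes V :: "nat set" and adj :: "nat \<Rightarrow> nat \<Rightarrow> bool"
  assumes finV: "finite V"
    and adj_sym: "adj u v \<Longrightarrow> adj v u"
    and adj_irrefl: "\<not> adj u u"
    and adj_V: "adj u v \<Longrightarrow> u \<in> V"
begin

lemma adj_commute: "adj u v \<longleftrightarrow> adj v u" using adj_sym by blast

text \<open>Vertices of \<open>Q\<close> can be entered but not left. For \<open>y\<close> outside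
  \<open>Q\<close> this gives the component of \<open>y\<close> after deletion of \<open>Q\<close>,
  together with the vertices of \<open>Q\<close> attached to it.\<close>

definition Cl :: "nat set \<Rightarrow> nat \<Rightarrow> nat set" where
  "Cl Q y = {z. (y, z) \<in> {(u, v). adj u v \<and> u \<notin> Q}\<^sup>*}"

definition component :: "nat set \<Rightarrow> nat \<Rightarrow> nat set" where
  "component Q y = Cl Q y - Q"

definition full :: "nat set \<Rightarrow> nat \<Rightarrow> bool" where
  "full Q y \<longleftrightarrow> (\<forall>z\<in>Q. z \<in> Cl Q y \<longrightarrow> adj y z)"

text \<open>As \<open>adj\<close> is symmetric and irreflexive, \<open>sorted_wrt adj\<close> makes
  the entries distinct and pairwise adjacent.\<close>

definition oclique :: "nat list \<Rightarrow> bool" where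
  "oclique q \<longleftrightarrow> set q \<subseteq> V \<and> sorted_wrt adj q"

definition restr :: "nat list \<Rightarrow> nat \<Rightarrow> nat list" where
  "restr q y = y # filter (adj y) q"

text \<open>Deleting the head from its component leaves the components attached to the head. For a
  full vertex, attachment of its component to the head is the same as adjacency to the head.\<close>

definition kids :: "nat list \<Rightarrow> nat set" where
  "kids q = {y \<in> V. y \<notin> set q \<and> adj y (hd q) \<and> full (set q) y}"

definition region :: "nat list \<Rightarrow> nat set" where
  "region q = component (set (tl q)) (hd q) \<union> set q"

primrec colour :: "nat \<Rightarrow> nat list \<Rightarrow> colour" where
  "colour 0 q = Colour {#}"
| "colour (Suc k) q =
     Colour (image_mset (\<lambda>y. (map (adj y) q, colour k (restr q y))) (mset_set (kids q)))"

definition liso :: "(nat \<Rightarrow> nat) \<Rightarrow> nat list \<Rightarrow> nat list \<Rightarrow> bool" where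
  "liso \<phi> q q' \<longleftrightarrow> bij_betw \<phi> (region q) (region q') \<and> map \<phi> q = q' \<and>
     (\<forall>u\<in>region q. \<forall>v\<in>region q. adj (\<phi> u) (\<phi> v) \<longleftrightarrow> adj u v)"

lemma Cl_refl [simp]: "y \<in> Cl Q y"
  by (simp add: Cl_def)

lemma Cl_step: "u \<in> Cl Q y \<Longrightarrow> u \<notin> Q \<Longrightarrow> adj u v \<Longrightarrow> v \<in> Cl Q y"
  unfolding Cl_def by (auto intro: rtrancl_into_rtrancl)

lemma Cl_induct [consumes 1, case_names base step]:
  assumes "z \<in> Cl Q y" "P y"
    "\<And>u v. u \<in> Cl Q y \<Longrightarrow> P u \<Longrightarrow> u \<notin> Q \<Longrightarrow> adj u v \<Longrightarrow> P v"
  shows "P z"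
  using assms(1) unfolding Cl_def mem_Collect_eq
  by (induction rule: rtrancl_induct) (use assms(2,3) in \<open>auto simp: Cl_def\<close>)

lemma Cl_trans: "u \<in> Cl Q y \<Longrightarrow> Cl Q u \<subseteq> Cl Q y"
  unfolding Cl_def by (auto intro: rtrancl_trans)

text \<open>A path counted by \<open>Cl\<close> leaves no vertex of \<open>Q\<close>, so only its
  end can lie in \<open>Q\<close>; if it does not, the reversed path counts as well.\<close>

lemma Cl_rev: "z \<in> Cl Q y \<Longrightarrow> z \<notin> Q \<Longrightarrow> y \<in> Cl Q z"
proof (induction rule: Cl_induct)
  case (step u v)
  have "u \<in> Cl Q v" by (rule Cl_step[of v]) (use step adj_sym in auto)
  then show ?case using step Cl_trans by blast
qed simp

lemma Cl_eq: "z \<in> component Q y \<Longrightarrow> Cl Q z = Cl Q y"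
  unfolding component_def using Cl_trans Cl_rev by blast

lemma component_eq: "z \<in> component Q y \<Longrightarrow> component Q z = component Q y"
  using Cl_eq[of z Q y] by (simp add: component_def[of Q z] component_def[of Q y])

lemma component_refl: "y \<notin> Q \<Longrightarrow> y \<in> component Q y"
  by (simp add: component_def)

lemma Cl_V: "y \<in> V \<Longrightarrow> Cl Q y \<subseteq> V"
proof
  fix z assume "z \<in> Cl Q y" "y \<in> V"
  then show "z \<in> V" by (induction rule: Cl_induct) (use adj_V adj_sym in blast)+
qed

lemma component_V: "y \<in> V \<Longrightarrow> component Q y \<subseteq> V"
  using Cl_V by (auto simp: component_def)

lemma component_nbr: "u \<in> component Q y \<Longrightarrow> adj u v \<Longrightarrow> v \<in> component Q y \<or> v \<in> Q"
  unfolding component_def using Cl_step by auto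

lemma oclique_Cons: "oclique (x # s) \<longleftrightarrow> x \<in> V \<and> (\<forall>y\<in>set s. adj x y) \<and> oclique s"
  by (auto simp: oclique_def)

lemma oclique_distinct: "oclique q \<Longrightarrow> distinct q"
  by (induction q) (auto simp: oclique_Cons adj_irrefl)

lemma oclique_adj: "oclique q \<Longrightarrow> u \<in> set q \<Longrightarrow> v \<in> set q \<Longrightarrow> adj u v \<longleftrightarrow> u \<noteq> v"
  by (induction q) (auto simp: oclique_Cons adj_irrefl adj_sym)

lemma oclique_filter: "oclique q \<Longrightarrow> oclique (filter P q)"
  by (auto simp: oclique_def sorted_wrt_filter)

lemma oclique_restr: "oclique q \<Longrightarrow> y \<in> V \<Longrightarrow> oclique (restr q y)"
  unfolding restr_def oclique_Cons by (auto simp: oclique_filter)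

lemma kids_V: "kids q \<subseteq> V" and finite_kids: "finite (kids q)"
  using finV by (auto simp: kids_def intro: finite_subset)

lemma full_Cl: "full Q y \<Longrightarrow> y \<notin> Q \<Longrightarrow> z \<in> Q \<Longrightarrow> z \<in> Cl Q y \<longleftrightarrow> adj y z"
  unfolding full_def using Cl_step[of y Q y z] by auto

lemma full_adj_eq:
  assumes "full Q y" "y \<notin> Q" "full Q z" "z \<in> component Q y" "w \<in> Q"
  shows "adj z w \<longleftrightarrow> adj y w"
  using assms full_Cl[of Q y w] full_Cl[of Q z w] Cl_eq[of z Q y] by (auto simp: component_def)

text \<open>Shrinking the separator could enlarge the component only through a deleted vertex that
  it reaches. By fullness every reached member of \<open>q\<close> is adjacent to \<open>y\<close>
  and therefore kept.\<close>

lemma component_restr: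
  assumes "full (set q) y" "y \<notin> set q"
  shows "component (set (tl (restr q y))) y = component (set q) y"
proof -
  let ?K = "{z \<in> set q. adj y z}"
  have 1: "z \<in> Cl ?K y \<and> (z \<in> set q \<longrightarrow> adj y z)" if "z \<in> Cl (set q) y" for z
    using that
  proof (induction rule: Cl_induct)
    case (step u v)
    then have "v \<in> Cl (set q) y" "v \<in> Cl ?K y" by (auto intro: Cl_step)
    then show ?case using assms(1) by (auto simp: full_def)
  qed (use assms in auto)
  have 2: "z \<in> Cl (set q) y" if "z \<in> Cl ?K y" for z
    using that
  proof (induction rule: Cl_induct)
    case (step u v)
    have "u \<notin> set q" using 1[of u] step by auto
    then show ?case using step by (auto intro: Cl_step)
  qed simp
  have "set (tl (restr q y)) = ?K" by (auto simp: restr_def)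
  moreover have "z \<in> Cl ?K y - ?K \<longleftrightarrow> z \<in> Cl (set q) y - set q" for z using 1[of z] 2[of z] by auto
  ultimately show ?thesis unfolding component_def by (metis set_eqI)
qed

lemma region_restr:
  assumes "full (set q) y" "y \<notin> set q"
  shows "region (restr q y) = component (set q) y \<union> {z \<in> set q. adj y z}"
  using component_restr[OF assms] component_refl[OF assms(2)] by (auto simp: region_def restr_def)

text \<open>The head connects the kid to the old component and is itself missing from the new one.
  The induction in \<open>colour_liso\<close> rests on this strict decrease.\<close>

lemma kid_component_subset:
  assumes "oclique (x # s)" "y \<in> kids (x # s)"
  shows "component (set (x # s)) y \<subseteq> component (set s) x - {x}"
proof
  fix z assume z: "z \<in> component (set (x # s)) y"
  have y: "y \<notin> set (x # s)" "adj y x" "y \<in> V" using assms by (auto simp: kids_def)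
  have x: "x \<notin> set s" using assms(1) oclique_distinct by fastforce
  have "z \<in> Cl (set (x # s)) y" using z by (simp add: component_def)
  then have "z \<in> Cl (set s) x"
  proof (induction rule: Cl_induct)
    case base
    show ?case by (rule Cl_step[of x]) (use x y adj_sym in auto)
  next
    case (step u v) then show ?case by (auto intro: Cl_step)
  qed
  then show "z \<in> component (set s) x - {x}" using z by (auto simp: component_def)
qed

lemma kids_in_region:
  assumes "oclique (x # s)" "y \<in> kids (x # s)"
  shows "y \<in> region (x # s)" "region (restr (x # s) y) \<subseteq> region (x # s)"
proof -
  have y: "full (set (x # s)) y" "y \<notin> set (x # s)" using assms(2) by (auto simp: kids_def)
  show "y \<in> region (x # s)"
    using kid_component_subset[OF assms] component_refl[OF y(2)] by (auto simp: region_def)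
  show "region (restr (x # s) y) \<subseteq> region (x # s)"
    unfolding region_restr[OF y] using kid_component_subset[OF assms] by (auto simp: region_def)
qed

section \<open>Local isomorphisms preserve colours\<close>

lemma liso_inv:
  assumes "liso \<phi> q q'"
  shows "liso (inv_into (region q) \<phi>) q' q"
proof -
  let ?\<psi> = "inv_into (region q) \<phi>"
  have b: "bij_betw \<phi> (region q) (region q')" and m: "map \<phi> q = q'" using assms by (auto simp: liso_def)
  have sq: "set q \<subseteq> region q" by (auto simp: region_def)
  have "map ?\<psi> q' = map id q" unfolding m[symmetric] map_map
    by (rule map_cong) (use b sq in \<open>auto simp: bij_betw_def\<close>)
  moreover have "adj (?\<psi> u) (?\<psi> v) \<longleftrightarrow> adj u v" if "u \<in> region q'" "v \<in> region q'" for u v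
  proof -
    have "?\<psi> u \<in> region q" "?\<psi> v \<in> region q" "\<phi> (?\<psi> u) = u" "\<phi> (?\<psi> v) = v"
      using b that by (auto simp: bij_betw_def inv_into_into f_inv_into_f)
    then show ?thesis using assms unfolding liso_def by metis
  qed
  ultimately show ?thesis unfolding liso_def using bij_betw_inv_into[OF b] by simp
qed

lemma liso_set: "liso \<phi> q q' \<Longrightarrow> u \<in> region q \<Longrightarrow> \<phi> u \<in> set q' \<longleftrightarrow> u \<in> set q"
proof -
  assume a: "liso \<phi> q q'" and u: "u \<in> region q"
  have "set q' = \<phi> ` set q" "inj_on \<phi> (region q)" "set q \<subseteq> region q"
    using a by (auto simp: liso_def bij_betw_def region_def)
  then show ?thesis using u by (auto dest: inj_onD)
qed

lemma region_nbr:
  assumes "q = x # s" "u \<in> region q" "u \<notin> set q" "adj u v" shows "v \<in> region q"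
  using assms component_nbr[of u "set s" x v] by (auto simp: region_def)

text \<open>The path never leaves a vertex of \<open>q\<close>, so \<open>region_nbr\<close> keeps
  it inside the region, where \<open>\<phi>\<close> preserves adjacency and clique
  membership.\<close>

lemma liso_Cl:
  assumes "liso \<phi> q q'" "q = x # s" "y \<in> region q" "z \<in> Cl (set q) y"
  shows "z \<in> region q \<and> \<phi> z \<in> Cl (set q') (\<phi> y)"
  using assms(4)
proof (induction rule: Cl_induct)
  case base show ?case using assms by simp
next
  case (step u v)
  have v: "v \<in> region q" using step region_nbr[OF assms(2)] by blast
  have "\<phi> u \<notin> set q'" using liso_set[OF assms(1)] step by blast
  moreover have "adj (\<phi> u) (\<phi> v)" using assms(1) step v by (auto simp: liso_def)
  ultimately show ?case using v step by (auto intro: Cl_step)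
qed

text \<open>Kids, patterns and restrictions are determined by the adjacencies inside the region.
  Fullness of the image and surjectivity onto the smaller region require paths of the target to be
  pulled back along the inverse.\<close>

lemma liso_kid:
  assumes "liso \<phi> q q'" "q = x # s" "oclique q" "q' = x' # s'" "oclique q'" "y \<in> kids q"
  shows "\<phi> y \<in> kids q'" "map (adj y) q = map (adj (\<phi> y)) q'"
    "liso \<phi> (restr q y) (restr q' (\<phi> y))"
proof -
  have b: "bij_betw \<phi> (region q) (region q')" and m: "map \<phi> q = q'"
    and a: "\<And>u v. u \<in> region q \<Longrightarrow> v \<in> region q \<Longrightarrow> adj (\<phi> u) (\<phi> v) \<longleftrightarrow> adj u v"
    using assms(1) by (auto simp: liso_def)
  let ?\<psi> = "inv_into (region q) \<phi>"
  have inv: "liso ?\<psi> q' q" by (rule liso_inv) fact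
  have yd: "y \<in> region q" using kids_in_region(1) assms by blast
  have pd: "\<phi> y \<in> region q'" using b yd by (auto simp: bij_betw_def)
  have py: "?\<psi> (\<phi> y) = y" using b yd by (auto simp: bij_betw_def)
  have pp: "\<phi> (?\<psi> z) = z" "?\<psi> z \<in> region q" if "z \<in> region q'" for z
    using b that by (auto simp: bij_betw_def f_inv_into_f inv_into_into)
  have sq: "set q \<subseteq> region q" "set q' \<subseteq> region q'" by (auto simp: region_def)
  have yq: "y \<notin> set q" "full (set q) y" "adj y x" using assms(2,6) by (auto simp: kids_def)
  have nq: "\<phi> y \<notin> set q'" using liso_set[OF assms(1) yd] yq by blast
  have cl: "z \<in> Cl (set q') (\<phi> y) \<Longrightarrow> ?\<psi> z \<in> Cl (set q) y \<and> z \<in> region q'" for z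
    using liso_Cl[OF inv assms(4) pd, of z] py by simp
  show pat: "map (adj y) q = map (adj (\<phi> y)) q'"
    unfolding m[symmetric] map_map using a yd sq by auto
  have x': "x' = \<phi> x" using m assms by auto
  have full': "full (set q') (\<phi> y)"
    unfolding full_def
  proof (intro ballI impI)
    fix z assume z: "z \<in> set q'" "z \<in> Cl (set q') (\<phi> y)"
    have "?\<psi> z \<in> set q" using liso_set[OF inv, of z] z sq by auto
    then have "adj y (?\<psi> z)" using cl[OF z(2)] yq(2) by (auto simp: full_def)
    then show "adj (\<phi> y) z" using a[OF yd, of "?\<psi> z"] pp[of z] z sq by auto
  qed
  have "x \<in> region q" using assms by (auto simp: region_def)
  then have "adj (\<phi> y) x'" using a[OF yd] yq x' by simp
  then show kid: "\<phi> y \<in> kids q'"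
    using nq full' adj_V assms(4) by (auto simp: kids_def)
  have d1: "region (restr q y) \<subseteq> region q" using kids_in_region(2) assms by blast
  have "\<phi> ` region (restr q y) = region (restr q' (\<phi> y))"
  proof (intro set_eqI iffI)
    fix w assume "w \<in> \<phi> ` region (restr q y)"
    then obtain z where z: "w = \<phi> z" "z \<in> component (set q) y \<or> z \<in> set q \<and> adj y z"
      unfolding region_restr[OF yq(2,1)] by auto
    then consider "z \<in> component (set q) y" | "z \<in> set q" "adj y z" by blast
    then show "w \<in> region (restr q' (\<phi> y))"
      unfolding region_restr[OF full' nq]
    proof cases
      case 1
      then have "z \<in> region q" "\<phi> z \<in> Cl (set q') (\<phi> y)" "\<phi> z \<notin> set q'"
        using liso_Cl[OF assms(1,2) yd, of z] liso_set[OF assms(1), of z] by (auto simp: component_def)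
      then show "w \<in> component (set q') (\<phi> y) \<union> {z \<in> set q'. adj (\<phi> y) z}" using z by (auto simp: component_def)
    next
      case 2
      then have "\<phi> z \<in> set q'" "adj (\<phi> y) (\<phi> z)" using a[OF yd, of z] sq m by auto
      then show "w \<in> component (set q') (\<phi> y) \<union> {z \<in> set q'. adj (\<phi> y) z}" using z by auto
    qed
  next
    fix w assume "w \<in> region (restr q' (\<phi> y))"
    then consider "w \<in> component (set q') (\<phi> y)" | "w \<in> set q'" "adj (\<phi> y) w"
      unfolding region_restr[OF full' nq] by auto
    then show "w \<in> \<phi> ` region (restr q y)"
      unfolding region_restr[OF yq(2,1)]
    proof cases
      case 1
      then have "w \<in> region q'" "?\<psi> w \<in> Cl (set q) y" "?\<psi> w \<notin> set q"
        using cl[of w] liso_set[OF inv, of w] by (auto simp: component_def)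
      then show "w \<in> \<phi> ` (component (set q) y \<union> {z \<in> set q. adj y z})"
        using pp[of w] unfolding component_def by (metis (no_types, lifting) DiffI UnI1 image_eqI)
    next
      case 2
      then have "w \<in> region q'" using sq by auto
      then have "?\<psi> w \<in> set q" "adj y (?\<psi> w)"
        using 2 liso_set[OF inv, of w] a[OF yd, of "?\<psi> w"] pp[of w] by auto
      then show "w \<in> \<phi> ` (component (set q) y \<union> {z \<in> set q. adj y z})"
        using pp[of w] \<open>w \<in> region q'\<close> by (metis (no_types, lifting) UnI2 image_eqI mem_Collect_eq)
    qed
  qed
  then have "bij_betw \<phi> (region (restr q y)) (region (restr q' (\<phi> y)))"
    using bij_betw_subset[OF b d1] by blast
  moreover have "map \<phi> (restr q y) = restr q' (\<phi> y)"
    using filter_map_cong[OF m pat] by (simp add: restr_def)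
  ultimately show "liso \<phi> (restr q y) (restr q' (\<phi> y))"
    unfolding liso_def using d1 a by blast
qed

lemma liso_Cons: "liso \<phi> (x # s) q' \<Longrightarrow> \<exists>x' s'. q' = x' # s'"
  by (auto simp: liso_def)

text \<open>By \<open>liso_kid\<close>, applied to \<open>\<phi>\<close> and to its inverse,
  \<open>\<phi>\<close> is a bijection between the kids that respects patterns and restrictions; so
  the multisets agree by induction on the rounds.\<close>

lemma liso_colour:
  assumes "liso \<phi> q q'" "q \<noteq> []" "oclique q" "oclique q'"
  shows "colour k q = colour k q'"
  using assms
proof (induction k arbitrary: q q')
  case (Suc k)
  obtain x s where q: "q = x # s" using Suc.prems by (cases q) auto
  obtain x' s' where q': "q' = x' # s'" using Suc.prems liso_Cons q by blast
  note K = liso_kid[OF Suc.prems(1) q Suc.prems(3) q' Suc.prems(4)]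
  let ?\<psi> = "inv_into (region q) \<phi>"
  have inv: "liso ?\<psi> q' q" by (rule liso_inv) fact
  note K' = liso_kid[OF inv q' Suc.prems(4) q Suc.prems(3)]
  have b: "bij_betw \<phi> (region q) (region q')" using Suc.prems(1) by (auto simp: liso_def)
  have kd: "kids q \<subseteq> region q" "kids q' \<subseteq> region q'" using kids_in_region(1) Suc.prems q q' by blast+
  have "\<phi> ` kids q = kids q'"
  proof (intro equalityI subsetI)
    fix z assume z: "z \<in> kids q'"
    then have "?\<psi> z \<in> kids q" "\<phi> (?\<psi> z) = z"
      using K'(1) b kd by (auto simp: bij_betw_def f_inv_into_f)
    then show "z \<in> \<phi> ` kids q" by (metis image_eqI)
  qed (use K(1) in auto)
  then have bk: "bij_betw \<phi> (kids q) (kids q')" using bij_betw_subset[OF b kd(1)] by blast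
  have "colour k (restr q y) = colour k (restr q' (\<phi> y))" if "y \<in> kids q" for y
    by (rule Suc.IH[OF K(3)[OF that]])
      (use that K(1)[OF that] kids_V oclique_restr Suc.prems in \<open>auto simp: restr_def\<close>)
  then show ?case using K(2) by (auto intro!: image_mset_bij[OF bk])
qed simp

lemma finite_component: "y \<in> V \<Longrightarrow> finite (component Q y)"
  using component_V finV by (meson finite_subset)

text \<open>Two full vertices of the same component have the same neighbours in the clique, so a local
  isomorphism of the component matches all of its full vertices.\<close>

lemma liso_move:
  assumes "liso \<phi> (restr q y) (restr q' y')" "q = x # s" "q' = x' # s'"
    "oclique q" "oclique q'" "y \<in> kids q" "y' \<in> kids q'" "map (adj y) q = map (adj y') q'"
    "z \<in> kids q" "z \<in> component (set q) y"
  shows "\<phi> z \<in> kids q' \<and> \<phi> z \<in> component (set q') y' \<and> map (adj z) q = map (adj (\<phi> z)) q' \<and>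
    liso \<phi> (restr q z) (restr q' (\<phi> z))"
proof -
  have y: "full (set q) y" "y \<notin> set q" "adj y x" and y': "full (set q') y'" "y' \<notin> set q'" "adj y' x'"
    and z: "full (set q) z" "z \<notin> set q" "adj z x"
    using assms by (auto simp: kids_def)
  have b: "bij_betw \<phi> (region (restr q y)) (region (restr q' y'))"
    and m: "map \<phi> (restr q y) = restr q' y'"
    and a: "\<And>u v. u \<in> region (restr q y) \<Longrightarrow> v \<in> region (restr q y) \<Longrightarrow> adj (\<phi> u) (\<phi> v) \<longleftrightarrow> adj u v"
    using assms(1) by (auto simp: liso_def)
  have nz: "adj z w \<longleftrightarrow> adj y w" if "w \<in> set q" for w
    by (rule full_adj_eq) (use y z assms that in auto)
  have pz: "map (adj z) q = map (adj y) q" using nz by auto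
  have fz: "filter (adj z) q = filter (adj y) q" using nz by (auto intro: filter_cong)
  have zd: "z \<in> region (restr q y)" using region_restr[OF y(1,2)] assms by auto
  have sr: "set (filter (adj y) q) \<subseteq> region (restr q y)" by (auto simp: region_def restr_def)
  have setK: "set (filter (adj y') q') = \<phi> ` set (filter (adj y) q)"
    using m by (metis list.inject list.set_map list.simps(9) restr_def)
  \<comment> \<open>An image in \<open>q'\<close> would be a kept member of \<open>q'\<close>, hence
    the image of a kept member of \<open>q\<close>; injectivity would then put \<open>z\<close> into
    \<open>q\<close>.\<close>
  have nq: "\<phi> z \<notin> set q'"
  proof
    assume "\<phi> z \<in> set q'"
    moreover have "\<phi> z \<in> region (restr q' y')" using b zd by (auto simp: bij_betw_def)
    ultimately have "\<phi> z \<in> \<phi> ` set (filter (adj y) q)"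
      unfolding region_restr[OF y'(1,2)] setK[symmetric] by (auto simp: component_def)
    then have "z \<in> set (filter (adj y) q)" using b zd sr by (auto simp: bij_betw_def dest: inj_onD)
    then show False using z by auto
  qed
  have zc: "\<phi> z \<in> component (set q') y'"
    using b zd nq region_restr[OF y'(1,2)] by (auto simp: bij_betw_def)
  have ak: "adj (\<phi> z) w" if w: "w \<in> set q'" "adj y' w" for w
  proof -
    have "w \<in> set (filter (adj y') q')" using w by simp
    then obtain u where "u \<in> set (filter (adj y) q)" "w = \<phi> u" unfolding setK by blast
    then show ?thesis using a[OF zd, of u] sr nz by auto
  qed
  have full': "full (set q') (\<phi> z)"
    unfolding full_def Cl_eq[OF zc] using y' ak by (auto simp: full_def)
  have nz': "adj (\<phi> z) w \<longleftrightarrow> adj y' w" if "w \<in> set q'" for w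
    by (rule full_adj_eq) (use y' full' zc that in auto)
  have fz': "filter (adj (\<phi> z)) q' = filter (adj y') q'" using nz' by (auto intro: filter_cong)
  have kid: "\<phi> z \<in> kids q'"
    using nq full' nz'[of x'] y' adj_V assms(3) by (auto simp: kids_def)
  have d: "region (restr q z) = region (restr q y)"
    unfolding region_restr[OF y(1,2)] region_restr[OF z(1,2)] using component_eq[OF assms(10)] nz by auto
  have d': "region (restr q' (\<phi> z)) = region (restr q' y')"
    unfolding region_restr[OF y'(1,2)] region_restr[OF full' nq] using component_eq[OF zc] nz' by auto
  have "map \<phi> (restr q z) = restr q' (\<phi> z)" using m fz fz' by (simp add: restr_def)
  then have "liso \<phi> (restr q z) (restr q' (\<phi> z))" unfolding liso_def d d' using b a by blast
  moreover have "map (adj z) q = map (adj (\<phi> z)) q'"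
    using pz assms(8) nz' by (simp cong: map_cong)
  ultimately show ?thesis using kid zc by blast
qed

end

section \<open>Colours determine regions\<close>

text \<open>The existence of full vertices is what the correctness of the colours takes from the
  tree representation.\<close>

locale helly_graph = sgraph +
  assumes helly: "oclique q \<Longrightarrow> y \<in> V \<Longrightarrow> y \<notin> set q \<Longrightarrow> \<exists>z\<in>component (set q) y. full (set q) z"
begin

text \<open>A path from \<open>x\<close> that ends outside the clique stays, after its last visit to
  \<open>x\<close>, in the component of a neighbour of \<open>x\<close>. The full vertex supplied
  there by \<open>helly\<close> is adjacent to \<open>x\<close>, hence a kid.\<close>

lemma region_kids:
  assumes "oclique (x # s)"
  shows "region (x # s) = set (x # s) \<union> (\<Union>y\<in>kids (x # s). component (set (x # s)) y)"
proof (intro equalityI subsetI)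
  fix z assume z: "z \<in> region (x # s)"
  have xs: "x \<notin> set s" "x \<in> V" using assms oclique_distinct by (fastforce, simp add: oclique_Cons)
  show "z \<in> set (x # s) \<union> (\<Union>y\<in>kids (x # s). component (set (x # s)) y)"
  proof (cases "z \<in> set (x # s)")
    case False
    then have "z \<in> Cl (set s) x" using z by (auto simp: region_def component_def)
    then have "z \<in> set (x # s) \<or> (\<exists>u. u \<notin> set (x # s) \<and> adj u x \<and> z \<in> component (set (x # s)) u)"
    proof (induction rule: Cl_induct)
      case (step u v)
      show ?case
      proof (cases "v \<in> set (x # s)")
        case v: False
        show ?thesis
        proof (cases "u = x")
          case True
          then have "v \<notin> set (x # s) \<and> adj v x \<and> v \<in> component (set (x # s)) v"
            using v step adj_sym component_refl by auto
          then show ?thesis by blast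
        next
          case False
          then obtain w where "w \<notin> set (x # s)" "adj w x" "u \<in> component (set (x # s)) w"
            using step by auto
          then show ?thesis using component_nbr step.hyps v by blast
        qed
      qed blast
    qed simp
    then obtain u where u: "u \<notin> set (x # s)" "adj u x" "z \<in> component (set (x # s)) u" using False by blast
    have "u \<in> V" using u adj_V by blast
    then obtain y where y: "y \<in> component (set (x # s)) u" "full (set (x # s)) y"
      using helly[OF assms] u by blast
    have "x \<in> Cl (set (x # s)) y" unfolding Cl_eq[OF y(1)] by (rule Cl_step[of u]) (use u in auto)
    then have "adj y x" using y(2) by (auto simp: full_def)
    then have "y \<in> kids (x # s)" using y component_V[OF \<open>u \<in> V\<close>] by (auto simp: kids_def component_def)
    moreover have "z \<in> component (set (x # s)) y" using component_eq[OF y(1)] u by simp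
    ultimately show ?thesis by blast
  qed blast
next
  fix z assume "z \<in> set (x # s) \<union> (\<Union>y\<in>kids (x # s). component (set (x # s)) y)"
  then show "z \<in> region (x # s)" using kid_component_subset[OF assms] by (fastforce simp: region_def)
qed

definition comps :: "nat list \<Rightarrow> nat set set" where
  "comps q = component (set q) ` kids q"

lemma comps_mem: "E \<in> comps q \<Longrightarrow> y \<in> E \<Longrightarrow> y \<notin> set q \<and> E = component (set q) y"
  unfolding comps_def using component_eq by (auto simp: component_def)

lemma kids_comps: "kids q = (\<Union>E\<in>comps q. kids q \<inter> E)"
proof -
  have "y \<in> component (set q) y" if "y \<in> kids q" for y
    using that by (auto simp: kids_def component_refl)
  then show ?thesis by (auto simp: comps_def)
qed

lemma finite_comps: "finite (comps q)"
  unfolding comps_def using finite_kids by simp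

text \<open>Equal colours allow the components left by the two heads to be matched; the induction
  hypothesis gives an isomorphism for each matched pair, and these agree on the clique and glue. The
  bound \<open>k\<close> on the component drops because the components of kids are strictly
  smaller.\<close>

lemma colour_liso:
  assumes "colour k q = colour k q'" "length q = length q'" "q \<noteq> []" "oclique q" "oclique q'"
    "card (component (set (tl q)) (hd q)) \<le> k"
  shows "\<exists>\<phi>. liso \<phi> q q'"
  using assms
proof (induction k arbitrary: q q')
  \<comment> \<open>Vacuous: the component contains the head.\<close>
  case 0
  obtain x s where q: "q = x # s" using 0 by (cases q) auto
  have "x \<in> component (set s) x" "finite (component (set s) x)"
    using 0 oclique_distinct[of q] q by (auto intro!: component_refl finite_component simp: oclique_Cons)
  then show ?case using 0 q by auto
next
  case (Suc k)
  obtain x s where q: "q = x # s" using Suc.prems by (cases q) auto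
  obtain x' s' where q': "q' = x' # s'" using Suc.prems q by (cases q') auto
  define \<tau> where "\<tau> y = (map (adj y) q, colour k (restr q y))" for y
  define \<tau>' where "\<tau>' y = (map (adj y) q', colour k (restr q' y))" for y
  have key_mset: "image_mset \<tau> (mset_set (kids q)) = image_mset \<tau>' (mset_set (kids q'))"
    using Suc.prems(1) by (simp add: \<tau>_def[abs_def] \<tau>'_def[abs_def])
  have xV: "x \<in> V" "x \<notin> set s" using Suc.prems q oclique_distinct[of q] by (auto simp: oclique_Cons)
  have small: "card (component (set q) y) \<le> k" if "y \<in> kids q" for y
  proof -
    have "component (set q) y \<subset> component (set s) x"
      using kid_component_subset[of x s y] Suc.prems q that component_refl[OF xV(2)] by auto
    then have "card (component (set q) y) < card (component (set s) x)"
      by (rule psubset_card_mono[OF finite_component[OF xV(1)]])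
    then show ?thesis using Suc.prems(6) q by simp
  qed
  have IH: "\<exists>\<phi>. liso \<phi> (restr q y) (restr q' y')"
    if y: "y \<in> kids q" "y' \<in> kids q'" "\<tau> y = \<tau>' y'" for y y'
  proof (rule Suc.IH)
    show "colour k (restr q y) = colour k (restr q' y')" using y by (simp add: \<tau>_def \<tau>'_def)
    have "map (adj y) q = map (adj y') q'" using y by (simp add: \<tau>_def \<tau>'_def)
    then have "length (filter id (map (adj y) q)) = length (filter id (map (adj y') q'))" by simp
    then show "length (restr q y) = length (restr q' y')"
      by (simp add: restr_def filter_map o_def)
    show "restr q y \<noteq> []" by (simp add: restr_def)
    show "oclique (restr q y)" "oclique (restr q' y')" using Suc.prems oclique_restr kids_V y by blast+
    have "component (set (tl (restr q y))) (hd (restr q y)) = component (set q) y"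
      using component_restr[of q y] y by (simp add: kids_def restr_def)
    then show "card (component (set (tl (restr q y))) (hd (restr q y))) \<le> k" using small y by simp
  qed
  define T where "T E = image_mset \<tau> (mset_set (kids q \<inter> E))" for E
  define T' where "T' E = image_mset \<tau>' (mset_set (kids q' \<inter> E))" for E
  have memT: "c \<in># T E \<longleftrightarrow> (\<exists>y\<in>kids q \<inter> E. c = \<tau> y)" for c E
    unfolding T_def using finite_kids by auto
  have memT': "c \<in># T' E \<longleftrightarrow> (\<exists>y\<in>kids q' \<inter> E. c = \<tau>' y)" for c E
    unfolding T'_def using finite_kids by auto
  have sumT: "(\<Sum>E\<in>comps q. T E) = image_mset \<tau> (mset_set (kids q))"
  proof -
    have "mset_set (kids q) = (\<Sum>E\<in>comps q. mset_set (kids q \<inter> E))"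
      by (subst kids_comps, rule mset_set_disjoint_UN)
        (use finite_comps finite_kids comps_mem in \<open>auto, blast+\<close>)
    then show ?thesis by (simp add: T_def image_mset_sum)
  qed
  have sumT': "(\<Sum>E\<in>comps q'. T' E) = image_mset \<tau>' (mset_set (kids q'))"
  proof -
    have "mset_set (kids q') = (\<Sum>E\<in>comps q'. mset_set (kids q' \<inter> E))"
      by (subst kids_comps, rule mset_set_disjoint_UN)
        (use finite_comps finite_kids comps_mem in \<open>auto, blast+\<close>)
    then show ?thesis by (simp add: T'_def image_mset_sum)
  qed
  have ne: "T E \<noteq> {#}" if E: "E \<in> comps q" for E
  proof -
    obtain y where "y \<in> kids q" "E = component (set q) y" using E by (auto simp: comps_def)
    then have "\<tau> y \<in># T E" unfolding memT by (auto simp: kids_def component_refl)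
    then show ?thesis by auto
  qed
  have ne': "T' E \<noteq> {#}" if E: "E \<in> comps q'" for E
  proof -
    obtain y where "y \<in> kids q'" "E = component (set q') y" using E by (auto simp: comps_def)
    then have "\<tau>' y \<in># T' E" unfolding memT' by (auto simp: kids_def component_refl)
    then show ?thesis by auto
  qed
  \<comment> \<open>One common colour yields, by the induction hypothesis, an isomorphism between
    regions that contain \<open>E\<close> and \<open>E'\<close> with all their full vertices.
    \<open>liso_move\<close> and \<open>liso_colour\<close> then equate the contributions of all
    these vertices.\<close>
  have share: "T E = T' E'"
    if E: "E \<in> comps q" "E' \<in> comps q'" "c \<in># T E" "c \<in># T' E'" for E E' c
  proof -
    obtain y y' where y: "y \<in> kids q" "y \<in> E" "c = \<tau> y" "y' \<in> kids q'" "y' \<in> E'" "c = \<tau>' y'"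
      using E memT memT' by auto
    have Ey: "E = component (set q) y" "E' = component (set q') y'" using comps_mem E y by blast+
    obtain \<phi> where \<phi>: "liso \<phi> (restr q y) (restr q' y')" using IH[of y y'] y by auto
    have pat: "map (adj y) q = map (adj y') q'" using y by (simp add: \<tau>_def \<tau>'_def)
    let ?\<psi> = "inv_into (region (restr q y)) \<phi>"
    have inv: "liso ?\<psi> (restr q' y') (restr q y)" by (rule liso_inv) fact
    note M = liso_move[OF \<phi> q q' Suc.prems(4,5) y(1,4) pat]
    note M' = liso_move[OF inv q' q Suc.prems(5,4) y(4,1) pat[symmetric]]
    have b: "bij_betw \<phi> (region (restr q y)) (region (restr q' y'))" using \<phi> by (auto simp: liso_def)
    have d: "region (restr q y) = E \<union> {z \<in> set q. adj y z}"
      "region (restr q' y') = E' \<union> {z \<in> set q'. adj y' z}"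
      unfolding Ey by (rule region_restr; use y in \<open>simp add: kids_def\<close>)+
    have "\<phi> ` (kids q \<inter> E) = kids q' \<inter> E'"
    proof (intro equalityI subsetI)
      fix z assume z: "z \<in> kids q' \<inter> E'"
      then have "?\<psi> z \<in> kids q \<inter> E" "\<phi> (?\<psi> z) = z"
        using M'[of z] Ey b d by (auto simp: bij_betw_def f_inv_into_f)
      then show "z \<in> \<phi> ` (kids q \<inter> E)" by (metis image_eqI)
    qed (use M Ey in auto)
    then have bk: "bij_betw \<phi> (kids q \<inter> E) (kids q' \<inter> E')"
      using bij_betw_subset[OF b, of "kids q \<inter> E"] d by auto
    have "\<tau>' (\<phi> z) = \<tau> z" if "z \<in> kids q \<inter> E" for z
    proof -
      have m: "liso \<phi> (restr q z) (restr q' (\<phi> z))" "\<phi> z \<in> kids q'" "map (adj z) q = map (adj (\<phi> z)) q'"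
        using M[of z] that Ey by auto
      have "colour k (restr q z) = colour k (restr q' (\<phi> z))"
        by (rule liso_colour[OF m(1)])
          (use that m(2) kids_V oclique_restr Suc.prems in \<open>auto simp: restr_def\<close>)
      then show ?thesis using m by (simp add: \<tau>_def \<tau>'_def)
    qed
    then show ?thesis unfolding T_def T'_def by (intro image_mset_bij[OF bk])
  qed
  have "\<exists>h. bij_betw h (comps q) (comps q') \<and> (\<forall>E\<in>comps q. T' (h E) = T E)"
    by (rule match_blocks) (use finite_comps ne ne' share sumT sumT' key_mset in auto)
  then obtain h where h: "bij_betw h (comps q) (comps q')" "\<And>E. E \<in> comps q \<Longrightarrow> T' (h E) = T E"
    by blast
  \<comment> \<open>Any two kids with a common colour may represent the matched components
    \<open>E\<close> and \<open>h E\<close>.\<close>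
  define P where "P E y y' \<phi> \<longleftrightarrow> y \<in> kids q \<and> y \<in> E \<and> y' \<in> kids q' \<and> y' \<in> h E \<and>
      map (adj y) q = map (adj y') q' \<and> liso \<phi> (restr q y) (restr q' y')" for E y y' \<phi>
  have "\<exists>p. P E (fst p) (fst (snd p)) (snd (snd p))" if E: "E \<in> comps q" for E
  proof -
    obtain c where c: "c \<in># T E" using ne[OF E] by fastforce
    then have "c \<in># T' (h E)" using h(2)[OF E] by simp
    then obtain y y' where y: "y \<in> kids q" "y \<in> E" "c = \<tau> y" "y' \<in> kids q'" "y' \<in> h E" "c = \<tau>' y'"
      using c memT memT' by auto
    then have "map (adj y) q = map (adj y') q'" by (simp add: \<tau>_def \<tau>'_def)
    moreover obtain \<phi> where "liso \<phi> (restr q y) (restr q' y')" using IH[of y y'] y by auto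
    ultimately have "P E y y' \<phi>" using y by (simp add: P_def)
    then show ?thesis by (intro exI[of _ "(y, y', \<phi>)"]) simp
  qed
  then obtain p where p: "\<And>E. E \<in> comps q \<Longrightarrow> P E (fst (p E)) (fst (snd (p E))) (snd (snd (p E)))"
    by metis
  define ky where "ky E = fst (p E)" for E
  define ky' where "ky' E = fst (snd (p E))" for E
  define \<phi> where "\<phi> E = snd (snd (p E))" for E
  have K: "ky E \<in> kids q" "ky E \<in> E" "ky' E \<in> kids q'" "ky' E \<in> h E"
    "map (adj (ky E)) q = map (adj (ky' E)) q'" "liso (\<phi> E) (restr q (ky E)) (restr q' (ky' E))"
    if "E \<in> comps q" for E
    using p[OF that] by (auto simp: P_def ky_def ky'_def \<phi>_def)
  have hE: "h E \<in> comps q'" if "E \<in> comps q" for E using h(1) that by (auto simp: bij_betw_def)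
  have region_E: "region (restr q (ky E)) = E \<union> {z \<in> set q. adj (ky E) z}" if "E \<in> comps q" for E
    using region_restr[of q "ky E"] K(1,2)[OF that] comps_mem[OF that] by (auto simp: kids_def)
  have region_E': "region (restr q' (ky' E)) = h E \<union> {z \<in> set q'. adj (ky' E) z}" if "E \<in> comps q" for E
    using region_restr[of q' "ky' E"] K(3,4)[OF that] comps_mem[OF hE[OF that]] by (auto simp: kids_def)
  have dist: "distinct q" "distinct q'" using Suc.prems oclique_distinct by auto
  \<comment> \<open>On the cliques the map is forced, position by position.\<close>
  define f where "f u = the (map_of (zip q q') u)" for u
  have fq: "map f q = q'" unfolding f_def using Suc.prems(2) dist
    by (intro nth_equalityI) (auto simp: map_of_zip_nth)
  have bf: "bij_betw f (set q) (set q')"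
    using fq dist by (metis bij_betw_def distinct_map list.set_map)
  have patf: "adj (ky E) z \<longleftrightarrow> adj (ky' E) (f z)" if "E \<in> comps q" "z \<in> set q" for E z
  proof -
    have "map (adj (ky E)) q = map (\<lambda>z. adj (ky' E) (f z)) q"
      using K(5)[OF that(1)] fq by (metis (mono_tags, lifting) comp_apply list.map_comp map_eq_conv)
    then show ?thesis using that by simp
  qed
  \<comment> \<open>Both maps send the kept members of \<open>q\<close> to the kept members of
    \<open>q'\<close> in the same order, so the chosen isomorphisms cannot disagree on the
    clique.\<close>
  have phiK: "\<phi> E z = f z" if "E \<in> comps q" "z \<in> set q" "adj (ky E) z" for E z
  proof -
    have "map f (filter (adj (ky E)) q) = filter (adj (ky' E)) q'"
      by (rule filter_map_cong[OF fq K(5)[OF that(1)]])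
    moreover have "map (\<phi> E) (filter (adj (ky E)) q) = filter (adj (ky' E)) q'"
      using K(6)[OF that(1)] by (auto simp: liso_def restr_def)
    ultimately have "map f (filter (adj (ky E)) q) = map (\<phi> E) (filter (adj (ky E)) q)" by simp
    then show ?thesis using that by auto
  qed
  have phiE: "bij_betw (\<phi> E) E (h E)" if E: "E \<in> comps q" for E
  proof -
    have b: "bij_betw (\<phi> E) (region (restr q (ky E))) (region (restr q' (ky' E)))"
      using K(6)[OF E] by (auto simp: liso_def)
    have im: "\<phi> E ` {z \<in> set q. adj (ky E) z} = {z \<in> set q'. adj (ky' E) z}"
    proof -
      have "\<phi> E ` {z \<in> set q. adj (ky E) z} = f ` {z \<in> set q. adj (ky E) z}"
        using phiK[OF E] by (auto intro: image_cong)
      also have "\<dots> = {z \<in> f ` set q. adj (ky' E) z}" using patf[OF E] by auto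
      finally show ?thesis using bf by (simp add: bij_betw_def)
    qed
    have "E \<inter> {z \<in> set q. adj (ky E) z} = {}" "h E \<inter> {z \<in> set q'. adj (ky' E) z} = {}"
      using comps_mem[OF E] comps_mem[OF hE[OF E]] by auto
    then have 1: "E = region (restr q (ky E)) - {z \<in> set q. adj (ky E) z}"
      "h E = region (restr q' (ky' E)) - {z \<in> set q'. adj (ky' E) z}"
      using region_E[OF E] region_E'[OF E] by auto
    have "\<phi> E ` (region (restr q (ky E)) - {z \<in> set q. adj (ky E) z}) =
        \<phi> E ` region (restr q (ky E)) - \<phi> E ` {z \<in> set q. adj (ky E) z}"
      by (rule inj_on_image_set_diff[where C = "region (restr q (ky E))"])
        (use b region_E[OF E] in \<open>auto simp: bij_betw_def\<close>)
    then have "\<phi> E ` E = h E" using 1 im b by (simp add: bij_betw_def)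
    moreover have "inj_on (\<phi> E) E" using b region_E[OF E] by (auto simp: bij_betw_def inj_on_Un)
    ultimately show ?thesis by (simp add: bij_betw_def)
  qed
  \<comment> \<open>Distinct components are disjoint, so \<open>component (set q) u\<close> recovers
    the one that contains \<open>u\<close>.\<close>
  define F where "F u = (if u \<in> set q then f u else \<phi> (component (set q) u) u)" for u
  have FE: "F u = \<phi> E u" if "E \<in> comps q" "u \<in> E" for E u
    using comps_mem[OF that] by (auto simp: F_def)
  have Fq: "F u = f u" if "u \<in> set q" for u using that by (simp add: F_def)
  have D: "region q = set q \<union> \<Union>(comps q)" "region q' = set q' \<union> \<Union>(comps q')"
    using region_kids[of x s] region_kids[of x' s'] Suc.prems q q' by (auto simp: comps_def)
  have bE: "bij_betw F E (h E)" if "E \<in> comps q" for E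
    using phiE[OF that] FE[OF that] by (simp cong: bij_betw_cong)
  have "bij_betw F (\<Union>(comps q)) (\<Union>(h ` comps q))"
  proof -
    have inj: "inj_on F (\<Union>(comps q))"
    proof (rule inj_onI)
      fix u v assume uv: "u \<in> \<Union>(comps q)" "v \<in> \<Union>(comps q)" "F u = F v"
      then obtain E1 E2 where E: "E1 \<in> comps q" "u \<in> E1" "E2 \<in> comps q" "v \<in> E2" by auto
      have "F u \<in> h E1" "F v \<in> h E2" using bE E by (auto simp: bij_betw_def)
      then have "h E1 = h E2" using uv comps_mem[OF hE] E by metis
      then have "E1 = E2" using h(1) E by (auto simp: bij_betw_def dest: inj_onD)
      then show "u = v" using bE[of E1] E uv by (auto simp: bij_betw_def dest: inj_onD)
    qed
    have "F ` \<Union>(comps q) = \<Union>(h ` comps q)" using bE by (auto simp: bij_betw_def image_Union)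
    then show ?thesis using inj by (simp add: bij_betw_def)
  qed
  then have b1: "bij_betw F (\<Union>(comps q)) (\<Union>(comps q'))" using h(1) by (simp add: bij_betw_def)
  have b2: "bij_betw F (set q) (set q')" using bf Fq by (simp cong: bij_betw_cong)
  have bF: "bij_betw F (region q) (region q')"
    unfolding D by (rule bij_betw_combine[OF b2 b1]) (use comps_mem in blast)
  have adjE: "adj (F u) (F v) \<longleftrightarrow> adj u v" if E: "E \<in> comps q" "u \<in> E" and v: "v \<in> region q" for E u v
  proof -
    have hu: "F u \<in> h E" using bE E by (auto simp: bij_betw_def)
    consider "v \<in> E" | E2 where "E2 \<in> comps q" "v \<in> E2" "E2 \<noteq> E" | "v \<in> set q" "adj (ky E) v"
      | "v \<in> set q" "\<not> adj (ky E) v"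
      using v D by auto
    then show ?thesis
    proof cases
      case 1
      then show ?thesis using K(6)[OF E(1)] E FE region_E[OF E(1)] by (auto simp: liso_def)
    next
      case (2 E2)
      have "\<not> adj u v"
        using 2 E comps_mem[OF E] comps_mem[OF 2(1,2)] component_nbr[of u "set q" u v] component_refl[of u]
          comps_mem[OF E(1), of v]
        by (metis comps_mem)
      moreover have "F v \<in> h E2" using bE 2 by (auto simp: bij_betw_def)
      moreover have "h E2 \<noteq> h E" using h(1) 2 E by (auto simp: bij_betw_def dest: inj_onD)
      ultimately show ?thesis
        using hu comps_mem[OF hE[OF E(1)] hu] comps_mem[OF hE[OF 2(1)], of "F v"]
          component_nbr[of "F u" "set q'" "F u" "F v"] component_refl[of "F u"] comps_mem[OF hE[OF E(1)], of "F v"]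
        by metis
    next
      case 3
      have "u \<in> region (restr q (ky E))" "v \<in> region (restr q (ky E))" using region_E[OF E(1)] E 3 by auto
      then have "adj (\<phi> E u) (\<phi> E v) \<longleftrightarrow> adj u v" using K(6)[OF E(1)] unfolding liso_def by blast
      then show ?thesis using FE[OF E] phiK[OF E(1) 3] Fq[OF 3(1)] by simp
    next
      \<comment> \<open>A clique member that the full vertex \<open>ky E\<close> misses is not
        attached to \<open>E\<close> at all; the equal patterns transfer this to
        \<open>ky' E\<close> and \<open>h E\<close>.\<close>
      case 4
      have "\<not> adj u v"
      proof
        assume "adj u v"
        then have "v \<in> Cl (set q) (ky E)"
          using comps_mem[OF E] comps_mem[OF E(1) K(2)[OF E(1)]] E
          by (metis Cl_step DiffD1 component_def)
        then show False using K(1)[OF E(1)] 4 by (auto simp: kids_def full_def)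
      qed
      moreover have "\<not> adj (F u) (F v)"
      proof
        assume "adj (F u) (F v)"
        then have "F v \<in> Cl (set q') (ky' E)"
          using comps_mem[OF hE[OF E(1)] hu] comps_mem[OF hE[OF E(1)] K(4)[OF E(1)]] hu
          by (metis Cl_step DiffD1 component_def)
        moreover have "F v \<in> set q'" using b2 4 by (auto simp: bij_betw_def)
        ultimately have "adj (ky' E) (F v)" using K(3)[OF E(1)] by (auto simp: kids_def full_def)
        then show False using patf[OF E(1) 4(1)] 4 Fq by auto
      qed
      ultimately show ?thesis by simp
    qed
  qed
  have adjF: "adj (F u) (F v) \<longleftrightarrow> adj u v" if uv: "u \<in> region q" "v \<in> region q" for u v
  proof -
    consider E where "E \<in> comps q" "u \<in> E" | E where "E \<in> comps q" "v \<in> E" | "u \<in> set q" "v \<in> set q"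
      using uv D by auto
    then show ?thesis
    proof cases
      case 3
      then have "F u \<in> set q'" "F v \<in> set q'" "F u = F v \<longleftrightarrow> u = v"
        using b2 by (auto simp: bij_betw_def dest: inj_onD)
      then show ?thesis using 3 oclique_adj Suc.prems by simp
    qed (use adjE uv adj_commute in blast)+
  qed
  have "map F q = q'" using fq Fq by (metis map_cong)
  then show ?case using bF adjF unfolding liso_def by blast
qed

theorem colour_iff_liso:
  assumes "length q = length q'" "q \<noteq> []" "oclique q" "oclique q'" "card V \<le> k"
  shows "colour k q = colour k q' \<longleftrightarrow> (\<exists>\<phi>. liso \<phi> q q')"
proof
  assume "colour k q = colour k q'"
  have "hd q \<in> V" using assms by (cases q) (auto simp: oclique_Cons)
  then have "card (component (set (tl q)) (hd q)) \<le> card V" by (intro card_mono finV component_V)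
  then show "\<exists>\<phi>. liso \<phi> q q'" using colour_liso \<open>colour k q = colour k q'\<close> assms by (meson le_trans)
qed (use liso_colour assms in blast)

end

section \<open>Intersection graphs of subtrees\<close>

text \<open>A tree is given by a parent map and a rank, and a subtree by a top below which the set
  is closed under parents. Ranks are real because subdividing an edge needs a value strictly between
  those of its ends.\<close>

definition subtree :: "('a \<Rightarrow> 'a) \<Rightarrow> ('a \<Rightarrow> real) \<Rightarrow> 'a set \<Rightarrow> 'a \<Rightarrow> bool" where
  "subtree par rk A a \<longleftrightarrow> finite A \<and> a \<in> A \<and> (\<forall>x\<in>A. x \<noteq> a \<longrightarrow> par x \<in> A \<and> rk (par x) < rk x)"

lemma subtree_rank:
  assumes "subtree par rk A a" "x \<in> A" "x \<noteq> a"
  shows "rk a < rk x"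
proof -
  have f: "finite A" "A \<noteq> {}" using assms by (auto simp: subtree_def)
  obtain y where y: "is_arg_min rk (\<lambda>z. z \<in> A) y"
    using ex_is_arg_min_if_finite[OF f] by blast
  have m: "z = a" if "z \<in> A" "rk z \<le> rk y" for z
    using assms(1) that y unfolding subtree_def is_arg_min_def by (meson less_le_trans)
  have "y = a" using m[of y] y by (auto simp: is_arg_min_def)
  then show ?thesis using m[of x] assms by force
qed

text \<open>If the common node of least rank were the top of neither subtree, its parent would also
  be common and have smaller rank.\<close>

lemma subtree_meet:
  assumes "subtree par rk A a" "subtree par rk B b" "A \<inter> B \<noteq> {}"
  shows "a \<in> B \<or> b \<in> A"
proof -
  have "finite (A \<inter> B)" using assms by (auto simp: subtree_def)
  then obtain x where x: "is_arg_min rk (\<lambda>z. z \<in> A \<inter> B) x"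
    using ex_is_arg_min_if_finite assms(3) by blast
  then have "x \<in> A \<inter> B" by (auto simp: is_arg_min_def)
  moreover have "x = a \<or> x = b"
  proof (rule ccontr)
    assume "\<not> (x = a \<or> x = b)"
    then have "par x \<in> A \<inter> B" "rk (par x) < rk x"
      using assms(1,2) \<open>x \<in> A \<inter> B\<close> by (auto simp: subtree_def)
    then show False using x by (auto simp: is_arg_min_def)
  qed
  ultimately show ?thesis by auto
qed

lemma subtree_Un:
  assumes "subtree par rk A a" "subtree par rk B b" "A \<inter> B \<noteq> {}"
  shows "\<exists>c. subtree par rk (A \<union> B) c"
  using subtree_meet[OF assms] assms(1,2) unfolding subtree_def by (metis Un_iff finite_UnI)

text \<open>The top \<open>t i\<close> of greatest rank works. If it is not obtained in
  \<open>S j\<close> directly, then \<open>t j\<close> lies in \<open>S i\<close> and so has at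
  least the rank of \<open>t i\<close>; maximality makes the two tops equal.\<close>

lemma subtree_Helly:
  assumes "finite I" "I \<noteq> {}" "\<And>i. i \<in> I \<Longrightarrow> subtree par rk (S i) (t i)"
    "\<And>i j. i \<in> I \<Longrightarrow> j \<in> I \<Longrightarrow> S i \<inter> S j \<noteq> {}"
  shows "\<exists>i\<in>I. \<forall>j\<in>I. t i \<in> S j"
proof -
  obtain i where i: "is_arg_max (\<lambda>i. rk (t i)) (\<lambda>i. i \<in> I) i"
    using ex_is_arg_min_if_finite[OF assms(1,2), of "\<lambda>i. - rk (t i)"]
    by (auto simp: is_arg_min_def is_arg_max_def)
  then have iI: "i \<in> I" and mx: "\<And>j. j \<in> I \<Longrightarrow> rk (t j) \<le> rk (t i)"
    by (auto simp: is_arg_max_def not_less)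
  have "t i \<in> S j" if j: "j \<in> I" for j
  proof -
    consider "t i \<in> S j" | "t j \<in> S i" using subtree_meet assms(3,4) iI j by metis
    then show ?thesis
    proof cases
      case 2
      then have "t j = t i" using subtree_rank[OF assms(3)[OF iI] 2] mx[OF j] by force
      then show ?thesis using assms(3)[OF j] by (auto simp: subtree_def)
    qed
  qed
  then show ?thesis using iI by blast
qed

lemma (in sgraph) length_oclique: "oclique q \<Longrightarrow> length q \<le> card V"
  using oclique_distinct[of q] finV card_mono[of V "set q"] by (simp add: oclique_def distinct_card)

lemma (in sgraph) finite_oclique: "finite {q. oclique q}"
proof -
  have "{q. oclique q} \<subseteq> {q. set q \<subseteq> V \<and> length q \<le> card V}"
    using length_oclique by (auto simp: oclique_def)
  then show ?thesis using finite_lists_length_le[OF finV] finite_subset by blast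
qed

lemma card_lists_le:
  assumes "finite B" "card B \<le> P"
  shows "card {q. set q \<subseteq> B \<and> length q \<le> P} \<le> 2 ^ ((P + 1) * (P + 1))"
proof -
  have "card {q. set q \<subseteq> B \<and> length q \<le> P} = (\<Sum>i\<le>P. card B ^ i)"
    by (rule card_lists_length_le[OF assms(1)])
  also have "\<dots> \<le> (\<Sum>i\<le>P. (P + 1) ^ P)"
  proof (rule sum_mono)
    fix i assume "i \<in> {..P}"
    have "card B ^ i \<le> (P + 1) ^ i" using assms by (intro power_mono) auto
    also have "\<dots> \<le> (P + 1) ^ P" using \<open>i \<in> {..P}\<close> by (intro power_increasing) auto
    finally show "card B ^ i \<le> (P + 1) ^ P" .
  qed
  also have "\<dots> = (P + 1) ^ (P + 1)" by simp
  also have "\<dots> \<le> (2 ^ (P + 1)) ^ (P + 1)" by (intro power_mono less_imp_le[OF less_exp]) auto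
  finally show ?thesis by (simp only: power_mult)
qed

locale subtree_graph = sgraph +
  fixes par :: "'a \<Rightarrow> 'a" and rk :: "'a \<Rightarrow> real" and T :: "nat \<Rightarrow> 'a set" and t :: "nat \<Rightarrow> 'a"
  assumes sub: "v \<in> V \<Longrightarrow> subtree par rk (T v) (t v)"
    and inter: "u \<in> V \<Longrightarrow> v \<in> V \<Longrightarrow> u \<noteq> v \<Longrightarrow> adj u v \<longleftrightarrow> T u \<inter> T v \<noteq> {}"
begin

text \<open>Take a maximal set of vertices of the component whose subtrees have a subtree as union.
  Were it not everything, connectivity would provide an edge leaving it, and
  \<open>subtree_Un\<close> would let its other end be added.\<close>

lemma subtree_component:
  assumes "y \<in> V" "y \<notin> Q"
  shows "\<exists>c. subtree par rk (\<Union>z\<in>component Q y. T z) c"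
proof -
  let ?E = "component Q y"
  let ?P = "{S \<in> Pow ?E. S \<noteq> {} \<and> (\<exists>c. subtree par rk (\<Union>z\<in>S. T z) c)}"
  have EV: "?E \<subseteq> V" "finite ?E" using assms component_V finite_component by auto
  have finP: "finite ?P" by (rule finite_subset[of _ "Pow ?E"]) (use EV in auto)
  have "{y} \<in> ?P" using assms sub[of y] by (auto simp: component_refl)
  then obtain S where S: "S \<in> ?P" "\<And>S'. S' \<in> ?P \<Longrightarrow> S \<subseteq> S' \<Longrightarrow> S' = S"
    using finite_has_maximal[OF finP] by (metis (no_types, lifting) empty_iff)
  have "S = ?E"
  proof (rule ccontr)
    assume "S \<noteq> ?E"
    have SE: "S \<subseteq> ?E" "S \<noteq> {}" using S(1) by auto
    have "\<exists>u\<in>S. \<exists>v\<in>?E - S. adj u v"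
    proof (rule ccontr)
      assume no: "\<not> (\<exists>u\<in>S. \<exists>v\<in>?E - S. adj u v)"
      obtain s where s: "s \<in> S" using SE by auto
      then have Es: "component Q s = ?E" using component_eq SE by blast
      have "z \<in> S \<union> Q" if "z \<in> Cl Q s" for z
        using that
      proof (induction rule: Cl_induct)
        case (step u v)
        then have "u \<in> S" "v \<in> ?E \<or> v \<in> Q" using component_nbr[of u Q s v] Es by (auto simp: component_def)
        then show ?case using no step by blast
      qed (use s in simp)
      then have "?E \<subseteq> S" unfolding Es[symmetric] by (auto simp: component_def)
      then show False using SE \<open>S \<noteq> ?E\<close> by blast
    qed
    then obtain u v where uv: "u \<in> S" "v \<in> ?E" "v \<notin> S" "adj u v" by blast
    obtain c where c: "subtree par rk (\<Union>z\<in>S. T z) c" using S(1) by blast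
    have "u \<in> V" "v \<in> V" "u \<noteq> v" using uv EV SE by auto
    then have "T u \<inter> T v \<noteq> {}" using inter uv by blast
    then have "(\<Union>z\<in>S. T z) \<inter> T v \<noteq> {}" using uv by blast
    then obtain c' where "subtree par rk ((\<Union>z\<in>S. T z) \<union> T v) c'"
      using subtree_Un[OF c sub[OF \<open>v \<in> V\<close>]] by blast
    moreover have "(\<Union>z\<in>insert v S. T z) = (\<Union>z\<in>S. T z) \<union> T v" by auto
    ultimately have "insert v S \<in> ?P" using uv SE by auto
    then show False using S(2)[of "insert v S"] uv by auto
  qed
  then show ?thesis using S(1) by blast
qed

lemma Cl_nbr:
  assumes "z \<in> Cl Q y" "z \<in> Q" "y \<notin> Q"
  shows "\<exists>u\<in>component Q y. adj u z"
proof -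
  have "z = y \<or> (\<exists>u\<in>component Q y. adj u z)"
    using assms(1) by (induction rule: Cl_induct) (auto simp: component_def)
  then show ?thesis using assms by auto
qed

text \<open>The union of the subtrees over the component is a subtree that meets the subtree of each
  attached clique member, and these meet pairwise. A node common to all lies in the subtree of some
  \<open>z\<close> of the component, and this \<open>z\<close> is full.\<close>

sublocale helly_graph
proof
  fix q y assume q: "oclique q" and y: "y \<in> V" "y \<notin> set q"
  let ?E = "component (set q) y"
  let ?K = "{z \<in> set q. z \<in> Cl (set q) y}"
  have EV: "?E \<subseteq> V" using component_V y by blast
  have qV: "set q \<subseteq> V" using q by (auto simp: oclique_def)
  obtain c where c: "subtree par rk (\<Union>z\<in>?E. T z) c" using subtree_component y by blast
  \<comment> \<open>\<open>None\<close> stands for the component as a whole, \<open>Some k\<close>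
    for the attached clique member \<open>k\<close>.\<close>
  define S where "S i = (case i of None \<Rightarrow> (\<Union>z\<in>?E. T z) | Some k \<Rightarrow> T k)" for i
  define tt where "tt i = (case i of None \<Rightarrow> c | Some k \<Rightarrow> t k)" for i
  have ne: "T v \<noteq> {}" if "v \<in> V" for v using sub[OF that] by (auto simp: subtree_def)
  have EK: "(\<Union>z\<in>?E. T z) \<inter> T k \<noteq> {}" if k: "k \<in> ?K" for k
  proof -
    obtain u where u: "u \<in> ?E" "adj u k" using Cl_nbr[of k "set q" y] k y by auto
    then have "T u \<inter> T k \<noteq> {}" using inter[of u k] EV qV k adj_irrefl by blast
    then show ?thesis using u by blast
  qed
  have KK: "T k \<inter> T l \<noteq> {}" if "k \<in> ?K" "l \<in> ?K" for k l
    using that oclique_adj[OF q, of k l] inter[of k l] ne[of k] qV by (cases "k = l") auto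
  have EE: "(\<Union>z\<in>?E. T z) \<noteq> {}" using c by (auto simp: subtree_def)
  have "\<exists>i\<in>insert None (Some ` ?K). \<forall>j\<in>insert None (Some ` ?K). tt i \<in> S j"
  proof (rule subtree_Helly)
    fix i assume "i \<in> insert None (Some ` ?K)"
    then show "subtree par rk (S i) (tt i)" using c sub qV by (auto simp: S_def tt_def)
  next
    fix i j assume "i \<in> insert None (Some ` ?K)" "j \<in> insert None (Some ` ?K)"
    then show "S i \<inter> S j \<noteq> {}"
      using EK KK EE by (auto simp: S_def Int_commute split: option.split)
  qed auto
  then obtain x where x: "x \<in> S None" "\<And>k. k \<in> ?K \<Longrightarrow> x \<in> S (Some k)" by blast
  then obtain z where z: "z \<in> ?E" "x \<in> T z" by (auto simp: S_def)
  have "adj z k" if "k \<in> set q" "k \<in> Cl (set q) z" for k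
  proof -
    have "k \<in> ?K" using that Cl_eq[OF z(1)] by auto
    then have "x \<in> T z \<inter> T k" using x z by (auto simp: S_def)
    moreover have "z \<noteq> k" "z \<in> V" "k \<in> V" using z that EV qV by (auto simp: component_def)
    ultimately show ?thesis using inter[of z k] by blast
  qed
  then show "\<exists>z\<in>?E. full (set q) z" using z by (auto simp: full_def)
qed

text \<open>These are the bags of a tree decomposition, taken only at the topmost nodes of subtrees,
  so that there are at most \<open>card V\<close> of them.\<close>

definition bag :: "nat \<Rightarrow> nat set" where
  "bag v = {u \<in> V. t v \<in> T u}"

lemma bag_clique: "u \<in> bag v \<Longrightarrow> w \<in> bag v \<Longrightarrow> u \<noteq> w \<Longrightarrow> adj u w"
  using inter[of u w] by (auto simp: bag_def)

lemma oclique_bag: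
  assumes "oclique q" "q \<noteq> []" shows "\<exists>v\<in>V. set q \<subseteq> bag v"
proof -
  have qV: "set q \<subseteq> V" using assms by (auto simp: oclique_def)
  have "\<exists>i\<in>set q. \<forall>j\<in>set q. t i \<in> T j"
  proof (rule subtree_Helly[of _ par rk])
    fix i j assume ij: "i \<in> set q" "j \<in> set q"
    then have "i \<in> V" "j \<in> V" "T i \<noteq> {}" using qV sub[of i] by (auto simp: subtree_def)
    then show "T i \<inter> T j \<noteq> {}"
      using ij inter[of i j] oclique_adj[OF assms(1) ij] by (cases "i = j") auto
  qed (use assms qV sub in auto)
  then show ?thesis using qV by (auto simp: bag_def)
qed

lemma card_oclique:
  assumes "V \<noteq> {}" "\<And>C. C \<subseteq> V \<Longrightarrow> (\<forall>u\<in>C. \<forall>v\<in>C. u \<noteq> v \<longrightarrow> adj u v) \<Longrightarrow> card C \<le> P"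
  shows "card {q. oclique q} \<le> card V * 2 ^ ((P + 1) * (P + 1))"
proof -
  have bagV: "bag v \<subseteq> V" for v by (auto simp: bag_def)
  have fb: "finite (bag v)" for v using finite_subset[OF bagV finV] .
  have cb: "card (bag v) \<le> P" for v using bag_clique bagV by (intro assms(2)) auto
  have "{q. oclique q} \<subseteq> (\<Union>v\<in>V. {q. set q \<subseteq> bag v \<and> length q \<le> P})"
  proof
    fix q assume "q \<in> {q. oclique q}"
    then have q: "oclique q" by simp
    show "q \<in> (\<Union>v\<in>V. {q. set q \<subseteq> bag v \<and> length q \<le> P})"
    proof (cases "q = []")
      case False
      then obtain v where v: "v \<in> V" "set q \<subseteq> bag v" using oclique_bag q by blast
      have "length q = card (set q)" using oclique_distinct[OF q] by (simp add: distinct_card)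
      also have "\<dots> \<le> P" using card_mono[OF fb v(2)] cb[of v] by simp
      finally show ?thesis using v by auto
    qed (use assms(1) in auto)
  qed
  moreover have "finite (\<Union>v\<in>V. {q. set q \<subseteq> bag v \<and> length q \<le> P})"
    using finV finite_lists_length_le[OF fb] by simp
  ultimately have "card {q. oclique q} \<le> card (\<Union>v\<in>V. {q. set q \<subseteq> bag v \<and> length q \<le> P})"
    by (rule card_mono[rotated])
  also have "\<dots> \<le> (\<Sum>v\<in>V. card {q. set q \<subseteq> bag v \<and> length q \<le> P})" by (rule card_UN_le[OF finV])
  also have "\<dots> \<le> (\<Sum>v\<in>V. 2 ^ ((P + 1) * (P + 1)))"
    by (intro sum_mono card_lists_le fb cb)
  finally show ?thesis by simp
qed

end

section \<open>Subdivided stars as rooted trees\<close>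

definition rooted_tree :: "'a pair_pre_digraph \<Rightarrow> ('a \<Rightarrow> 'a) \<Rightarrow> ('a \<Rightarrow> real) \<Rightarrow> 'a \<Rightarrow> bool" where
  "rooted_tree G par rk r \<longleftrightarrow> r \<in> pverts G \<and>
     (\<forall>x\<in>pverts G. x \<noteq> r \<longrightarrow> par x \<in> pverts G \<and> rk (par x) < rk x) \<and>
     parcs G = (\<lambda>x. (x, par x)) ` (pverts G - {r}) \<union> (\<lambda>x. (par x, x)) ` (pverts G - {r})"

lemma rooted_tree_star: "rooted_tree (star d) (\<lambda>_. 0) (\<lambda>x. real x) 0"
  by (auto simp: rooted_tree_def star_def)

lemma pair_graph_star: "pair_graph (star d)"
  by unfold_locales (auto simp: star_def symmetric_def sym_def)

text \<open>The new vertex is put between \<open>u\<close> and its parent and takes the mean of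
  their ranks, so ranks still decrease towards the root.\<close>

lemma rooted_tree_subdivide_up:
  assumes G: "rooted_tree G par rk r" and u: "u \<in> pverts G" "u \<noteq> r" and w: "w \<notin> pverts G"
    and H: "pverts H = pverts G \<union> {w}"
      "parcs H = (parcs G - {(u, par u), (par u, u)}) \<union> {(u, w), (w, u), (w, par u), (par u, w)}"
  shows "rooted_tree H (par(u := w, w := par u)) (rk(w := (rk u + rk (par u)) / 2)) r"
proof -
  let ?p = "par(u := w, w := par u)"
  have r: "r \<in> pverts G" and p: "\<And>x. x \<in> pverts G \<Longrightarrow> x \<noteq> r \<Longrightarrow> par x \<in> pverts G \<and> rk (par x) < rk x"
    and a: "parcs G = (\<lambda>x. (x, par x)) ` (pverts G - {r}) \<union> (\<lambda>x. (par x, x)) ` (pverts G - {r})"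
    using G by (auto simp: rooted_tree_def)
  have uw: "u \<noteq> w" "r \<noteq> w" using u r w by auto
  have pu: "par u \<in> pverts G" "rk (par u) < rk u" "par u \<noteq> w" using p[OF u] w by auto
  \<comment> \<open>Two vertices are never each other's parent; otherwise the two removed arcs could
    also belong to the edge of another vertex.\<close>
  have npp: "par x \<noteq> u \<or> x \<noteq> par u" if "x \<in> pverts G" "x \<noteq> r" for x
    using p[OF that] pu by auto
  have 1: "pverts H - {r} = insert u (insert w (pverts G - {r, u}))" using H u uw by auto
  have 2: "pverts G - {r} = insert u (pverts G - {r, u})" using u by auto
  have 3: "(\<lambda>x. (x, ?p x)) ` (pverts H - {r}) = {(u, w), (w, par u)} \<union> (\<lambda>x. (x, par x)) ` (pverts G - {r, u})"
    unfolding 1 using uw w by auto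
  have 4: "(\<lambda>x. (?p x, x)) ` (pverts H - {r}) = {(w, u), (par u, w)} \<union> (\<lambda>x. (par x, x)) ` (pverts G - {r, u})"
    unfolding 1 using uw w by auto
  have "parcs G - {(u, par u), (par u, u)} =
      (\<lambda>x. (x, par x)) ` (pverts G - {r, u}) \<union> (\<lambda>x. (par x, x)) ` (pverts G - {r, u})"
    unfolding a 2 using npp[of "par u"] npp pu(1) by auto
  then have "parcs H = (\<lambda>x. (x, ?p x)) ` (pverts H - {r}) \<union> (\<lambda>x. (?p x, x)) ` (pverts H - {r})"
    unfolding 3 4 H(2) by auto
  moreover have "?p x \<in> pverts H \<and> (rk(w := (rk u + rk (par u)) / 2)) (?p x) < (rk(w := (rk u + rk (par u)) / 2)) x"
    if x: "x \<in> pverts H" "x \<noteq> r" for x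
  proof -
    consider "x = w" | "x = u" | "x \<noteq> w" "x \<noteq> u" "x \<in> pverts G" using x H by auto
    then show ?thesis
    proof cases
      case 3
      then show ?thesis using p[of x] x w H by auto
    qed (use uw pu H u in auto)
  qed
  ultimately show ?thesis unfolding rooted_tree_def using r H by auto
qed

lemma rooted_tree_subdivision:
  assumes "subdivision_pair (star d) H"
  shows "\<exists>par rk r. rooted_tree H par rk r"
  using assms
proof (induction rule: subdivision_pair_induct)
  case base
  show ?case using rooted_tree_star by blast
next
  case (divide e w H)
  then obtain par rk r where G: "rooted_tree H par rk r" by blast
  have "e \<in> parcs H" "w \<notin> pverts H" using divide by auto
  then obtain x where x: "x \<in> pverts H" "x \<noteq> r" "e = (x, par x) \<or> e = (par x, x)"
    using G by (auto simp: rooted_tree_def)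
  have 1: "pverts (subdivide H e w) = pverts H \<union> {w}" by simp
  have 2: "parcs (subdivide H e w) =
      (parcs H - {(x, par x), (par x, x)}) \<union> {(x, w), (w, x), (w, par x), (par x, w)}"
    using x(3) by auto
  from rooted_tree_subdivide_up[OF G x(1,2) \<open>w \<notin> pverts H\<close> 1 2] show ?case by (intro exI)
qed

text \<open>A connected subgraph that misses the parent of one of its vertices stays below that vertex.\<close>

lemma connected_subtree:
  assumes G: "rooted_tree G par rk r" and fin: "finite (pverts G)"
    and T: "pair_graph T" "subgraph (with_proj T) (with_proj G)"
    "Digraph_Component.connected (with_proj T)"
  shows "\<exists>a. subtree par rk (pverts T) a"
proof -
  interpret T: pair_graph T by fact
  have sub: "pverts T \<subseteq> pverts G" "parcs T \<subseteq> parcs G" using T(2) by (auto simp: subgraph_def)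
  have ne: "pverts T \<noteq> {}" using T(3) by (auto simp: Digraph_Component.connected_def strongly_connected_def)
  have sym: "parcs (mk_symmetric (with_proj T)) = parcs T"
    using T.arcs_symmetric by (auto simp: parcs_mk_symmetric)
  have conn: "(u, v) \<in> (parcs T)\<^sup>*" if "u \<in> pverts T" "v \<in> pverts T" for u v
  proof -
    have "u \<rightarrow>\<^sup>*\<^bsub>with_proj (mk_symmetric (with_proj T))\<^esub> v"
      using T(3) that by (auto simp: Digraph_Component.connected_def strongly_connected_def)
    then have "(u, v) \<in> (arcs_ends (with_proj (mk_symmetric (with_proj T))))\<^sup>*"
      by (rule reachable_rtranclI)
    then show ?thesis by (simp add: sym)
  qed
  obtain a where a: "is_arg_min rk (\<lambda>z. z \<in> pverts T) a"
    using ex_is_arg_min_if_finite[OF T.pair_finite_verts ne] by blast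
  then have aT: "a \<in> pverts T" by (auto simp: is_arg_min_def)
  have mn: "rk a \<le> rk z" if "z \<in> pverts T" for z
    using a that by (auto simp: is_arg_min_def not_less)
  have top: "subtree par rk (pverts G) r" using G fin by (auto simp: rooted_tree_def subtree_def)
  have "par x \<in> pverts T \<and> rk (par x) < rk x" if x: "x \<in> pverts T" "x \<noteq> a" for x
  proof -
    have "x \<noteq> r"
    proof
      assume "x = r"
      then have "rk r < rk a" using subtree_rank[OF top, of a] aT sub x by auto
      then show False using mn[OF x(1)] \<open>x = r\<close> by simp
    qed
    then have less: "rk (par x) < rk x" using G x sub by (auto simp: rooted_tree_def)
    have "par x \<in> pverts T"
    proof (rule ccontr)
      assume no: "par x \<notin> pverts T"
      \<comment> \<open>Inside \<open>T\<close>, a path from \<open>x\<close> to the minimum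
        \<open>a\<close> stays among the descendants of \<open>x\<close>, since leaving them means
        passing to \<open>par x\<close>. So \<open>a\<close> is \<open>x\<close> itself or has
        larger rank, and both are impossible.\<close>
      define R where "R = {(z, par z) |z. z \<in> pverts G \<and> z \<noteq> r}"
      have "(x, a) \<in> (parcs T)\<^sup>*" by (rule conn[OF x(1) aT])
      then have "(a, x) \<in> R\<^sup>*"
      proof (induction rule: rtrancl_induct)
        case (step u w)
        then have "w \<in> pverts T" using T.in_arcsD2 by blast
        have "(u, w) \<in> parcs G" using step sub by blast
        then consider "w = par u" "u \<in> pverts G" "u \<noteq> r" | "u = par w" "w \<in> pverts G" "w \<noteq> r"
          using G by (auto simp: rooted_tree_def)
        then show ?case
        proof cases
          case 1
          then have "u \<noteq> x" using no \<open>w \<in> pverts T\<close> by auto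
          then have "(par u, x) \<in> R\<^sup>*" using step.IH by (auto simp: R_def elim: converse_rtranclE)
          then show ?thesis using 1 by simp
        next
          case 2
          then have "(w, u) \<in> R" by (auto simp: R_def)
          then show ?thesis using step.IH by (rule converse_rtrancl_into_rtrancl)
        qed
      qed simp
      then have "a = x \<or> rk x < rk a"
        by (induction rule: converse_rtrancl_induct)
          (use G in \<open>force simp: R_def rooted_tree_def\<close>)+
      then show False using x mn[OF x(1)] by auto
    qed
    then show ?thesis using less by simp
  qed
  then show ?thesis using aT T.pair_finite_verts unfolding subtree_def by blast
qed

section \<open>The disjoint union with two apices\<close>

text \<open>Vertices below \<open>n\<close> belong to the first graph, those from \<open>n\<close>
  to \<open>2 * n - 1\<close> to the second one shifted by \<open>n\<close>; \<open>2 * n\<close>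
  and \<open>2 * n + 1\<close> are the apices. The case distinction by rows is the one that
  \<open>pAdjEntry\<close> carries out.\<close>

definition uadj :: "nat \<Rightarrow> (nat \<times> nat) set \<Rightarrow> (nat \<times> nat) set \<Rightarrow> nat \<Rightarrow> nat \<Rightarrow> bool" where
  "uadj n A B u v \<longleftrightarrow>
     (if u < n then v < n \<and> (u, v) \<in> A \<or> v = 2 * n
      else if u < 2 * n then n \<le> v \<and> v < 2 * n \<and> (u - n, v - n) \<in> B \<or> v = 2 * n + 1
      else if u = 2 * n then v < n
      else u = 2 * n + 1 \<and> n \<le> v \<and> v < 2 * n)"

text \<open>The whole tree \<open>W\<close> is kept besides the subtrees of the vertices because it
  will represent the apex.\<close>

lemma H_graph_subtrees:
  assumes "is_H_graph (star d) G" "pverts G = {..<n}"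
  shows "\<exists>(par :: nat \<Rightarrow> nat) rk W r T t. subtree par rk W r \<and>
    (\<forall>v<n. subtree par rk (T v) (t v) \<and> T v \<subseteq> W) \<and>
    (\<forall>u<n. \<forall>v<n. u \<noteq> v \<longrightarrow> (u, v) \<in> parcs G \<longleftrightarrow> T u \<inter> T v \<noteq> {})"
proof -
  obtain H' T where H: "subdivision_pair (star d) H'"
    and T': "\<forall>v\<in>pverts G. pair_graph (T v) \<and> subgraph (with_proj (T v)) (with_proj H') \<and>
            Digraph_Component.connected (with_proj (T v))"
    and i: "\<forall>u\<in>pverts G. \<forall>v\<in>pverts G. u \<noteq> v \<longrightarrow>
            ((u, v) \<in> parcs G \<longleftrightarrow> pverts (T u) \<inter> pverts (T v) \<noteq> {})"
    using assms(1) unfolding is_H_graph_def by blast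
  note T = bspec[OF T']
  obtain par rk r where R: "rooted_tree H' par rk r" using rooted_tree_subdivision[OF H] by blast
  have "pair_graph H'" using pair_graph.pair_graph_subdivision[OF pair_graph_star H] .
  then have fin: "finite (pverts H')"
    by (simp add: pair_digraph_def pair_fin_digraph.pair_finite_verts pair_graph_def)
  then have "subtree par rk (pverts H') r" using R by (auto simp: rooted_tree_def subtree_def)
  moreover have "\<exists>a. subtree par rk (pverts (T v)) a" if v: "v \<in> pverts G" for v
    using connected_subtree[OF R fin] T[OF v] by blast
  then obtain t where "\<And>v. v \<in> pverts G \<Longrightarrow> subtree par rk (pverts (T v)) (t v)" by metis
  moreover have "pverts (T v) \<subseteq> pverts H'" if v: "v \<in> pverts G" for v
    using T[OF v] by (auto simp: subgraph_def)
  ultimately show ?thesis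
    using assms(2) i by (intro exI[of _ par] exI[of _ rk] exI[of _ "pverts H'"] exI[of _ r]
        exI[of _ "\<lambda>v. pverts (T v)"] exI[of _ t]) auto
qed

lemma subtree_Inl:
  assumes "subtree par rk A a"
  shows "subtree (map_sum par par') (case_sum rk rk') (Inl ` A) (Inl a)"
  using assms by (auto simp: subtree_def)

lemma subtree_Inr:
  assumes "subtree par' rk' A a"
  shows "subtree (map_sum par par') (case_sum rk rk') (Inr ` A) (Inr a)"
  using assms by (auto simp: subtree_def)

lemma is_H_graph_props:
  assumes "is_H_graph S G" "pverts G = {..<n}"
  shows "(u, v) \<in> parcs G \<Longrightarrow> (v, u) \<in> parcs G" "(u, u) \<notin> parcs G"
    "(u, v) \<in> parcs G \<Longrightarrow> u < n \<and> v < n"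
proof -
  interpret pair_graph G using assms by (simp add: is_H_graph_def)
  show "(u, v) \<in> parcs G \<Longrightarrow> (v, u) \<in> parcs G" by (rule arcs_symmetric)
  show "(u, u) \<notin> parcs G" using no_loops' by blast
  show "(u, v) \<in> parcs G \<Longrightarrow> u < n \<and> v < n" using in_arcsD1 in_arcsD2 assms by blast
qed

locale star_pair =
  fixes d p n :: nat and G H :: "nat pair_pre_digraph"
  assumes verts: "pverts G = {..<n}" "pverts H = {..<n}"
    and star: "is_H_graph (star d) G" "is_H_graph (star d) H"
    and cl: "\<And>C. clique G C \<Longrightarrow> card C \<le> p" "\<And>C. clique H C \<Longrightarrow> card C \<le> p"
begin

definition U :: "nat \<Rightarrow> nat \<Rightarrow> bool" where "U = uadj n (parcs G) (parcs H)"

lemmas GP = is_H_graph_props[OF star(1) verts(1)] and HP = is_H_graph_props[OF star(2) verts(2)]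

lemma U_sgraph: "sgraph {..<2 * n + 2} U"
  by unfold_locales (auto simp: U_def uadj_def GP(2) HP(2) intro: GP(1) HP(1) dest: GP(3) HP(3) split: if_splits)

lemma U_row:
  "u < n \<Longrightarrow> U u v \<longleftrightarrow> v < n \<and> (u, v) \<in> parcs G \<or> v = 2 * n"
  "n \<le> u \<Longrightarrow> u < 2 * n \<Longrightarrow>
    U u v \<longleftrightarrow> n \<le> v \<and> v < 2 * n \<and> (u - n, v - n) \<in> parcs H \<or> v = 2 * n + 1"
  "U (2 * n) v \<longleftrightarrow> v < n" "U (2 * n + 1) v \<longleftrightarrow> n \<le> v \<and> v < 2 * n"
  by (auto simp: U_def uadj_def)

lemma U_side:
  "u < n \<or> u = 2 * n \<Longrightarrow> U u v \<Longrightarrow> v < n \<or> v = 2 * n"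
  "n \<le> u \<and> u < 2 * n \<or> u = 2 * n + 1 \<Longrightarrow> U u v \<Longrightarrow> n \<le> v \<and> v < 2 * n \<or> v = 2 * n + 1"
  by (auto simp: U_def uadj_def)

text \<open>The two trees lie side by side in a sum type, so subtrees of different sides are
  disjoint. Each apex is represented by its whole tree, which meets every subtree on its
  side.\<close>

lemma subtree_graph_U:
  "\<exists>(par :: nat + nat \<Rightarrow> nat + nat) rk T t. subtree_graph {..<2 * n + 2} U par rk T t"
proof -
  obtain p1 :: "nat \<Rightarrow> nat" and r1 W1 w1 T1 t1 where One: "subtree p1 r1 W1 w1"
    "\<forall>v<n. subtree p1 r1 (T1 v) (t1 v) \<and> T1 v \<subseteq> W1"
    "\<forall>u<n. \<forall>v<n. u \<noteq> v \<longrightarrow> (u, v) \<in> parcs G \<longleftrightarrow> T1 u \<inter> T1 v \<noteq> {}"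
    using H_graph_subtrees[OF star(1) verts(1)] by (elim exE conjE)
  obtain p2 :: "nat \<Rightarrow> nat" and r2 W2 w2 T2 t2 where Two: "subtree p2 r2 W2 w2"
    "\<forall>v<n. subtree p2 r2 (T2 v) (t2 v) \<and> T2 v \<subseteq> W2"
    "\<forall>u<n. \<forall>v<n. u \<noteq> v \<longrightarrow> (u, v) \<in> parcs H \<longleftrightarrow> T2 u \<inter> T2 v \<noteq> {}"
    using H_graph_subtrees[OF star(2) verts(2)] by (elim exE conjE)
  define T where "T u = (if u < n then Inl ` T1 u else if u < 2 * n then Inr ` T2 (u - n)
      else if u = 2 * n then Inl ` W1 else Inr ` W2)" for u
  define t where "t u = (if u < n then Inl (t1 u) else if u < 2 * n then Inr (t2 (u - n))
      else if u = 2 * n then Inl w1 else Inr w2)" for u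
  have T1: "T1 v \<noteq> {}" "T1 v \<subseteq> W1" if "v < n" for v using One(2) that by (auto simp: subtree_def)
  have T2: "T2 v \<noteq> {}" "T2 v \<subseteq> W2" if "v < n" for v using Two(2) that by (auto simp: subtree_def)
  interpret sgraph "{..<2 * n + 2}" U by (rule U_sgraph)
  have LR: "Inl ` A \<inter> Inr ` B = {}" "Inr ` B \<inter> Inl ` A = {}" for A B by auto
  have LL: "Inl ` A \<inter> Inl ` B = {} \<longleftrightarrow> A \<inter> B = {}" for A B by auto
  have RR: "Inr ` A \<inter> Inr ` B = {} \<longleftrightarrow> A \<inter> B = {}" for A B by auto
  have "subtree_graph {..<2 * n + 2} U (map_sum p1 p2) (case_sum r1 r2) T t"
  proof
    fix v assume "v \<in> {..<2 * n + 2}"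
    then show "subtree (map_sum p1 p2) (case_sum r1 r2) (T v) (t v)"
      using One(1) One(2) Two(1) Two(2)[rule_format, of "v - n"]
      by (auto simp: T_def t_def intro!: subtree_Inl subtree_Inr)
  next
    fix u v assume uv: "u \<in> {..<2 * n + 2}" "v \<in> {..<2 * n + 2}" "u \<noteq> v"
    have W1: "T1 x \<inter> W1 \<noteq> {}" "W1 \<inter> T1 x \<noteq> {}" if "x < n" for x using T1[OF that] by auto
    have W2: "T2 x \<inter> W2 \<noteq> {}" "W2 \<inter> T2 x \<noteq> {}" if "x < n" for x using T2[OF that] by auto
    have TT: "T x = Inl ` T1 x" if "x < n" for x using that by (simp add: T_def)
    have TT': "T x = Inr ` T2 (x - n)" if "n \<le> x" "x < 2 * n" for x using that by (simp add: T_def)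
    have TA: "T (2 * n) = Inl ` W1" "T (2 * n + 1) = Inr ` W2" by (auto simp: T_def)
    consider "v < n" | "n \<le> v" "v < 2 * n" | "v = 2 * n" | "v = 2 * n + 1" using uv(2) by fastforce
    note cv = this
    consider "u < n" | "n \<le> u" "u < 2 * n" | "u = 2 * n" | "u = 2 * n + 1" using uv(1) by fastforce
    then show "U u v \<longleftrightarrow> T u \<inter> T v \<noteq> {}"
    proof cases
      case u: 1
      show ?thesis unfolding U_row(1)[OF u] TT[OF u]
      proof (cases rule: cv)
        case 1 then show "(v < n \<and> (u, v) \<in> parcs G \<or> v = 2 * n) \<longleftrightarrow> Inl ` T1 u \<inter> T v \<noteq> {}"
          using One(3) u uv(3) by (simp add: TT LL)
      qed (use u W1 in \<open>simp_all only: TT' TA LR LL\<close>, auto)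
    next
      case u: 2
      have "u - n \<noteq> v - n" if "n \<le> v" using u(1) uv(3) that by simp
      show ?thesis unfolding U_row(2)[OF u] TT'[OF u]
      proof (cases rule: cv)
        case 2
        have "u - n < n" "v - n < n" "u - n \<noteq> v - n" using u 2 uv(3) by auto
        then show "(n \<le> v \<and> v < 2 * n \<and> (u - n, v - n) \<in> parcs H \<or> v = 2 * n + 1) \<longleftrightarrow>
            Inr ` T2 (u - n) \<inter> T v \<noteq> {}"
          using Two(3) 2 by (simp add: TT' RR)
      qed (use u W2[of "u - n"] in \<open>simp_all only: TT TA LR RR\<close>, auto)
    next
      case u: 3
      show ?thesis unfolding u U_row(3) TA
        by (cases rule: cv) (use u uv(3) W1 in \<open>simp_all only: TT TT' TA LR LL\<close>, auto)
    next
      case u: 4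
      show ?thesis unfolding u U_row(4) TA
        by (cases rule: cv) (use u uv(3) W2[of "v - n"] in \<open>simp_all only: TT TT' TA LR RR\<close>, auto)
    qed
  qed
  then show ?thesis by blast
qed

text \<open>No edge joins the two sides, so a clique is one of \<open>G\<close> or \<open>H\<close>,
  possibly enlarged by the apex of that side.\<close>

lemma U_clique:
  assumes "C \<subseteq> {..<2 * n + 2}" "\<forall>u\<in>C. \<forall>v\<in>C. u \<noteq> v \<longrightarrow> U u v"
  shows "card C \<le> p + 1"
proof (cases "\<exists>u\<in>C. u < n \<or> u = 2 * n")
  case True
  then obtain u where u: "u \<in> C" "u < n \<or> u = 2 * n" by blast
  have "v < n \<or> v = 2 * n" if "v \<in> C" for v
    using assms(2) u that by (cases "v = u") (simp, metis U_side(1))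
  then have "C \<subseteq> insert (2 * n) (C \<inter> {..<n})" by auto
  then have "card C \<le> card (insert (2 * n) (C \<inter> {..<n}))" by (intro card_mono) auto
  also have "\<dots> \<le> Suc (card (C \<inter> {..<n}))" by (intro card_insert_le_m1) auto
  also have "card (C \<inter> {..<n}) \<le> p"
  proof (rule cl(1))
    have "(u, v) \<in> parcs G" if "u \<in> C" "v \<in> C" "u < n" "v < n" "u \<noteq> v" for u v
    proof -
      have "U u v" using assms(2) that by blast
      then show ?thesis using U_row(1)[of u v] that by simp
    qed
    then show "clique G (C \<inter> {..<n})" by (auto simp: clique_def verts)
  qed
  finally show ?thesis by simp
next
  case False
  then have "C \<subseteq> insert (2 * n + 1) (C \<inter> {n..<2 * n})" using assms(1) by force
  then have "card C \<le> card (insert (2 * n + 1) (C \<inter> {n..<2 * n}))" by (intro card_mono) auto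
  also have "\<dots> \<le> Suc (card (C \<inter> {n..<2 * n}))" by (intro card_insert_le_m1) auto
  also have "card (C \<inter> {n..<2 * n}) = card ((\<lambda>v. v - n) ` (C \<inter> {n..<2 * n}))"
    by (intro card_image[symmetric] inj_onI) auto
  also have "\<dots> \<le> p"
  proof (rule cl(2))
    have "(u - n, v - n) \<in> parcs H"
      if "u \<in> C" "v \<in> C" "n \<le> u" "u < 2 * n" "n \<le> v" "v < 2 * n" "u - n \<noteq> v - n" for u v
    proof -
      have "u \<noteq> v" using that(7) by auto
      then have "U u v" using assms(2) that(1,2) by blast
      then show ?thesis using U_row(2)[of u v] that by simp
    qed
    then show "clique H ((\<lambda>v. v - n) ` (C \<inter> {n..<2 * n}))" by (auto simp: clique_def verts)
  qed
  finally show ?thesis by simp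
qed

lemma U_helly: "helly_graph {..<2 * n + 2} U"
proof -
  obtain par :: "nat + nat \<Rightarrow> nat + nat" and rk T t where "subtree_graph {..<2 * n + 2} U par rk T t"
    using subtree_graph_U by blast
  then interpret subtree_graph "{..<2 * n + 2}" U par rk T t .
  show ?thesis by (rule helly_graph_axioms)
qed

lemma U_card_oclique:
  "card {q. sgraph.oclique {..<2 * n + 2} U q} \<le> (2 * n + 2) * 2 ^ ((p + 2) * (p + 2))"
proof -
  obtain par :: "nat + nat \<Rightarrow> nat + nat" and rk T t where "subtree_graph {..<2 * n + 2} U par rk T t"
    using subtree_graph_U by blast
  then interpret subtree_graph "{..<2 * n + 2}" U par rk T t .
  show ?thesis using card_oclique[of "p + 1"] U_clique by (simp add: lessThan_empty_iff)
qed

text \<open>A \<open>digraph_iso\<close> has a separate map for arcs. Since tail and head are the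
  projections on both sides, the map on vertices determines it.\<close>

lemma digraph_iso_iff:
  "digraph_iso (with_proj G) (with_proj H) \<longleftrightarrow>
    (\<exists>f. bij_betw f {..<n} {..<n} \<and> (\<forall>u<n. \<forall>v<n. (f u, f v) \<in> parcs H \<longleftrightarrow> (u, v) \<in> parcs G))"
proof
  assume "digraph_iso (with_proj G) (with_proj H)"
  then obtain h where h: "pre_digraph.digraph_isomorphism (with_proj G) h"
    "with_proj H = app_iso h (with_proj G)" by (auto simp: digraph_iso_def)
  let ?f = "iso_verts h"
  have "pverts H = ?f ` pverts G" "parcs H = iso_arcs h ` parcs G"
    and th: "iso_tail h = fst" "iso_head h = snd"
    using arg_cong[OF h(2), of verts] arg_cong[OF h(2), of arcs] arg_cong[OF h(2), of tail]
      arg_cong[OF h(2), of head] by simp_all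
  note VA = this
  have inj: "inj_on ?f {..<n}"
    and ar: "\<forall>a\<in>parcs G. ?f (fst a) = fst (iso_arcs h a) \<and> ?f (snd a) = snd (iso_arcs h a)"
    using h(1) verts th by (auto simp: pre_digraph.digraph_isomorphism_def)
  have ia: "iso_arcs h a = (?f (fst a), ?f (snd a))" if "a \<in> parcs G" for a
    using ar that by (simp add: prod_eq_iff)
  have "(?f u, ?f v) \<in> parcs H \<longleftrightarrow> (u, v) \<in> parcs G" if "u < n" "v < n" for u v
  proof
    assume "(?f u, ?f v) \<in> parcs H"
    then obtain a where a: "a \<in> parcs G" "(?f u, ?f v) = iso_arcs h a" using VA by auto
    then have "fst a < n" "snd a < n" "?f u = ?f (fst a)" "?f v = ?f (snd a)"
      using ia[OF a(1)] GP(3)[of "fst a" "snd a"] by auto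
    then have "u = fst a" "v = snd a" using inj that by (auto dest: inj_onD)
    then show "(u, v) \<in> parcs G" using a by simp
  next
    assume "(u, v) \<in> parcs G"
    then show "(?f u, ?f v) \<in> parcs H" using ia[of "(u, v)"] VA by force
  qed
  moreover have "bij_betw ?f {..<n} {..<n}" using inj VA verts by (simp add: bij_betw_def)
  ultimately show "\<exists>f. bij_betw f {..<n} {..<n} \<and>
      (\<forall>u<n. \<forall>v<n. (f u, f v) \<in> parcs H \<longleftrightarrow> (u, v) \<in> parcs G)" by blast
next
  assume "\<exists>f. bij_betw f {..<n} {..<n} \<and> (\<forall>u<n. \<forall>v<n. (f u, f v) \<in> parcs H \<longleftrightarrow> (u, v) \<in> parcs G)"
  then obtain f where f: "bij_betw f {..<n} {..<n}"
    "\<And>u v. u < n \<Longrightarrow> v < n \<Longrightarrow> (f u, f v) \<in> parcs H \<longleftrightarrow> (u, v) \<in> parcs G" by blast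
  interpret G: pair_graph G using star by (simp add: is_H_graph_def)
  define h :: "(nat, nat \<times> nat, nat, nat \<times> nat) digraph_isomorphism" where
    "h = \<lparr>iso_verts = f, iso_arcs = map_prod f f, iso_head = snd, iso_tail = fst\<rparr>"
  have inj: "inj_on f {..<n}" using f by (auto simp: bij_betw_def)
  have "inj_on (map_prod f f) (parcs G)"
    by (rule inj_onI) (clarsimp, metis GP(3) inj inj_onD lessThan_iff)
  then have "pre_digraph.digraph_isomorphism (with_proj G) h"
    using inj G.wf_digraph by (auto simp: pre_digraph.digraph_isomorphism_def h_def verts)
  moreover have "parcs H = map_prod f f ` parcs G"
  proof (intro equalityI subsetI)
    fix e assume e: "e \<in> parcs H"
    obtain x y where xy: "e = (x, y)" by (cases e)
    have "x \<in> f ` {..<n}" "y \<in> f ` {..<n}" using HP(3)[of x y] e xy f(1) by (auto simp: bij_betw_def)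
    then obtain u v where "u < n" "v < n" "x = f u" "y = f v" by auto
    then show "e \<in> map_prod f f ` parcs G" using f(2)[of u v] e xy by force
  qed (use f(2) GP(3) in auto)
  then have "with_proj H = app_iso h (with_proj G)"
    using f(1) by (simp add: with_proj_def app_iso_def h_def verts bij_betw_def)
  ultimately show "digraph_iso (with_proj G) (with_proj H)" by (auto simp: digraph_iso_def)
qed

text \<open>An apex reaches all of its side and nothing else, so the regions of the two singletons
  are the whole sides. A local isomorphism sends apex to apex, so removing or adding the apices
  converts the two kinds of isomorphism into each other.\<close>

lemma U_iso:
  "digraph_iso (with_proj G) (with_proj H) \<longleftrightarrow>
    (\<exists>\<phi>. sgraph.liso U \<phi> [2 * n] [2 * n + 1])"
proof -
  interpret sgraph "{..<2 * n + 2}" U by (rule U_sgraph)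
  have side: "z < n \<or> z = 2 * n" if "z \<in> Cl {} (2 * n)" for z
    using that
  proof (induction rule: Cl_induct)
    case (step u v) then show ?case using U_side(1)[of u v] by blast
  qed simp
  have side': "n \<le> z \<and> z < 2 * n \<or> z = 2 * n + 1" if "z \<in> Cl {} (2 * n + 1)" for z
    using that
  proof (induction rule: Cl_induct)
    case (step u v) then show ?case using U_side(2)[of u v] by blast
  qed simp
  have N: "U (2 * n) v \<longleftrightarrow> v < n" "U (2 * n + 1) v \<longleftrightarrow> n \<le> v \<and> v < 2 * n" for v
    by (auto simp: U_def uadj_def)
  have R1: "region [2 * n] = insert (2 * n) {..<n}"
  proof -
    have "z \<in> Cl {} (2 * n) \<longleftrightarrow> z < n \<or> z = 2 * n" for z
      using side[of z] Cl_step[of "2 * n" "{}" "2 * n" z] N(1)[of z] by (cases "z = 2 * n") auto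
    then show ?thesis by (auto simp: region_def component_def)
  qed
  have R2: "region [2 * n + 1] = insert (2 * n + 1) {n..<2 * n}"
  proof -
    have "z \<in> Cl {} (2 * n + 1) \<longleftrightarrow> n \<le> z \<and> z < 2 * n \<or> z = 2 * n + 1" for z
    proof
      assume "n \<le> z \<and> z < 2 * n \<or> z = 2 * n + 1"
      then show "z \<in> Cl {} (2 * n + 1)"
      proof
        assume "n \<le> z \<and> z < 2 * n"
        then have "U (2 * n + 1) z" using N(2) by blast
        then show ?thesis by (rule Cl_step[OF Cl_refl, rotated]) simp
      next
        assume "z = 2 * n + 1"
        then show ?thesis by (simp only: Cl_refl)
      qed
    qed (rule side')
    then have "Cl {} (2 * n + 1) = insert (2 * n + 1) {n..<2 * n}" by (intro set_eqI) (simp only:, auto)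
    then show ?thesis unfolding region_def component_def list.sel list.set by blast
  qed
  show ?thesis
    unfolding digraph_iso_iff
  proof
    assume "\<exists>f. bij_betw f {..<n} {..<n} \<and> (\<forall>u<n. \<forall>v<n. (f u, f v) \<in> parcs H \<longleftrightarrow> (u, v) \<in> parcs G)"
    then obtain f where f: "bij_betw f {..<n} {..<n}"
      "\<And>u v. u < n \<Longrightarrow> v < n \<Longrightarrow> (f u, f v) \<in> parcs H \<longleftrightarrow> (u, v) \<in> parcs G" by blast
    define \<phi> where "\<phi> u = (if u < n then f u + n else 2 * n + 1)" for u
    have fn: "f u < n" if "u < n" for u using f(1) that by (auto simp: bij_betw_def)
    have "bij_betw (\<lambda>u. u + n) {..<n} {n..<2 * n}"
      by (rule bij_betw_byWitness[where f' = "\<lambda>u. u - n"]) auto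
    then have "bij_betw ((\<lambda>u. u + n) \<circ> f) {..<n} {n..<2 * n}" using f(1) bij_betw_trans by blast
    then have "bij_betw \<phi> {..<n} {n..<2 * n}"
      by (subst bij_betw_cong[where g = "(\<lambda>u. u + n) \<circ> f"]) (auto simp: \<phi>_def)
    then have "bij_betw \<phi> ({..<n} \<union> {2 * n}) ({n..<2 * n} \<union> {2 * n + 1})"
      by (rule bij_betw_combine) (auto simp: \<phi>_def bij_betw_def)
    then have "bij_betw \<phi> (region [2 * n]) (region [2 * n + 1])" by (simp only: R1 R2 Un_insert_right sup_bot_right)
    moreover have "U (\<phi> u) (\<phi> v) \<longleftrightarrow> U u v" if uv: "u \<in> region [2 * n]" "v \<in> region [2 * n]" for u v
    proof -
      have p: "\<phi> x = f x + n" "n \<le> \<phi> x" "\<phi> x < 2 * n" "\<phi> x \<noteq> 2 * n + 1" if "x < n" for x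
        using fn[OF that] that by (auto simp: \<phi>_def)
      have pn: "\<phi> (2 * n) = 2 * n + 1" by (simp add: \<phi>_def)
      consider "u < n" "v < n" | "u < n" "v = 2 * n" | "u = 2 * n" "v < n" | "u = 2 * n" "v = 2 * n"
        using uv R1 by auto
      then show ?thesis
      proof cases
        case 1
        then have "v \<noteq> 2 * n" by simp
        then show ?thesis using f(2)[OF 1] p[OF 1(1)] p[OF 1(2)] 1
          unfolding U_row(1)[OF 1(1)] U_row(2)[OF p(2,3)[OF 1(1)]] by simp
      next
        case 2
        then show ?thesis using pn unfolding U_row(1)[OF 2(1)] U_row(2)[OF p(2,3)[OF 2(1)]] by simp
      next
        case 3
        then show ?thesis using p[OF 3(2)] unfolding 3(1) pn U_row(3,4) by simp
      next
        case 4
        then show ?thesis unfolding 4 pn U_row(3,4) by simp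
      qed
    qed
    ultimately show "\<exists>\<phi>. liso \<phi> [2 * n] [2 * n + 1]" unfolding liso_def
      by (intro exI[of _ \<phi>]) (auto simp: \<phi>_def)
  next
    assume "\<exists>\<phi>. liso \<phi> [2 * n] [2 * n + 1]"
    then obtain \<phi> where b: "bij_betw \<phi> (insert (2 * n) {..<n}) (insert (2 * n + 1) {n..<2 * n})"
      and p: "\<phi> (2 * n) = 2 * n + 1"
      and a: "\<And>u v. u < n \<Longrightarrow> v < n \<Longrightarrow> U (\<phi> u) (\<phi> v) \<longleftrightarrow> U u v"
      unfolding liso_def R1 R2 by auto
    have "bij_betw \<phi> (insert (2 * n) {..<n} - {2 * n}) (insert (2 * n + 1) {n..<2 * n} - {\<phi> (2 * n)})"
      using b by (intro bij_betw_DiffI) (auto simp: bij_betw_def)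
    moreover have "insert (2 * n) {..<n} - {2 * n} = {..<n}"
      "insert (2 * n + 1) {n..<2 * n} - {\<phi> (2 * n)} = {n..<2 * n}" using p by auto
    ultimately have b': "bij_betw \<phi> {..<n} {n..<2 * n}" by simp
    define f where "f u = \<phi> u - n" for u
    have m: "n \<le> \<phi> u \<and> \<phi> u < 2 * n" if "u < n" for u using b' that by (auto simp: bij_betw_def)
    have "bij_betw (\<lambda>u. u - n) {n..<2 * n} {..<n}"
      by (rule bij_betw_byWitness[where f' = "\<lambda>u. u + n"]) auto
    then have "bij_betw ((\<lambda>u. u - n) \<circ> \<phi>) {..<n} {..<n}" using b' bij_betw_trans by blast
    then have "bij_betw f {..<n} {..<n}" by (simp add: f_def[abs_def] o_def)
    moreover have "(f u, f v) \<in> parcs H \<longleftrightarrow> (u, v) \<in> parcs G" if "u < n" "v < n" for u v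
    proof -
      have "v \<noteq> 2 * n" "\<phi> v \<noteq> 2 * n + 1" using that m[OF that(2)] by auto
      then show ?thesis using a[OF that] m[OF that(1)] m[OF that(2)] that
        unfolding U_row(1)[OF that(1)] f_def by (subst (asm) U_row(2)) auto
    qed
    ultimately show "\<exists>f. bij_betw f {..<n} {..<n} \<and>
      (\<forall>u<n. \<forall>v<n. (f u, f v) \<in> parcs H \<longleftrightarrow> (u, v) \<in> parcs G)" by blast
  qed
qed

end

section \<open>Programs over arrays\<close>

text \<open>
  In a state \<open>s\<close>, \<open>s k i\<close> is the entry \<open>i\<close> of the array \<open>k\<close>, and a scalar is the entry \<open>0\<close> of its array.
  The arrays are interleaved in memory: \<open>s k i\<close> is stored in register \<open>64 * i + k\<close>, so that an array need not
  have a length that is known in advance. \<open>Fr k l c\<close> executes \<open>c\<close> for each value of the scalar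
  \<open>k\<close> below the scalar \<open>l\<close>. \<open>wr\<close> is a syntactic frame condition, and \<open>lims\<close> collects the scalars that
  bound the loops.
\<close>

type_synonym st = "nat \<Rightarrow> nat \<Rightarrow> nat"

datatype ex = Cn nat | Rd nat ex | Pl ex ex | Mn ex ex
datatype cm = Wr nat ex ex | Sq cm cm | Ifn ex cm cm | Fr nat nat cm

primrec ev :: "ex \<Rightarrow> st \<Rightarrow> nat" where
  "ev (Cn c) s = c"
| "ev (Rd k e) s = s k (ev e s)"
| "ev (Pl a b) s = ev a s + ev b s"
| "ev (Mn a b) s = ev a s - ev b s"

definition setv :: "nat \<Rightarrow> nat \<Rightarrow> st \<Rightarrow> st" where
  "setv k i s = s(k := (s k)(0 := i))"

text \<open>The number of iterations is fixed on entry. The last \<open>setv\<close> reflects that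
  the compiled counter ends at the value of the limit.\<close>

primrec run :: "cm \<Rightarrow> st \<Rightarrow> st" where
  "run (Wr k i e) s = s(k := (s k)(ev i s := ev e s))"
| "run (Sq a b) s = run b (run a s)"
| "run (Ifn e a b) s = (if ev e s \<noteq> 0 then run a s else run b s)"
| "run (Fr k l c) s = setv k (s l 0) (fold (\<lambda>i s. run c (setv k i s)) [0..<s l 0] s)"

primrec wr :: "cm \<Rightarrow> nat set" where
  "wr (Wr k i e) = {k}"
| "wr (Sq a b) = wr a \<union> wr b"
| "wr (Ifn e a b) = wr a \<union> wr b"
| "wr (Fr k l c) = insert k (wr c)"

primrec lims :: "cm \<Rightarrow> nat set" where
  "lims (Wr k i e) = {}"
| "lims (Sq a b) = lims a \<union> lims b"
| "lims (Ifn e a b) = lims a \<union> lims b"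
| "lims (Fr k l c) = insert l (lims c)"

definition dbl :: "exp \<Rightarrow> exp" where "dbl e = Add e e"

definition addr :: "nat \<Rightarrow> exp \<Rightarrow> exp" where
  "addr k e = Add (Const k) (dbl (dbl (dbl (dbl (dbl (dbl e))))))"

primrec cmpe :: "ex \<Rightarrow> exp" where
  "cmpe (Cn c) = Const c"
| "cmpe (Rd k e) = Load (addr k (cmpe e))"
| "cmpe (Pl a b) = Add (cmpe a) (cmpe b)"
| "cmpe (Mn a b) = Monus (cmpe a) (cmpe b)"

primrec cmp :: "cm \<Rightarrow> prog" where
  "cmp (Wr k i e) = Store (addr k (cmpe i)) (cmpe e)"
| "cmp (Sq a b) = Seq (cmp a) (cmp b)"
| "cmp (Ifn e a b) = Cond (cmpe e) (cmp a) (cmp b)"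
| "cmp (Fr k l c) = Seq (Store (Const k) (Const 0))
     (While (Monus (Load (Const l)) (Load (Const k)))
        (Seq (cmp c) (Store (Const k) (Add (Load (Const k)) (Const 1)))))"

primrec wfe :: "ex \<Rightarrow> bool" where
  "wfe (Cn c) = True"
| "wfe (Rd k e) = (k < 64 \<and> wfe e)"
| "wfe (Pl a b) = (wfe a \<and> wfe b)"
| "wfe (Mn a b) = (wfe a \<and> wfe b)"

text \<open>Addresses \<open>64 * i + k\<close> are unambiguous for \<open>k < 64\<close>. A body
  that leaves counter and limit alone makes the compiled \<open>While\<close> run for exactly the
  rounds that \<open>run\<close> prescribes.\<close>

primrec wf :: "cm \<Rightarrow> bool" where
  "wf (Wr k i e) = (k < 64 \<and> wfe i \<and> wfe e)"
| "wf (Sq a b) = (wf a \<and> wf b)"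
| "wf (Ifn e a b) = (wfe e \<and> wf a \<and> wf b)"
| "wf (Fr k l c) = (k < 64 \<and> l < 64 \<and> k \<noteq> l \<and> k \<notin> wr c \<and> l \<notin> wr c \<and> wf c)"

text \<open>Each iteration of a compiled loop pays 6 for the test and 6 for the increment, hence
  \<open>12\<close>; the \<open>9\<close> consists of 3 for the initial store and 6 for the failing
  test.\<close>

primrec tm :: "cm \<Rightarrow> st \<Rightarrow> nat" where
  "tm (Wr k i e) s = cost (addr k (cmpe i)) + cost (cmpe e) + 1"
| "tm (Sq a b) s = tm a s + tm b (run a s)"
| "tm (Ifn e a b) s = cost (cmpe e) + 1 + (if ev e s \<noteq> 0 then tm a s else tm b s)"
| "tm (Fr k l c) s = 9 + (\<Sum>i<s l 0. 12 + tm c (setv k i (fold (\<lambda>i s. run c (setv k i s)) [0..<i] s)))"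

primrec kst :: "cm \<Rightarrow> nat" where
  "kst (Wr k i e) = cost (addr k (cmpe i)) + cost (cmpe e) + 1"
| "kst (Sq a b) = kst a + kst b"
| "kst (Ifn e a b) = cost (cmpe e) + 1 + kst a + kst b"
| "kst (Fr k l c) = 21 + kst c"

primrec dep :: "cm \<Rightarrow> nat" where
  "dep (Wr k i e) = 0"
| "dep (Sq a b) = max (dep a) (dep b)"
| "dep (Ifn e a b) = max (dep a) (dep b)"
| "dep (Fr k l c) = Suc (dep c)"

lemma setv_other [simp]: "x \<noteq> k \<Longrightarrow> setv k i s x = s x"
  and setv_same [simp]: "setv k i s k 0 = i"
  by (auto simp: setv_def)

lemma fold_upt_Suc [simp]: "fold f [0..<Suc i] s = f i (fold f [0..<i] s)"
  by simp

lemma fold_frame: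
  assumes "\<And>i s. f i s x = s x" shows "fold f [0..<n] s x = s x"
  by (induction n) (use assms in auto)

lemma run_frame: "x \<notin> wr c \<Longrightarrow> run c s x = s x"
proof (induction c arbitrary: s)
  case (Fr k l c)
  then show ?case by (auto intro!: fold_frame)
qed auto

lemma run_Fr:
  assumes "I 0 s"
    and "\<And>i s'. i < s l 0 \<Longrightarrow> I i s' \<Longrightarrow> (\<And>x. x \<notin> insert k (wr c) \<Longrightarrow> s' x = s x) \<Longrightarrow>
      I (Suc i) (run c (setv k i s'))"
  obtains s' where "I (s l 0) s'" "run (Fr k l c) s = setv k (s l 0) s'"
    "\<And>x. x \<notin> insert k (wr c) \<Longrightarrow> s' x = s x"
proof -
  let ?f = "\<lambda>i s. run c (setv k i s)"
  have fr: "fold ?f [0..<i] s x = s x" if "x \<notin> insert k (wr c)" for i x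
    using that by (intro fold_frame) (auto simp: run_frame)
  have "I i (fold ?f [0..<i] s)" if "i \<le> s l 0" for i
    using that
  proof (induction i)
    case (Suc i) then show ?case using assms(2) fr by simp
  qed (use assms(1) in simp)
  then show ?thesis using that[of "fold ?f [0..<s l 0] s"] fr by auto
qed

lemma tm_Fr:
  assumes "I 0 s"
    and "\<And>i s'. i < s l 0 \<Longrightarrow> I i s' \<Longrightarrow> (\<And>x. x \<notin> insert k (wr c) \<Longrightarrow> s' x = s x) \<Longrightarrow>
      I (Suc i) (run c (setv k i s')) \<and> tm c (setv k i s') \<le> T"
  shows "tm (Fr k l c) s \<le> 9 + s l 0 * (12 + T)"
proof -
  let ?f = "\<lambda>i s. run c (setv k i s)"
  have fr: "fold ?f [0..<i] s x = s x" if "x \<notin> insert k (wr c)" for i x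
    using that by (intro fold_frame) (auto simp: run_frame)
  have I: "I i (fold ?f [0..<i] s)" if "i \<le> s l 0" for i
    using that
  proof (induction i)
    case (Suc i) then show ?case using assms(2) fr by simp
  qed (use assms(1) in simp)
  have "(\<Sum>i<s l 0. 12 + tm c (setv k i (fold ?f [0..<i] s))) \<le> (\<Sum>i<s l 0. 12 + T)"
    using assms(2) I fr by (intro sum_mono) auto
  then show ?thesis by simp
qed

text \<open>A limit that is never written keeps its bound \<open>B\<close> throughout, so each
  nesting level costs at most a factor \<open>B + 1\<close>. This times every part of the main
  program except the outer loop of the clique enumeration.\<close>

lemma tm_bound:
  "(\<And>l. l \<in> lims c \<Longrightarrow> s l 0 \<le> B) \<Longrightarrow> lims c \<inter> wr c = {} \<Longrightarrow> tm c s \<le> kst c * (B + 1) ^ dep c"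
proof (induction c arbitrary: s)
  case (Sq a b)
  have 1: "tm a s \<le> kst a * (B + 1) ^ dep a" by (rule Sq.IH) (use Sq.prems in auto)
  have 2: "tm b (run a s) \<le> kst b * (B + 1) ^ dep b"
  proof (rule Sq.IH)
    fix l assume "l \<in> lims b"
    then have "run a s l = s l" using Sq.prems(2) by (intro run_frame) auto
    then show "run a s l 0 \<le> B" using Sq.prems(1) \<open>l \<in> lims b\<close> by simp
  qed (use Sq.prems in auto)
  let ?D = "(B + 1) ^ dep (Sq a b)"
  have "(B + 1) ^ dep a \<le> ?D" "(B + 1) ^ dep b \<le> ?D"
    by (auto intro!: power_increasing)
  then have 3: "kst a * (B + 1) ^ dep a \<le> kst a * ?D"
    "kst b * (B + 1) ^ dep b \<le> kst b * ?D" by (auto intro: mult_le_mono2)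
  have "tm (Sq a b) s \<le> kst a * ?D + kst b * ?D"
    unfolding tm.simps by (rule add_mono[OF order_trans[OF 1 3(1)] order_trans[OF 2 3(2)]])
  also have "\<dots> = kst (Sq a b) * ?D" by (simp only: kst.simps distrib_right)
  finally show ?case .
next
  case (Ifn e a b)
  have 1: "tm a s \<le> kst a * (B + 1) ^ dep a" by (rule Ifn.IH) (use Ifn.prems in auto)
  have 2: "tm b s \<le> kst b * (B + 1) ^ dep b" by (rule Ifn.IH) (use Ifn.prems in auto)
  let ?D = "(B + 1) ^ dep (Ifn e a b)"
  have "(B + 1) ^ dep a \<le> ?D" "(B + 1) ^ dep b \<le> ?D"
    by (auto intro!: power_increasing)
  then have 3: "kst a * (B + 1) ^ dep a \<le> kst a * ?D"
    "kst b * (B + 1) ^ dep b \<le> kst b * ?D" by (auto intro: mult_le_mono2)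
  have "1 \<le> ?D" by simp
  then have "cost (cmpe e) + 1 \<le> (cost (cmpe e) + 1) * ?D"
    using mult_le_mono2[of 1 ?D "cost (cmpe e) + 1"] by simp
  moreover have "(if ev e s \<noteq> 0 then tm a s else tm b s) \<le> kst a * ?D + kst b * ?D"
    using order_trans[OF 1 3(1)] order_trans[OF 2 3(2)] by (auto intro: trans_le_add1 trans_le_add2)
  ultimately have "tm (Ifn e a b) s \<le> (cost (cmpe e) + 1) * ?D + (kst a * ?D + kst b * ?D)"
    unfolding tm.simps by (rule add_mono)
  also have "\<dots> = kst (Ifn e a b) * ?D" by (simp only: kst.simps distrib_right)
  finally show ?case .
next
  case (Fr k l c)
  let ?D = "(B + 1) ^ dep c"
  have "tm (Fr k l c) s \<le> 9 + s l 0 * (12 + kst c * ?D)"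
  proof (rule tm_Fr[where I = "\<lambda>_ _. True"])
    fix i s' assume fr: "\<And>x. x \<notin> insert k (wr c) \<Longrightarrow> s' x = s x"
    have "tm c (setv k i s') \<le> kst c * ?D"
    proof (rule Fr.IH)
      fix l' assume l: "l' \<in> lims c"
      then have "l' \<noteq> k" "l' \<notin> wr c" using Fr.prems(2) by auto
      then show "setv k i s' l' 0 \<le> B" using Fr.prems(1)[of l'] fr[of l'] l by simp
    qed (use Fr.prems in auto)
    then show "True \<and> tm c (setv k i s') \<le> kst c * ?D" by simp
  qed simp
  also have "\<dots> \<le> 9 + B * (12 + kst c * ?D)" using Fr.prems(1)[of l] by simp
  also have "\<dots> \<le> 9 * ((B + 1) * ?D) + (B + 1) * (12 * ?D + kst c * ?D)"
  proof (rule add_mono)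
    have "1 \<le> (B + 1) ^ Suc (dep c)" by (rule one_le_power) simp
    then have "1 \<le> (B + 1) * ?D" by simp
    then show "9 \<le> 9 * ((B + 1) * ?D)" by linarith
    have "12 \<le> 12 * ?D" by simp
    then show "B * (12 + kst c * ?D) \<le> (B + 1) * (12 * ?D + kst c * ?D)"
      by (intro mult_le_mono) auto
  qed
  also have "\<dots> = kst (Fr k l c) * (B + 1) ^ dep (Fr k l c)" by (simp add: algebra_simps)
  finally show ?case .
qed (auto simp: addr_def)

section \<open>Correctness and running time of compiled programs\<close>

definition rep :: "mem \<Rightarrow> st \<Rightarrow> bool" where
  "rep m s \<longleftrightarrow> (\<forall>k<64. \<forall>i. m (64 * i + k) = s k i)"

lemma val_addr: "val (addr k e) m = 64 * val e m + k"
  by (simp add: addr_def dbl_def)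

lemma rep_scalar: "rep m s \<Longrightarrow> k < 64 \<Longrightarrow> m k = s k 0"
  using rep_def[of m s] by (metis add.left_neutral mult_zero_right)

lemma ev_cmpe: "rep m s \<Longrightarrow> wfe e \<Longrightarrow> val (cmpe e) m = ev e s"
  by (induction e) (auto simp: val_addr rep_def)

lemma rep_upd:
  assumes "rep m s" "k < 64" shows "rep (m(64 * i + k := x)) (s(k := (s k)(i := x)))"
  unfolding rep_def
proof (intro allI impI)
  fix l j :: nat assume "l < 64"
  have "l = k \<and> j = i" if e: "64 * j + l = 64 * i + k"
  proof -
    have "(64 * j + l) div 64 = j" "(64 * i + k) div 64 = i" using \<open>l < 64\<close> assms(2) by simp_all
    then have "j = i" using e by simp
    then show ?thesis using e by simp
  qed
  then have "64 * j + l = 64 * i + k \<longleftrightarrow> l = k \<and> j = i" by auto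
  then show "(m(64 * i + k := x)) (64 * j + l) = (s(k := (s k)(i := x))) l j"
    using assms(1) \<open>l < 64\<close> by (auto simp: rep_def)
qed

lemma exec_While:
  assumes step: "\<And>i m. i < n \<Longrightarrow> I i m \<Longrightarrow>
      val b m \<noteq> 0 \<and> (\<exists>t m'. exec P m t m' \<and> t \<le> T i \<and> I (Suc i) m')"
    and stop: "\<And>m. I n m \<Longrightarrow> val b m = 0"
    and start: "I 0 m"
  shows "\<exists>t m'. exec (While b P) m t m' \<and>
    t \<le> (\<Sum>i<n. cost b + 1 + T i) + cost b + 1 \<and> I n m'"
proof -
  have "\<exists>t m'. exec (While b P) m t m' \<and>
      t \<le> (\<Sum>i=j..<n. cost b + 1 + T i) + cost b + 1 \<and> I n m'" if "j \<le> n" "I j m" for j m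
    using that
  proof (induction "n - j" arbitrary: j m)
    case 0
    then have "I n m" by simp
    then have "exec (While b P) m (cost b + 1) m" by (intro exec.WhileFalse stop)
    then show ?case using \<open>I n m\<close> 0 by force
  next
    case (Suc d)
    then have j: "j < n" by simp
    obtain t m' where b: "val b m \<noteq> 0" and 1: "exec P m t m'" "t \<le> T j" "I (Suc j) m'"
      using step[OF j] Suc.prems by blast
    obtain t' m'' where 2: "exec (While b P) m' t' m''"
      "t' \<le> (\<Sum>i=Suc j..<n. cost b + 1 + T i) + cost b + 1" "I n m''"
      using Suc.hyps(1)[of "Suc j" m'] Suc.hyps(2) 1 j by (metis Suc_diff_Suc Suc_leI nat.inject)
    have "exec (While b P) m (cost b + 1 + t + t') m''" by (rule exec.WhileTrue[OF b 1(1) 2(1)])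
    moreover have "(\<Sum>i=j..<n. cost b + 1 + T i) = cost b + 1 + T j + (\<Sum>i=Suc j..<n. cost b + 1 + T i)"
      using j by (rule sum.atLeast_Suc_lessThan)
    ultimately show ?case using 1 2 by (intro exI[of _ "cost b + 1 + t + t'"] exI[of _ m'']) auto
  qed
  from this[of 0 m] show ?thesis using start by (simp add: lessThan_atLeast0)
qed

lemma exec_Store:
  "val a m = i \<Longrightarrow> val e m = x \<Longrightarrow> cost a + cost e + 1 = t \<Longrightarrow> exec (Store a e) m t (m(i := x))"
  using exec.Store by blast

theorem exec_cmp:
  "wf c \<Longrightarrow> rep m s \<Longrightarrow> \<exists>t m'. exec (cmp c) m t m' \<and> t \<le> tm c s \<and> rep m' (run c s)"
proof (induction c arbitrary: m s)
  case (Wr k i e)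
  let ?m = "m(val (addr k (cmpe i)) m := val (cmpe e) m)"
  have "exec (cmp (Wr k i e)) m (tm (Wr k i e) s) ?m" by (simp add: exec.Store[simplified])
  moreover have "rep ?m (run (Wr k i e) s)"
    using Wr rep_upd[of m s k] ev_cmpe by (simp add: val_addr)
  ultimately show ?case by blast
next
  case (Sq a b)
  obtain t m' where 1: "exec (cmp a) m t m'" "t \<le> tm a s" "rep m' (run a s)"
    using Sq.IH(1)[of m s] Sq.prems by auto
  obtain t' m'' where 2: "exec (cmp b) m' t' m''" "t' \<le> tm b (run a s)" "rep m'' (run b (run a s))"
    using Sq.IH(2)[of m' "run a s"] Sq.prems 1 by auto
  have "exec (cmp (Sq a b)) m (t + t') m''" using exec.Seq[OF 1(1) 2(1)] by simp
  then show ?case using 1 2 by (intro exI[of _ "t + t'"] exI[of _ m'']) auto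
next
  case (Ifn e a b)
  have v: "val (cmpe e) m = ev e s" using Ifn.prems ev_cmpe by simp
  show ?case
  proof (cases "ev e s = 0")
    case True
    obtain t m' where 1: "exec (cmp b) m t m'" "t \<le> tm b s" "rep m' (run b s)"
      using Ifn.IH(2)[of m s] Ifn.prems by auto
    have "exec (cmp (Ifn e a b)) m (cost (cmpe e) + 1 + t) m'"
      using exec.CondFalse[OF _ 1(1)] v True by simp
    then show ?thesis using 1 True by (intro exI[of _ "cost (cmpe e) + 1 + t"] exI[of _ m']) auto
  next
    case False
    obtain t m' where 1: "exec (cmp a) m t m'" "t \<le> tm a s" "rep m' (run a s)"
      using Ifn.IH(1)[of m s] Ifn.prems by auto
    have "exec (cmp (Ifn e a b)) m (cost (cmpe e) + 1 + t) m'"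
      using exec.CondTrue[OF _ 1(1)] v False by simp
    then show ?thesis using 1 False by (intro exI[of _ "cost (cmpe e) + 1 + t"] exI[of _ m']) auto
  qed
next
  case (Fr k l c)
  let ?f = "\<lambda>i s. run c (setv k i s)"
  let ?s = "\<lambda>i. fold ?f [0..<i] s"
  let ?b = "Monus (Load (Const l)) (Load (Const k))"
  let ?inc = "Store (Const k) (Add (Load (Const k)) (Const 1))"
  have wf: "k < 64" "l < 64" "k \<noteq> l" "k \<notin> wr c" "l \<notin> wr c" "wf c" using Fr.prems by auto
  have fl: "?s i l = s l" for i
    using wf by (intro fold_frame) (auto simp: run_frame)
  have upd: "rep (m'(k := x)) (setv k x s')" if "rep m' s'" for m' s' x
    using rep_upd[OF that wf(1), of 0 x] by (simp add: setv_def)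
  have e0: "exec (Store (Const k) (Const 0)) m 3 (m(k := 0))"
    by (rule exec_Store) simp_all
  have "\<exists>t m'. exec (While ?b (Seq (cmp c) ?inc)) (m(k := 0)) t m' \<and>
      t \<le> (\<Sum>i<s l 0. cost ?b + 1 + (tm c (setv k i (?s i)) + 6)) + cost ?b + 1 \<and>
      rep m' (setv k (s l 0) (?s (s l 0)))"
  proof (rule exec_While[where I = "\<lambda>i m'. rep m' (setv k i (?s i))"
        and T = "\<lambda>i. tm c (setv k i (?s i)) + 6"])
    show "rep (m(k := 0)) (setv k 0 (?s 0))" using upd[OF Fr.prems(2)] by simp
  next
    fix m' assume "rep m' (setv k (s l 0) (?s (s l 0)))"
    then show "val ?b m' = 0" using wf fl rep_scalar[of m'] by simp
  next
    fix i m' assume i: "i < s l 0" and r: "rep m' (setv k i (?s i))"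
    obtain t m'' where 1: "exec (cmp c) m' t m''" "t \<le> tm c (setv k i (?s i))"
      "rep m'' (?s (Suc i))" using Fr.IH[OF wf(6) r] by auto
    have mk: "m'' k = i" using rep_scalar[OF 1(3) wf(1)] wf(4) by (simp add: run_frame)
    have "exec ?inc m'' 6 (m''(k := Suc i))"
      by (rule exec_Store) (simp, use mk in simp, simp del: One_nat_def)
    then have "exec (Seq (cmp c) ?inc) m' (t + 6) (m''(k := Suc i))" by (rule exec.Seq[OF 1(1)])
    moreover have "val ?b m' \<noteq> 0"
      using rep_scalar[OF r wf(1)] rep_scalar[OF r wf(2)] wf(3) i fl by simp
    ultimately show "val ?b m' \<noteq> 0 \<and> (\<exists>t m'a. exec (Seq (cmp c) ?inc) m' t m'a \<and>
        t \<le> tm c (setv k i (?s i)) + 6 \<and> rep m'a (setv k (Suc i) (?s (Suc i))))"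
      using 1(2) upd[OF 1(3), of "Suc i"] by (metis add_le_mono1)
  qed
  then obtain t m' where 2: "exec (While ?b (Seq (cmp c) ?inc)) (m(k := 0)) t m'"
      "t \<le> (\<Sum>i<s l 0. cost ?b + 1 + (tm c (setv k i (?s i)) + 6)) + cost ?b + 1"
      "rep m' (setv k (s l 0) (?s (s l 0)))" by blast
  have "exec (cmp (Fr k l c)) m (3 + t) m'" using exec.Seq[OF e0 2(1)] by simp
  moreover have "3 + t \<le> tm (Fr k l c) s" using 2(2) by (simp add: add.commute add.left_commute)
  moreover have "rep m' (run (Fr k l c) s)" using 2(3) by simp
  ultimately show ?case by blast
qed

section \<open>The computable bound\<close>

definition fbound :: "nat \<Rightarrow> nat \<Rightarrow> nat" where
  "fbound K p = 2 ^ (K * ((p + 2) * (p + 2)))"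

text \<open>The argument is found in scalar \<open>0\<close>, and its sum with 2 is kept in scalar
  \<open>7\<close>. Doubling scalar \<open>3\<close> in three nested loops replaces both
  multiplication and exponentiation.\<close>

definition fprog :: "nat \<Rightarrow> cm" where
  "fprog K = Sq (Wr 7 (Cn 0) (Pl (Rd 0 (Cn 0)) (Cn 2))) (Sq (Wr 2 (Cn 0) (Cn K)) (Sq (Wr 3 (Cn 0) (Cn 1))
     (Sq (Fr 4 7 (Fr 5 7 (Fr 6 2 (Wr 3 (Cn 0) (Pl (Rd 3 (Cn 0)) (Rd 3 (Cn 0)))))))
       (Wr 0 (Cn 0) (Rd 3 (Cn 0))))))"

lemma computable_fbound: "computable (fbound K)"
proof -
  let ?b = "Wr 3 (Cn 0) (Pl (Rd 3 (Cn 0)) (Rd 3 (Cn 0)))"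
  have l1: "run (Fr 6 2 ?b) s 3 0 = s 3 0 * 2 ^ s 2 0" for s
    by (rule run_Fr[where I = "\<lambda>i s'. s' 3 0 = s 3 0 * 2 ^ i" and k = 6 and l = 2 and c = ?b and s = s]) auto
  have l2: "run (Fr 5 7 (Fr 6 2 ?b)) s 3 0 = s 3 0 * 2 ^ (s 2 0 * s 7 0)" for s
    by (rule run_Fr[where I = "\<lambda>i s'. s' 3 0 = s 3 0 * 2 ^ (s 2 0 * i)" and k = 5 and l = 7
          and c = "Fr 6 2 ?b" and s = s]) (auto simp: l1 power_add simp del: run.simps)
  have l3: "run (Fr 4 7 (Fr 5 7 (Fr 6 2 ?b))) s 3 0 = s 3 0 * 2 ^ (s 2 0 * s 7 0 * s 7 0)" for s
    by (rule run_Fr[where I = "\<lambda>i s'. s' 3 0 = s 3 0 * 2 ^ (s 2 0 * s 7 0 * i)" and k = 4 and l = 7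
          and c = "Fr 5 7 (Fr 6 2 ?b)" and s = s]) (auto simp: l2 power_add simp del: run.simps)
  have "\<exists>b. outputs_within (cmp (fprog K)) [x] (fbound K x) b" for x
  proof -
    let ?s = "\<lambda>k i. input_mem [x] (64 * i + k)"
    have "rep (input_mem [x]) ?s" by (simp add: rep_def)
    moreover have "wf (fprog K)" by (simp add: fprog_def)
    ultimately obtain t m' where m: "exec (cmp (fprog K)) (input_mem [x]) t m'" "rep m' (run (fprog K) ?s)"
      using exec_cmp by blast
    have "m' 0 = run (fprog K) ?s 0 0" using rep_scalar[OF m(2)] by simp
    also have "\<dots> = fbound K x"
      by (simp add: fprog_def l3 fbound_def input_mem_def algebra_simps del: run.simps(4))
    finally show ?thesis using m(1) unfolding outputs_within_def by blast
  qed
  then show ?thesis unfolding computable_def by blast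
qed

section \<open>Moving the input into an array\<close>

text \<open>The input fills consecutive registers, whereas array \<open>1\<close> has stride 64.
  Adding \<open>2 * n\<close> to register \<open>1\<close> in \<open>n\<close> rounds gives the last
  input address \<open>2 * (n * n)\<close>, from which the second loop spreads the input
  downwards.\<close>

definition prelude :: prog where
  "prelude = Seq
    (While (Monus (Load (Const 0)) (Load (Add (Load (Const 0)) (Const 2))))
      (Seq (Store (Const 1) (Add (Load (Const 1)) (Add (Load (Const 0)) (Load (Const 0)))))
           (Store (Add (Load (Const 0)) (Const 2)) (Add (Load (Add (Load (Const 0)) (Const 2))) (Const 1)))))
    (Seq (Store (Add (Load (Const 0)) (Const 2)) (Const 0))
      (While (Monus (Load (Const 1)) (Const 1))
        (Seq (Store (addr 1 (Load (Const 1))) (Load (Load (Const 1))))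
             (Store (Const 1) (Monus (Load (Const 1)) (Const 1))))))"

text \<open>Registers \<open>1\<close> and \<open>n + 2\<close> hold diagonal entries of the first matrix or lie beyond the input,
  so they are free for use as counters. The input is moved in descending order of addresses, since
  the target address always exceeds the source address.\<close>

lemma exec_prelude:
  assumes "m 0 = n" "m 1 = 0" "m (n + 2) = 0"
  shows "\<exists>t m'. exec prelude m t m' \<and> t \<le> 1000 * (n * n + n + 1) \<and> m' 0 = n \<and>
    (\<forall>i. 2 \<le> i \<longrightarrow> i \<le> 2 * (n * n) \<longrightarrow> m' (64 * i + 1) = m i)"
proof -
  let ?b = "Monus (Load (Const 0)) (Load (Add (Load (Const 0)) (Const 2)))"
  let ?s1 = "Store (Const 1) (Add (Load (Const 1)) (Add (Load (Const 0)) (Load (Const 0))))"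
  let ?s2 = "Store (Add (Load (Const 0)) (Const 2)) (Add (Load (Add (Load (Const 0)) (Const 2))) (Const 1))"
  let ?I = "\<lambda>i m'. m' = m(1 := i * (2 * n), n + 2 := i)"
  have "\<exists>t m'. exec (While ?b (Seq ?s1 ?s2)) m t m' \<and>
      t \<le> (\<Sum>i<n. cost ?b + 1 + 22) + cost ?b + 1 \<and> ?I n m'"
  proof (rule exec_While[where I = ?I and T = "\<lambda>_. 22"])
    fix i m' assume i: "i < n" "?I i m'"
    have e1: "exec ?s1 m' 10 (m'(1 := Suc i * (2 * n)))"
      by (rule exec_Store) (use i assms in \<open>simp_all add: algebra_simps del: One_nat_def\<close>)
    let ?m = "m'(1 := Suc i * (2 * n))"
    have e2: "exec ?s2 ?m 12 (?m(n + 2 := Suc i))"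
      by (rule exec_Store) (use i assms in \<open>simp_all del: One_nat_def\<close>)
    have "?m(n + 2 := Suc i) = m(1 := Suc i * (2 * n), n + 2 := Suc i)" using i by (auto simp: fun_eq_iff)
    then have "exec (Seq ?s1 ?s2) m' (10 + 12) (m(1 := Suc i * (2 * n), n + 2 := Suc i))"
      using exec.Seq[OF e1 e2] by simp
    then have "\<exists>t m''. exec (Seq ?s1 ?s2) m' t m'' \<and> t \<le> 22 \<and> ?I (Suc i) m''"
      by (intro exI[of _ "10 + 12"] exI[of _ "m(1 := Suc i * (2 * n), n + 2 := Suc i)"]) simp
    moreover have "val ?b m' \<noteq> 0" using i assms by simp
    ultimately show "val ?b m' \<noteq> 0 \<and> (\<exists>t m''. exec (Seq ?s1 ?s2) m' t m'' \<and> t \<le> 22 \<and> ?I (Suc i) m'')"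
      by blast
  qed (use assms in \<open>auto simp: fun_eq_iff\<close>)
  then obtain t1 where A: "exec (While ?b (Seq ?s1 ?s2)) m t1 (m(1 := n * (2 * n), n + 2 := n))"
    "t1 \<le> 31 * n + 9" by auto
  let ?m1 = "m(1 := n * (2 * n), n + 2 := n)"
  let ?m2 = "m(1 := 2 * (n * n))"
  have "exec (Store (Add (Load (Const 0)) (Const 2)) (Const 0)) ?m1 6 (?m1(n + 2 := 0))"
    by (rule exec_Store) (use assms in \<open>simp_all del: One_nat_def\<close>)
  moreover have "?m1(n + 2 := 0) = ?m2" using assms by (auto simp: fun_eq_iff)
  ultimately have B: "exec (Store (Add (Load (Const 0)) (Const 2)) (Const 0)) ?m1 6 ?m2" by simp
  let ?b' = "Monus (Load (Const 1)) (Const 1)"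
  let ?s3 = "Store (addr 1 (Load (Const 1))) (Load (Load (Const 1)))"
  let ?s4 = "Store (Const 1) (Monus (Load (Const 1)) (Const 1))"
  let ?k = "2 * (n * n)"
  let ?J = "\<lambda>i m'. m' 0 = n \<and> m' 1 = ?k - i \<and> (\<forall>j. 2 \<le> j \<longrightarrow> j \<le> ?k - i \<longrightarrow> m' j = m j) \<and>
      (\<forall>j. 2 \<le> j \<longrightarrow> j \<le> ?k \<longrightarrow> ?k - i < j \<longrightarrow> m' (64 * j + 1) = m j)"
  have "\<exists>t m'. exec (While ?b' (Seq ?s3 ?s4)) ?m2 t m' \<and>
      t \<le> (\<Sum>i<?k - 1. cost ?b' + 1 + 205) + cost ?b' + 1 \<and> ?J (?k - 1) m'"
  proof (rule exec_While[where I = ?J and T = "\<lambda>_. 205"])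
    fix i m' assume i: "i < ?k - 1" and J: "?J i m'"
    define c where "c = ?k - i"
    have c: "2 \<le> c" "c \<le> ?k" "?k - Suc i = c - 1" using i by (auto simp: c_def)
    let ?m = "m'(64 * c + 1 := m c)"
    have "exec ?s3 m' 197 ?m"
      by (rule exec_Store) (use J c in \<open>simp_all add: val_addr c_def[symmetric] del: One_nat_def\<close>,
          simp add: addr_def dbl_def)
    moreover have "exec ?s4 ?m 6 (?m(1 := c - 1))"
      by (rule exec_Store) (use J c in \<open>simp_all add: c_def[symmetric] del: One_nat_def\<close>)
    ultimately have "exec (Seq ?s3 ?s4) m' (197 + 6) (?m(1 := c - 1))" by (rule exec.Seq)
    moreover have "?J (Suc i) (?m(1 := c - 1))"
    proof -
      have J': "m' 0 = n" "m' 1 = c" "\<And>j. 2 \<le> j \<Longrightarrow> j \<le> c \<Longrightarrow> m' j = m j"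
        "\<And>j. 2 \<le> j \<Longrightarrow> j \<le> ?k \<Longrightarrow> c < j \<Longrightarrow> m' (64 * j + 1) = m j"
        using J unfolding c_def[symmetric] by auto
      show ?thesis unfolding c(3)
      proof (intro conjI allI impI)
        fix j assume "2 \<le> j" "j \<le> c - 1"
        then show "(?m(1 := c - 1)) j = m j" using J'(3)[of j] c(1) by auto
      next
        fix j assume j: "2 \<le> j" "j \<le> ?k" "c - 1 < j"
        show "(?m(1 := c - 1)) (64 * j + 1) = m j"
        proof (cases "j = c")
          case False
          then show ?thesis using J'(4)[of j] j by simp
        qed (use j in simp)
      qed (use J' in simp_all)
    qed
    moreover have "val ?b' m' \<noteq> 0" using J c by (simp add: c_def[symmetric])
    ultimately show "val ?b' m' \<noteq> 0 \<and> (\<exists>t m''. exec (Seq ?s3 ?s4) m' t m'' \<and> t \<le> 205 \<and> ?J (Suc i) m'')"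
      by (intro conjI exI[of _ "197 + 6"] exI[of _ "?m(1 := c - 1)"]) simp_all
  qed (use assms in auto)
  then obtain t3 m3 where C: "exec (While ?b' (Seq ?s3 ?s4)) ?m2 t3 m3"
    "t3 \<le> (\<Sum>i<?k - 1. cost ?b' + 1 + 205) + cost ?b' + 1" "?J (?k - 1) m3" by blast
  have t3: "t3 \<le> 210 * ?k + 5" using C(2) by simp
  have "exec prelude m (t1 + (6 + t3)) m3"
    unfolding prelude_def by (rule exec.Seq[OF A(1) exec.Seq[OF B C(1)]])
  moreover have "t1 + (6 + t3) \<le> 1000 * (n * n + n + 1)" using t3 A(2) by simp
  moreover have "m3 0 = n \<and> (\<forall>i. 2 \<le> i \<longrightarrow> i \<le> ?k \<longrightarrow> m3 (64 * i + 1) = m i)" using C(3) by auto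
  ultimately show ?thesis by blast
qed

section \<open>Comparisons and two-dimensional tables\<close>

definition Dfx :: "ex \<Rightarrow> ex \<Rightarrow> ex" where "Dfx a b = Pl (Mn a b) (Mn b a)"
definition Eqx :: "ex \<Rightarrow> ex \<Rightarrow> ex" where "Eqx a b = Mn (Cn 1) (Dfx a b)"

lemma ev_Dfx [simp]: "ev (Dfx a b) s = 0 \<longleftrightarrow> ev a s = ev b s" "0 < ev (Dfx a b) s \<longleftrightarrow> ev a s \<noteq> ev b s"
  and ev_Eqx [simp]: "ev (Eqx a b) s = of_bool (ev a s = ev b s)"
  by (auto simp: Dfx_def Eqx_def)

lemma wfe_Dfx [simp]: "wfe (Dfx a b) \<longleftrightarrow> wfe a \<and> wfe b"
  and wfe_Eqx [simp]: "wfe (Eqx a b) \<longleftrightarrow> wfe a \<and> wfe b"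
  by (auto simp: Dfx_def Eqx_def)

notation Sq (infixr ";;" 60)

abbreviation Sc :: "nat \<Rightarrow> ex" where "Sc k \<equiv> Rd k (Cn 0)"
abbreviation Ws :: "nat \<Rightarrow> ex \<Rightarrow> cm" where "Ws k e \<equiv> Wr k (Cn 0) e"

lemma idx_inj: "b < m \<Longrightarrow> b' < m \<Longrightarrow> a * m + b = a' * m + b' \<longleftrightarrow> a = a' \<and> b = (b' :: nat)"
proof
  assume b: "b < m" "b' < m" and e: "a * m + b = a' * m + b'"
  have "(a * m + b) div m = a" "(a' * m + b') div m = a'" using b by simp_all
  then have "a = a'" unfolding e by blast
  then show "a = a' \<and> b = b'" using e by simp
qed simp

text \<open>An invariant rule for tables filled row by row: \<open>Q a b\<close> is the correctness
  of one entry, and the body may rely on all lexicographically smaller entries. This suits tables in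
  which the row of a clique is computed from the row of its tail.\<close>

lemma fill2:
  assumes wf: "wf (Fr i li (Fr y ly body))" "i \<noteq> y" "li \<noteq> y" "ly \<noteq> i"
    and n: "s li 0 = n" and m: "s ly 0 = m"
    and insens: "\<And>a b x s'. Q a b (setv i x s') = Q a b s'" "\<And>a b x s'. Q a b (setv y x s') = Q a b s'"
    and step: "\<And>a b s'. a < n \<Longrightarrow> b < m \<Longrightarrow>
      (\<And>x. x \<notin> insert i (insert y (wr body)) \<Longrightarrow> s' x = s x) \<Longrightarrow> s' i 0 = a \<Longrightarrow> s' y 0 = b \<Longrightarrow>
      (\<And>a' b'. b' < m \<Longrightarrow> a' < a \<or> a' = a \<and> b' < b \<Longrightarrow> Q a' b' s') \<Longrightarrow>
      Q a b (run body s') \<and>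
      (\<forall>a' b'. b' < m \<longrightarrow> (a' < a \<or> a' = a \<and> b' < b) \<longrightarrow> Q a' b' (run body s'))"
  shows "\<forall>a<n. \<forall>b<m. Q a b (run (Fr i li (Fr y ly body)) s)"
proof -
  obtain s1 where 1: "\<forall>a<s li 0. \<forall>b<m. Q a b s1" "run (Fr i li (Fr y ly body)) s = setv i (s li 0) s1"
  proof (rule run_Fr[where I = "\<lambda>a0 s'. \<forall>a<a0. \<forall>b<m. Q a b s'" and k = i and l = li and c = "Fr y ly body" and s = s])
    fix a s' assume a: "a < s li 0" and I: "\<forall>a'<a. \<forall>b<m. Q a' b s'"
      and fr: "\<And>x. x \<notin> insert i (wr (Fr y ly body)) \<Longrightarrow> s' x = s x"
    let ?s = "setv i a s'"
    have m': "?s ly 0 = m" using wf m fr[of ly] by auto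
    obtain s2 where 2: "\<forall>a' b'. b' < m \<longrightarrow> (a' < a \<or> a' = a \<and> b' < ?s ly 0) \<longrightarrow> Q a' b' s2"
      "run (Fr y ly body) ?s = setv y (?s ly 0) s2"
    proof (rule run_Fr[where I = "\<lambda>b0 s'. \<forall>a' b'. b' < m \<longrightarrow> (a' < a \<or> a' = a \<and> b' < b0) \<longrightarrow> Q a' b' s'"
          and k = y and l = ly and c = body and s = ?s])
      fix b s'' assume b: "b < ?s ly 0"
        and I2: "\<forall>a' b'. b' < m \<longrightarrow> (a' < a \<or> a' = a \<and> b' < b) \<longrightarrow> Q a' b' s''"
        and fr2: "\<And>x. x \<notin> insert y (wr body) \<Longrightarrow> s'' x = ?s x"
      have "s'' i = ?s i" using wf by (intro fr2) auto
      then have A: "setv y b s'' i 0 = a" using wf by simp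
      have F: "setv y b s'' x = s x" if "x \<notin> insert i (insert y (wr body))" for x
        using fr2[of x] fr[of x] that by auto
      have "Q a b (run body (setv y b s'')) \<and> (\<forall>a' b'. b' < m \<longrightarrow> (a' < a \<or> a' = a \<and> b' < b) \<longrightarrow>
          Q a' b' (run body (setv y b s'')))"
        by (rule step) (use a b m' n I2 insens A F in auto)
      then show "\<forall>a' b'. b' < m \<longrightarrow> (a' < a \<or> a' = a \<and> b' < Suc b) \<longrightarrow> Q a' b' (run body (setv y b s''))"
        by (auto simp: less_Suc_eq)
    qed (use I insens in auto)
    then show "\<forall>a'<Suc a. \<forall>b<m. Q a' b (run (Fr y ly body) ?s)"
      using m' insens by (auto simp: less_Suc_eq)
  qed auto
  then show ?thesis using insens n by simp
qed

section \<open>The adjacency table\<close>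

text \<open>
  The scalars and arrays of the program, where \<open>m = 2 * n + 2\<close>, \<open>N\<close> is the number of ordered cliques, and \<open>i\<close>
  stands for the \<open>i\<close>-th ordered clique in order of their creation, beginning with the empty one:

  \<^item> \<open>0\<close>: \<open>n\<close>; \<open>1\<close>: the input; \<open>2\<close>: \<open>m\<close>; \<open>3\<close>: \<open>N\<close>; \<open>4\<close>: \<open>m * m\<close>; \<open>32\<close>: \<open>m + 1\<close>;
  \<^item> \<open>6\<close> to \<open>13\<close>: loop variables; \<open>26\<close> to \<open>30\<close> and \<open>63\<close>: temporaries; \<open>31\<close>: the next clique to be extended;
  \<^item> \<open>14\<close> and \<open>25\<close>: the multiples of \<open>m\<close> and \<open>n\<close>, since machines cannot multiply; entry \<open>(i, v)\<close> of a table with \<open>m\<close>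
    columns has index \<open>i * m + v\<close>;
  \<^item> \<open>15\<close>: adjacency table; \<open>16\<close>: the clique \<open>v # i\<close>, or \<open>0\<close>; \<open>17\<close> and \<open>18\<close>: tail and head of \<open>i\<close>;
  \<^item> \<open>19\<close>: whether \<open>v\<close> is in \<open>i\<close>; \<open>20\<close>: the subsequence of the neighbours of \<open>v\<close> in \<open>i\<close>; \<open>21\<close>: its pattern;
  \<^item> \<open>22\<close>: marked vertices; \<open>23\<close>: the clique \<open>restr i v\<close> if \<open>v\<close> is in \<open>kids i\<close>, otherwise \<open>0\<close>;
  \<^item> \<open>24\<close>: the colours, those of round \<open>r\<close> from index \<open>r * N\<close> on; \<open>33\<close> and \<open>34\<close>: start indices of the old and
    the new colours.
\<close>

definition pInit :: cm where
  "pInit = Wr 1 (Cn 1) (Cn 0) ;; Ws 2 (Pl (Pl (Sc 0) (Sc 0)) (Cn 2)) ;; Ws 32 (Pl (Sc 2) (Cn 1)) ;;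
     Ws 14 (Cn 0) ;; Ws 25 (Cn 0)"
definition pOffsets :: cm where
  "pOffsets = Fr 6 32 (Wr 14 (Pl (Sc 6) (Cn 1)) (Pl (Rd 14 (Sc 6)) (Sc 2))) ;;
     Fr 6 0 (Wr 25 (Pl (Sc 6) (Cn 1)) (Pl (Rd 25 (Sc 6)) (Sc 0))) ;;
     Ws 4 (Rd 14 (Sc 2))"
definition pAdjEntry :: cm where
  "pAdjEntry =
     Ifn (Mn (Sc 0) (Sc 8))
       (Ifn (Mn (Sc 0) (Sc 9)) (Ws 29 (Rd 1 (Pl (Cn 1) (Pl (Rd 25 (Sc 8)) (Sc 9)))))
         (Ws 29 (Eqx (Sc 9) (Pl (Sc 0) (Sc 0)))))
       (Ifn (Mn (Pl (Sc 0) (Sc 0)) (Sc 8))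
         (Ifn (Mn (Sc 0) (Sc 9)) (Ws 29 (Cn 0))
           (Ifn (Mn (Pl (Sc 0) (Sc 0)) (Sc 9))
             (Ws 29 (Rd 1 (Pl (Pl (Cn 1) (Rd 25 (Sc 0))) (Pl (Rd 25 (Mn (Sc 8) (Sc 0))) (Mn (Sc 9) (Sc 0))))))
             (Ws 29 (Eqx (Sc 9) (Pl (Pl (Sc 0) (Sc 0)) (Cn 1))))))
         (Ifn (Eqx (Sc 8) (Pl (Sc 0) (Sc 0)))
           (Ifn (Mn (Sc 0) (Sc 9)) (Ws 29 (Cn 1)) (Ws 29 (Cn 0)))
           (Ifn (Mn (Sc 0) (Sc 9)) (Ws 29 (Cn 0))
             (Ifn (Mn (Pl (Sc 0) (Sc 0)) (Sc 9)) (Ws 29 (Cn 1)) (Ws 29 (Cn 0)))))) ;;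
     Wr 15 (Pl (Rd 14 (Sc 8)) (Sc 9)) (Sc 29)"
definition pAdj :: cm where "pAdj = Fr 8 2 (Fr 9 2 pAdjEntry)"

lemma wr_A [simp]: "wr pInit = {1, 2, 32, 14, 25}" "wr pOffsets = {6, 14, 25, 4}" "wr pAdjEntry = {29, 15}"
  "wr pAdj = {8, 9, 29, 15}"
  by (auto simp: pInit_def pOffsets_def pAdjEntry_def pAdj_def)

lemma wf_A [simp]: "wf pInit" "wf pOffsets" "wf pAdjEntry" "wf pAdj"
  by (auto simp: pInit_def pOffsets_def pAdjEntry_def pAdj_def)

lemma multiples:
  assumes "k \<noteq> a" "d \<noteq> a" "d \<noteq> k" "l \<noteq> k" "l \<noteq> a" "s a 0 = 0"
  shows "\<forall>i\<le>s l 0. run (Fr k l (Wr a (Pl (Sc k) (Cn 1)) (Pl (Rd a (Sc k)) (Sc d)))) s a i = i * s d 0"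
proof -
  obtain s' where "\<forall>i\<le>s l 0. s' a i = i * s d 0"
    "run (Fr k l (Wr a (Pl (Sc k) (Cn 1)) (Pl (Rd a (Sc k)) (Sc d)))) s = setv k (s l 0) s'"
  proof (rule run_Fr[where I = "\<lambda>j s'. \<forall>i\<le>j. s' a i = i * s d 0" and k = k and l = l and s = s
        and c = "Wr a (Pl (Sc k) (Cn 1)) (Pl (Rd a (Sc k)) (Sc d))"])
    fix i s' assume "\<forall>i'\<le>i. s' a i' = i' * s d 0"
      "\<And>x. x \<notin> insert k (wr (Wr a (Pl (Sc k) (Cn 1)) (Pl (Rd a (Sc k)) (Sc d)))) \<Longrightarrow> s' x = s x"
    then show "\<forall>i'\<le>Suc i. run (Wr a (Pl (Sc k) (Cn 1)) (Pl (Rd a (Sc k)) (Sc d))) (setv k i s') a i' = i' * s d 0"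
      using assms by (auto simp: le_Suc_eq)
  qed (use assms in auto)
  then show ?thesis using assms by simp
qed

locale adj_input =
  fixes n m :: nat and A B :: "(nat \<times> nat) set" and s :: st
  assumes m: "m = 2 * n + 2" and s0: "s 0 0 = n"
    and G: "\<And>i j. i < n \<Longrightarrow> j < n \<Longrightarrow> 0 < i * n + j \<Longrightarrow> s 1 (1 + (i * n + j)) = of_bool ((i, j) \<in> A)"
    and H: "\<And>i j. i < n \<Longrightarrow> j < n \<Longrightarrow> s 1 (1 + n * n + (i * n + j)) = of_bool ((i, j) \<in> B)"
    and diag: "(0, 0) \<notin> A"
begin

lemma offsets_spec:
  defines "s' \<equiv> run (pInit ;; pOffsets) s"
  shows "s' 0 = s 0" "s' 2 0 = m" "s' 32 0 = m + 1" "s' 4 0 = m * m" "\<And>i. i \<le> m + 1 \<Longrightarrow> s' 14 i = i * m"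
    "\<And>i. i \<le> n \<Longrightarrow> s' 25 i = i * n" "s' 1 = (s 1)(1 := 0)"
proof -
  let ?s1 = "run pInit s"
  let ?a = "Fr 6 32 (Wr 14 (Pl (Sc 6) (Cn 1)) (Pl (Rd 14 (Sc 6)) (Sc 2)))"
  let ?b = "Fr 6 0 (Wr 25 (Pl (Sc 6) (Cn 1)) (Pl (Rd 25 (Sc 6)) (Sc 0)))"
  have 1: "?s1 0 = s 0" "?s1 2 0 = m" "?s1 32 0 = m + 1" "?s1 14 0 = 0" "?s1 25 0 = 0" "?s1 1 = (s 1)(1 := 0)"
    using s0 m by (auto simp: pInit_def)
  have 2: "\<forall>i\<le>m + 1. run ?a ?s1 14 i = i * m"
    using multiples[of 6 14 2 32 ?s1] 1 by (simp del: run.simps)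
  let ?s2 = "run ?a ?s1"
  have f: "?s2 x = ?s1 x" if "x \<notin> {6, 14}" for x using that by (intro run_frame) auto
  have 3: "\<forall>i\<le>n. run ?b ?s2 25 i = i * n"
    using multiples[of 6 25 0 0 ?s2] 1 f s0 by (simp del: run.simps)
  let ?s3 = "run ?b ?s2"
  have g: "?s3 x = ?s2 x" if "x \<notin> {6, 25}" for x using that by (intro run_frame) auto
  have "s' = ?s3(4 := (?s3 4)(0 := ?s3 14 (?s3 2 0)))"
    unfolding s'_def pOffsets_def by (simp del: run.simps(4))
  moreover have "?s3 2 0 = m" "?s3 14 = ?s2 14" using f g 1 by (simp_all del: run.simps)
  ultimately show "s' 0 = s 0" "s' 2 0 = m" "s' 32 0 = m + 1" "s' 4 0 = m * m" "\<And>i. i \<le> m + 1 \<Longrightarrow> s' 14 i = i * m"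
    "\<And>i. i \<le> n \<Longrightarrow> s' 25 i = i * n" "s' 1 = (s 1)(1 := 0)"
    using f g 1 2 3 by (simp_all del: run.simps)
qed

lemma adj_entry_spec:
  assumes "t 0 = s 0" "t 1 = (s 1)(1 := 0)" "\<And>i. i \<le> m \<Longrightarrow> t 14 i = i * m"
    "\<And>i. i \<le> n \<Longrightarrow> t 25 i = i * n" "t 8 0 = u" "t 9 0 = v" "u < m" "v < m"
  shows "run pAdjEntry t 15 = (t 15)(u * m + v := of_bool (uadj n A B u v))"
proof -
  have tA: "t 1 (Suc (i * n + j)) = of_bool ((i, j) \<in> A)" if "i < n" "j < n" for i j
    using G[OF that] assms(2) diag that by (cases "i = 0 \<and> j = 0") auto
  have tB: "t 1 (Suc (n * n + (i * n + j))) = of_bool ((i, j) \<in> B)" if "i < n" "j < n" for i j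
  proof -
    have "n * n \<noteq> 0" using that by simp
    then have "Suc (n * n + (i * n + j)) \<noteq> 1" by simp
    then show ?thesis using H[OF that] assms(2) by (metis fun_upd_other plus_1_eq_Suc add.assoc)
  qed
  have "t 25 n = n * n" "t 14 u = u * m" using assms(3,4,7) by simp_all
  consider "u < n" | "n \<le> u" "u < 2 * n" | "u = 2 * n" | "u = 2 * n + 1" using assms(7) m by fastforce
  then show ?thesis
  proof cases
    case 1
    then show ?thesis using \<open>t 14 u = u * m\<close> assms(1,4,5,6) s0 tA[of u v]
      by (auto simp: pAdjEntry_def uadj_def)
  next
    case 2
    have "u - n < n" using 2 by simp
    moreover have "v - n < n" if "v < 2 * n" using that 2 by (cases "n \<le> v") auto
    ultimately show ?thesis
      using \<open>t 14 u = u * m\<close> \<open>t 25 n = n * n\<close> assms(1,4,5,6) s0 2 tB[of "u - n" "v - n"]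
      by (auto simp: pAdjEntry_def uadj_def)
  next
    case 3
    then show ?thesis using \<open>t 14 u = u * m\<close> assms(1,5,6) s0 by (auto simp: pAdjEntry_def uadj_def)
  next
    case 4
    then show ?thesis using \<open>t 14 u = u * m\<close> assms(1,5,6) s0 by (auto simp: pAdjEntry_def uadj_def)
  qed
qed

lemma adj_spec:
  defines "s' \<equiv> run (pInit ;; pOffsets ;; pAdj) s"
  shows "s' 0 0 = n" "s' 2 0 = m" "s' 32 0 = m + 1" "s' 4 0 = m * m" "\<And>i. i \<le> m + 1 \<Longrightarrow> s' 14 i = i * m"
    "\<And>u v. u < m \<Longrightarrow> v < m \<Longrightarrow> s' 15 (u * m + v) = of_bool (uadj n A B u v)"
proof -
  let ?s = "run (pInit ;; pOffsets) s"
  have s': "s' = run pAdj ?s" by (simp add: s'_def)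
  have f: "s' x = ?s x" if "x \<notin> {8, 9, 29, 15}" for x unfolding s' using that by (intro run_frame) simp
  show "s' 0 0 = n" "s' 2 0 = m" "s' 32 0 = m + 1" "s' 4 0 = m * m" "\<And>i. i \<le> m + 1 \<Longrightarrow> s' 14 i = i * m"
    using f offsets_spec s0 by (simp_all del: run.simps)
  have "\<forall>u<m. \<forall>v<m. s' 15 (u * m + v) = of_bool (uadj n A B u v)"
    unfolding s' pAdj_def
  proof (rule fill2)
    fix a b s' assume ab: "a < m" "b < m"
      and fr: "\<And>x. x \<notin> insert 8 (insert 9 (wr pAdjEntry)) \<Longrightarrow> s' x = ?s x"
      and st: "s' 8 0 = a" "s' 9 0 = b"
      and Q: "\<And>a' b'. b' < m \<Longrightarrow> a' < a \<or> a' = a \<and> b' < b \<Longrightarrow> s' 15 (a' * m + b') = of_bool (uadj n A B a' b')"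
    have "run pAdjEntry s' 15 = (s' 15)(a * m + b := of_bool (uadj n A B a b))"
      by (rule adj_entry_spec) (use ab fr st offsets_spec in \<open>simp_all del: run.simps\<close>)
    then show "run pAdjEntry s' 15 (a * m + b) = of_bool (uadj n A B a b) \<and>
        (\<forall>a' b'. b' < m \<longrightarrow> (a' < a \<or> a' = a \<and> b' < b) \<longrightarrow>
          run pAdjEntry s' 15 (a' * m + b') = of_bool (uadj n A B a' b'))"
      using Q ab idx_inj by (auto simp: idx_inj)
  qed (use offsets_spec in \<open>simp_all del: run.simps\<close>)
  then show "\<And>u v. u < m \<Longrightarrow> v < m \<Longrightarrow> s' 15 (u * m + v) = of_bool (uadj n A B u v)" by blast
qed

end

section \<open>Enumeration of the ordered cliques\<close>

text \<open>For an ordered clique \<open>x # q\<close>, the list \<open>v # x # q\<close> is one iff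
  \<open>v # q\<close> is one and \<open>x\<close> is adjacent to \<open>v\<close>. So a finished
  row of the tail and one adjacency decide each entry.\<close>

definition pExtend :: cm where
  "pExtend = Ifn (Sc 31)
       (Ifn (Rd 16 (Pl (Rd 14 (Rd 17 (Sc 31))) (Sc 9)))
         (Ws 29 (Rd 15 (Pl (Rd 14 (Rd 18 (Sc 31))) (Sc 9)))) (Ws 29 (Cn 0)))
       (Ws 29 (Cn 1)) ;;
     Ifn (Sc 29)
       (Wr 16 (Pl (Rd 14 (Sc 31)) (Sc 9)) (Sc 3) ;; Wr 17 (Sc 3) (Sc 31) ;; Wr 18 (Sc 3) (Sc 9) ;;
        Ws 3 (Pl (Sc 3) (Cn 1)))
       (Wr 16 (Pl (Rd 14 (Sc 31)) (Sc 9)) (Cn 0))"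
text \<open>Further row offsets are made clique by clique, as the final number of rows is not known
  beforehand.\<close>

definition pExpand :: cm where
  "pExpand = Wr 14 (Pl (Sc 31) (Cn 1)) (Pl (Rd 14 (Sc 31)) (Sc 2)) ;; Fr 9 2 pExtend ;;
     Ws 31 (Pl (Sc 31) (Cn 1))"
text \<open>\<open>Fr\<close> fixes its number of rounds on entry, but expansion creates new
  cliques. So one level treats the cliques waiting at its start; since ordered cliques have length
  at most \<open>m\<close>, \<open>m + 1\<close> levels suffice.\<close>

definition pLevel :: cm where "pLevel = Ws 30 (Mn (Sc 3) (Sc 31)) ;; Fr 11 30 pExpand"
definition pTrieInit :: cm where "pTrieInit = Ws 3 (Cn 1) ;; Ws 31 (Cn 0) ;; Ws 17 (Cn 0) ;; Ws 18 (Cn 0)"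
definition pTrie :: cm where "pTrie = Fr 13 32 pLevel"

lemma wr_B [simp]: "wr pExtend = {29, 16, 17, 18, 3}" "wr pExpand = {14, 9, 29, 16, 17, 18, 3, 31}"
  "wr pLevel = {30, 11, 14, 9, 29, 16, 17, 18, 3, 31}" "wr pTrieInit = {3, 31, 17, 18}"
  "wr pTrie = {13, 30, 11, 14, 9, 29, 16, 17, 18, 3, 31}"
  by (auto simp: pExtend_def pExpand_def pLevel_def pTrie_def pTrieInit_def)

lemma wf_B [simp]: "wf pExtend" "wf pExpand" "wf pLevel" "wf pTrieInit" "wf pTrie"
  by (auto simp: pExtend_def pExpand_def pLevel_def pTrie_def pTrieInit_def)

locale tables = sgraph "{..<m}" adj for m adj
begin

text \<open>The list \<open>os\<close> of all cliques created so far exists only in the proof; the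
  program stores the index of the tail and the head.\<close>

definition trie :: "nat list list \<Rightarrow> st \<Rightarrow> bool" where
  "trie os s \<longleftrightarrow> os \<noteq> [] \<and> os ! 0 = [] \<and> distinct os \<and> (\<forall>q\<in>set os. oclique q) \<and> s 3 0 = length os \<and>
     (\<forall>i. 0 < i \<and> i < length os \<longrightarrow> s 17 i < i \<and> s 18 i < m \<and> os ! i = s 18 i # os ! s 17 i)"

text \<open>The pair \<open>(p, v)\<close> is the entry to be processed next. The value
  \<open>0\<close> can mean absence because index \<open>0\<close> belongs to the empty
  clique.\<close>

definition kidsok :: "nat list list \<Rightarrow> nat \<Rightarrow> nat \<Rightarrow> st \<Rightarrow> bool" where
  "kidsok os p v s \<longleftrightarrow> (\<forall>a b. a < length os \<longrightarrow> b < m \<longrightarrow> (a < p \<or> a = p \<and> b < v) \<longrightarrow>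
     (if oclique (b # os ! a) then 0 < s 16 (a * m + b) \<and> s 16 (a * m + b) < length os \<and>
        os ! s 16 (a * m + b) = b # os ! a else s 16 (a * m + b) = 0))"

definition base :: "nat \<Rightarrow> st \<Rightarrow> bool" where
  "base p s \<longleftrightarrow> s 2 0 = m \<and> (\<forall>u<m. \<forall>v<m. s 15 (u * m + v) = of_bool (adj u v)) \<and>
     (\<forall>i. i \<le> p \<or> i \<le> m \<longrightarrow> s 14 i = i * m)"

text \<open>The last conjunct puts all created pairs of tail and head lexicographically before
  \<open>(p, v)\<close>; this is what keeps \<open>os\<close> distinct.\<close>

definition trie_inv :: "nat list list \<Rightarrow> nat \<Rightarrow> nat \<Rightarrow> st \<Rightarrow> bool" where
  "trie_inv os p v s \<longleftrightarrow> trie os s \<and> kidsok os p v s \<and> base p s \<and> s 31 0 = p \<and>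
     (\<forall>i. 0 < i \<and> i < length os \<longrightarrow> s 17 i < p \<or> s 17 i = p \<and> s 18 i < v)"

lemma trie_inv_cong:
  assumes "trie_inv os p v s" "\<And>x. x \<in> {3, 16, 17, 18, 31} \<Longrightarrow> s' x = s x" "base p s'"
  shows "trie_inv os p v s'"
proof -
  have e: "s' 3 = s 3" "s' 16 = s 16" "s' 17 = s 17" "s' 18 = s 18" "s' 31 = s 31" using assms(2) by simp_all
  show ?thesis using assms(1,3) unfolding trie_inv_def trie_def kidsok_def e by blast
qed

lemma base_cong:
  assumes "base p s" "\<And>x. x \<in> {2, 14, 15} \<Longrightarrow> s' x = s x" shows "base p s'"
proof -
  have e: "s' 2 = s 2" "s' 14 = s 14" "s' 15 = s 15" using assms(2) by simp_all
  show ?thesis using assms(1) unfolding base_def e .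
qed

lemma trie_cong:
  assumes "trie os s" "\<And>x. x \<in> {3, 17, 18} \<Longrightarrow> s' x = s x" shows "trie os s'"
proof -
  have e: "s' 3 = s 3" "s' 17 = s 17" "s' 18 = s 18" using assms(2) by simp_all
  show ?thesis using assms(1) unfolding trie_def e .
qed

lemma kidsok_cong:
  assumes "kidsok os p v s" "s' 16 = s 16" shows "kidsok os p v s'"
  using assms(1) unfolding kidsok_def assms(2) .

lemma kidsok_Suc: "kidsok os p m s \<Longrightarrow> kidsok os (Suc p) 0 s"
  unfolding kidsok_def
proof (intro allI impI)
  fix a b assume K: "\<forall>a b. a < length os \<longrightarrow> b < m \<longrightarrow> a < p \<or> a = p \<and> b < m \<longrightarrow>
      (if oclique (b # os ! a) then 0 < s 16 (a * m + b) \<and> s 16 (a * m + b) < length os \<and>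
        os ! s 16 (a * m + b) = b # os ! a else s 16 (a * m + b) = 0)"
    and a: "a < length os" "b < m" "a < Suc p \<or> a = Suc p \<and> b < 0"
  have "a < p \<or> a = p \<and> b < m" using a by auto
  then show "if oclique (b # os ! a) then 0 < s 16 (a * m + b) \<and> s 16 (a * m + b) < length os \<and>
        os ! s 16 (a * m + b) = b # os ! a else s 16 (a * m + b) = 0"
    using K a(1,2) by blast
qed

lemma trie_inv_setv [simp]: "trie_inv os p v (setv 9 x s) = trie_inv os p v s" "trie_inv os p v (setv 11 x s) = trie_inv os p v s"
  "trie_inv os p v (setv 13 x s) = trie_inv os p v s"
  by (auto simp: trie_inv_def trie_def kidsok_def base_def)

text \<open>The cliques are created in lexicographic order of tail and head, hence none of them twice.\<close>

lemma pExtend_spec: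
  assumes trie_inv: "trie_inv os p v s" and p: "p < length os" and v: "v < m" "s 9 0 = v"
  shows "\<exists>os'. trie_inv os' p (Suc v) (run pExtend s) \<and> (os' = os \<or> os' = os @ [v # os ! p])"
proof -
  have tr: "trie os s" and ko: "kidsok os p v s" and ba: "base p s" and p': "s 31 0 = p"
    and lex: "\<And>i. 0 < i \<Longrightarrow> i < length os \<Longrightarrow> s 17 i < p \<or> s 17 i = p \<and> s 18 i < v"
    using trie_inv by (auto simp: trie_inv_def)
  have len: "s 3 0 = length os" "os ! 0 = []" "distinct os" "os \<noteq> []" "\<And>q. q \<in> set os \<Longrightarrow> oclique q"
    and st: "\<And>i. 0 < i \<Longrightarrow> i < length os \<Longrightarrow> s 17 i < i \<and> s 18 i < m \<and> os ! i = s 18 i # os ! s 17 i"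
    using tr by (auto simp: trie_def)
  have row: "s 14 i = i * m" if "i \<le> p \<or> i \<le> m" for i using ba that by (auto simp: base_def)
  have ad: "s 15 (u * m + w) = of_bool (adj u w)" if "u < m" "w < m" for u w
    using ba that by (auto simp: base_def)
  define t where "t = (if p \<noteq> 0 then if s 16 (s 14 (s 17 p) + v) \<noteq> 0 then s 15 (s 14 (s 18 p) + v) else 0 else (1::nat))"
  have t: "t \<noteq> 0 \<longleftrightarrow> oclique (v # os ! p)"
  proof (cases "p = 0")
    case True
    then show ?thesis using len v by (simp add: t_def oclique_def)
  next
    case False
    let ?q = "os ! s 17 p" and ?x = "s 18 p"
    have s: "s 17 p < p" "?x < m" "os ! p = ?x # ?q" using st[of p] p False by auto
    have "s 17 p < length os" using s p by simp
    then have c: "s 16 (s 17 p * m + v) \<noteq> 0 \<longleftrightarrow> oclique (v # ?q)"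
      using ko[unfolded kidsok_def, rule_format, of "s 17 p" v] s(1) v by (auto split: if_splits)
    have "s 14 (s 17 p) = s 17 p * m" "s 14 ?x = ?x * m" using row s by simp_all
    then have "t \<noteq> 0 \<longleftrightarrow> oclique (v # ?q) \<and> adj ?x v" using c ad[OF s(2) v(1)] False by (simp add: t_def)
    moreover have "oclique (?x # ?q)" using len(5)[OF nth_mem[OF p]] s(3) by simp
    ultimately show ?thesis unfolding s(3) oclique_Cons by (auto simp: adj_commute)
  qed
  have rp: "s 14 p = p * m" using row by simp
  show ?thesis
  proof (cases "oclique (v # os ! p)")
    case False
    then have "t = 0" using t by simp
    then have "run pExtend s = s(29 := (s 29)(0 := 0), 16 := (s 16)(p * m + v := 0))"
      using p' v rp by (simp add: pExtend_def t_def split: if_splits)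
    note r = this
    have "trie os (run pExtend s)" by (rule trie_cong[OF tr]) (auto simp: r)
    moreover have "base p (run pExtend s)" by (rule base_cong[OF ba]) (auto simp: r)
    moreover have "kidsok os p (Suc v) (run pExtend s)"
      unfolding kidsok_def
    proof (intro allI impI)
      fix a b assume a: "a < length os" "b < m" "a < p \<or> a = p \<and> b < Suc v"
      show "if oclique (b # os ! a) then 0 < run pExtend s 16 (a * m + b) \<and> run pExtend s 16 (a * m + b) < length os \<and>
        os ! run pExtend s 16 (a * m + b) = b # os ! a else run pExtend s 16 (a * m + b) = 0"
      proof (cases "a = p \<and> b = v")
        case True
        then show ?thesis using False by (simp add: r)
      next
        case ab: False
        then have "run pExtend s 16 (a * m + b) = s 16 (a * m + b)" using idx_inj[OF a(2) v(1)] by (auto simp: r)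
        moreover have "a < p \<or> a = p \<and> b < v" using a(3) ab by auto
        ultimately show ?thesis using ko[unfolded kidsok_def, rule_format, OF a(1,2)] by simp
      qed
    qed
    moreover have "\<forall>i. 0 < i \<and> i < length os \<longrightarrow>
        run pExtend s 17 i < p \<or> run pExtend s 17 i = p \<and> run pExtend s 18 i < Suc v"
      using lex by (auto simp: r less_Suc_eq)
    moreover have "run pExtend s 31 0 = p" using p' by (simp add: r)
    ultimately show ?thesis unfolding trie_inv_def by blast
  next
    case True
    then have "t \<noteq> 0" using t by simp
    then have r: "run pExtend s = s(29 := (s 29)(0 := t), 16 := (s 16)(p * m + v := length os),
        17 := (s 17)(length os := p), 18 := (s 18)(length os := v), 3 := (s 3)(0 := Suc (length os)))"
      using p' v rp len by (simp add: pExtend_def t_def split: if_splits)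
    let ?os = "os @ [v # os ! p]" and ?s = "run pExtend s"
    have new: "v # os ! p \<notin> set os"
    proof
      assume "v # os ! p \<in> set os"
      then obtain i where i: "i < length os" "os ! i = v # os ! p" by (auto simp: in_set_conv_nth)
      then have "i \<noteq> 0" using len(2) by (cases i) auto
      then have "s 18 i = v" "os ! s 17 i = os ! p" "s 17 i < length os" using st[of i] i by auto
      then have "s 17 i = p" using len(3) p nth_eq_iff_index_eq by blast
      then show False using lex[of i] \<open>s 18 i = v\<close> i \<open>i \<noteq> 0\<close> by simp
    qed
    have "s 17 i < length os" if "0 < i" "i < length os" for i using st[OF that] that by simp
    then have "trie ?os ?s"
      using len new True st p v(1) unfolding trie_def r by (auto simp: nth_append less_Suc_eq)
    moreover have "kidsok ?os p (Suc v) ?s"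
      unfolding kidsok_def
    proof (intro allI impI)
      fix a b assume a: "a < length ?os" "b < m" "a < p \<or> a = p \<and> b < Suc v"
      have al: "a < length os" using a(3) p by auto
      show "if oclique (b # ?os ! a) then 0 < ?s 16 (a * m + b) \<and> ?s 16 (a * m + b) < length ?os \<and>
        ?os ! ?s 16 (a * m + b) = b # ?os ! a else ?s 16 (a * m + b) = 0"
      proof (cases "a = p \<and> b = v")
        case ab: True
        then show ?thesis using True al p len by (simp add: r nth_append)
      next
        case False
        then have "?s 16 (a * m + b) = s 16 (a * m + b)" using idx_inj[OF a(2) v(1)] by (auto simp: r)
        moreover have "if oclique (b # os ! a) then 0 < s 16 (a * m + b) \<and> s 16 (a * m + b) < length os \<and>
          os ! s 16 (a * m + b) = b # os ! a else s 16 (a * m + b) = 0"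
        proof -
          have "a < p \<or> a = p \<and> b < v" using a(3) False by auto
          then show ?thesis using ko[unfolded kidsok_def, rule_format, OF al a(2)] by blast
        qed
        ultimately show ?thesis using al by (simp add: nth_append split: if_splits)
      qed
    qed
    moreover have "base p ?s" using ba by (simp add: base_def r)
    moreover have "?s 31 0 = p" using p' by (simp add: r)
    moreover have "\<forall>i. 0 < i \<and> i < length ?os \<longrightarrow> ?s 17 i < p \<or> ?s 17 i = p \<and> ?s 18 i < Suc v"
      using lex by (auto simp: r less_Suc_eq)
    ultimately have "trie_inv ?os p (Suc v) ?s" unfolding trie_inv_def by blast
    then show ?thesis by blast
  qed
qed

lemma pExpand_spec:
  assumes trie_inv: "trie_inv os p 0 s" and p: "p < length os"
  shows "\<exists>os'. trie_inv os' (Suc p) 0 (run pExpand s) \<and> length os \<le> length os' \<and> take (length os) os' = os"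
proof -
  let ?s = "s(14 := (s 14)(Suc p := Suc p * m))"
  have s: "s 31 0 = p" "s 14 p = p * m" "s 2 0 = m" using trie_inv by (auto simp: trie_inv_def base_def)
  have "base p s" using trie_inv by (simp add: trie_inv_def)
  then have "base p ?s" unfolding base_def by auto
  then have 1: "trie_inv os p 0 ?s" by (intro trie_inv_cong[OF trie_inv]) auto
  have e: "?s 14 (Suc p) = Suc p * m" by simp
  obtain s1 where 2: "\<exists>os'. trie_inv os' p (?s 2 0) s1 \<and> length os \<le> length os' \<and> take (length os) os' = os"
    "run (Fr 9 2 pExtend) ?s = setv 9 (?s 2 0) s1"
    "\<And>x. x \<notin> insert 9 (wr pExtend) \<Longrightarrow> s1 x = ?s x"
  proof (rule run_Fr[where I = "\<lambda>v s'. \<exists>os'. trie_inv os' p v s' \<and> length os \<le> length os' \<and> take (length os) os' = os"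
      and k = 9 and l = 2 and c = pExtend and s = ?s])
    fix v s' assume v: "v < ?s 2 0"
      and "\<exists>os'. trie_inv os' p v s' \<and> length os \<le> length os' \<and> take (length os) os' = os"
    then obtain os' where os': "trie_inv os' p v s'" "length os \<le> length os'" "take (length os) os' = os" by blast
    have "\<exists>os''. trie_inv os'' p (Suc v) (run pExtend (setv 9 v s')) \<and> (os'' = os' \<or> os'' = os' @ [v # os' ! p])"
      by (rule pExtend_spec) (use os' p v s in auto)
    then show "\<exists>os'. trie_inv os' p (Suc v) (run pExtend (setv 9 v s')) \<and> length os \<le> length os' \<and> take (length os) os' = os"
      using os' by force
  qed (use 1 in auto)
  then obtain os' where os': "trie_inv os' p m s1" "length os \<le> length os'" "take (length os) os' = os"
    using s by auto
  have r: "run pExpand s = (setv 9 m s1)(31 := (s1 31)(0 := Suc p))"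
    using 2(2) s os'(1) by (simp add: pExpand_def trie_inv_def add.commute del: run.simps(4))
  have "s1 14 = ?s 14" using 2(3)[of 14] by simp
  then have "base (Suc p) s1" using os'(1) e unfolding trie_inv_def base_def by (auto simp: le_Suc_eq)
  then have "base (Suc p) (run pExpand s)" by (rule base_cong) (auto simp: r)
  moreover have "trie os' (run pExpand s)"
    by (rule trie_cong[of _ s1]) (use os'(1) in \<open>auto simp: r trie_inv_def\<close>)
  moreover have "kidsok os' (Suc p) 0 (run pExpand s)"
    by (rule kidsok_cong[of _ _ _ s1]) (use os'(1) kidsok_Suc in \<open>auto simp: r trie_inv_def\<close>)
  moreover have "run pExpand s 31 0 = Suc p" by (simp add: r)
  moreover have "\<forall>i. 0 < i \<and> i < length os' \<longrightarrow>
      run pExpand s 17 i < Suc p \<or> run pExpand s 17 i = Suc p \<and> run pExpand s 18 i < 0"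
    using os'(1) by (auto simp: r trie_inv_def less_Suc_eq)
  ultimately have "trie_inv os' (Suc p) 0 (run pExpand s)" unfolding trie_inv_def by blast
  then show ?thesis using os' by blast
qed

text \<open>Short cliques are sought among the first \<open>p\<close> entries because they must be
  expanded already, not merely listed.\<close>

definition level_inv :: "nat \<Rightarrow> st \<Rightarrow> bool" where
  "level_inv L s \<longleftrightarrow> (\<exists>os p. trie_inv os p 0 s \<and> p \<le> length os \<and> (\<forall>q. oclique q \<and> length q < L \<longrightarrow> q \<in> set (take p os)))"

lemma pLevel_spec:
  assumes "level_inv L s"
  shows "level_inv (Suc L) (run pLevel s)"
proof -
  obtain os p where trie_inv: "trie_inv os p 0 s" and p: "p \<le> length os"
    and sh: "\<And>q. oclique q \<Longrightarrow> length q < L \<Longrightarrow> q \<in> set (take p os)"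
    using assms by (auto simp: level_inv_def)
  let ?s = "s(30 := (s 30)(0 := length os - p))"
  have s: "s 3 0 = length os" "s 31 0 = p" using trie_inv by (auto simp: trie_inv_def trie_def)
  have "base p s" using trie_inv by (simp add: trie_inv_def)
  then have "base p ?s" by (rule base_cong) auto
  then have 1: "trie_inv os p 0 ?s" by (intro trie_inv_cong[OF trie_inv]) auto
  let ?I = "\<lambda>j s'. \<exists>os'. trie_inv os' (p + j) 0 s' \<and> length os \<le> length os' \<and> take (length os) os' = os"
  obtain s1 where 2: "?I (?s 30 0) s1" "run (Fr 11 30 pExpand) ?s = setv 11 (?s 30 0) s1"
  proof (rule run_Fr[where I = ?I and k = 11 and l = 30 and c = pExpand and s = ?s])
    fix j s' assume j: "j < ?s 30 0" and "?I j s'"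
    then obtain os' where os': "trie_inv os' (p + j) 0 s'" "length os \<le> length os'" "take (length os) os' = os"
      by blast
    have "\<exists>os''. trie_inv os'' (Suc (p + j)) 0 (run pExpand (setv 11 j s')) \<and> length os' \<le> length os'' \<and>
        take (length os') os'' = os'"
      by (rule pExpand_spec) (use os' j in auto)
    then obtain os'' where os'': "trie_inv os'' (Suc (p + j)) 0 (run pExpand (setv 11 j s'))"
      "length os' \<le> length os''" "take (length os') os'' = os'" by blast
    have "take (length os) os'' = os" using os'(2,3) os''(3) by (metis min.absorb1 take_take)
    then show "?I (Suc j) (run pExpand (setv 11 j s'))" using os'' os'(2) by (intro exI[of _ os'']) auto
  qed (use 1 in auto)
  have pl: "p + (length os - p) = length os" using p by simp
  obtain os' where os': "trie_inv os' (length os) 0 s1" "length os \<le> length os'" "take (length os) os' = os"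
    using 2(1) pl by auto
  have "q \<in> set (take (length os) os')" if q: "oclique q" "length q < Suc L" for q
  proof (cases q)
    case Nil
    have "os \<noteq> []" "os ! 0 = []" using trie_inv by (auto simp: trie_inv_def trie_def)
    then have "[] \<in> set os" by (metis length_greater_0_conv nth_mem)
    then show ?thesis using Nil os' by simp
  next
    \<comment> \<open>The tail is shorter than \<open>L\<close>, so it was expanded before this
      level, and its extension by \<open>v\<close> was already listed.\<close>
    case (Cons v q')
    then have "q' \<in> set (take p os)" using q sh by (auto simp: oclique_Cons)
    then obtain a where a: "a < p" "os ! a = q'" using p by (auto simp: in_set_conv_nth)
    have "v < m" using q Cons by (simp add: oclique_Cons)
    have "kidsok os p 0 s" using trie_inv by (simp add: trie_inv_def)
    then have "s 16 (a * m + v) < length os \<and> os ! s 16 (a * m + v) = v # os ! a"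
      using a p q Cons \<open>v < m\<close> unfolding kidsok_def by auto
    then show ?thesis using os' a Cons by (metis nth_mem)
  qed
  moreover have "run pLevel s = setv 11 (length os - p) s1"
    using 2(2) s by (simp add: pLevel_def del: run.simps(4))
  ultimately show ?thesis unfolding level_inv_def using os' by (intro exI[of _ os'] exI[of _ "length os"]) auto
qed

definition built :: "nat list list \<Rightarrow> st \<Rightarrow> bool" where
  "built os s \<longleftrightarrow> trie os s \<and> set os = {q. oclique q} \<and> kidsok os (length os) 0 s \<and> base (length os) s"

lemma built_cong:
  assumes "\<And>x. x \<in> {2, 3, 14, 15, 16, 17, 18} \<Longrightarrow> s' x = s x"
  shows "built os s' = built os s"
proof -
  have "s' 2 = s 2" "s' 3 = s 3" "s' 14 = s 14" "s' 15 = s 15" "s' 16 = s 16" "s' 17 = s 17" "s' 18 = s 18"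
    using assms by simp_all
  then show ?thesis by (simp only: built_def trie_def kidsok_def base_def)
qed

text \<open>The running time needs this bound in every intermediate state, not only at the
  end.\<close>

lemma trie_inv_length: "trie_inv os p v s \<Longrightarrow> length os \<le> card {q. oclique q}"
  unfolding trie_inv_def trie_def using finite_oclique
  by (metis card_mono distinct_card mem_Collect_eq subsetI)

lemma level_inv_start:
  assumes "base 0 s" shows "level_inv 0 (run pTrieInit s)"
proof -
  have "run pTrieInit s = s(3 := (s 3)(0 := 1), 31 := (s 31)(0 := 0), 17 := (s 17)(0 := 0), 18 := (s 18)(0 := 0))"
    by (simp add: pTrieInit_def)
  moreover have "base 0 (run pTrieInit s)" using assms by (rule base_cong) (auto simp: calculation)
  ultimately have "trie_inv [[]] 0 0 (run pTrieInit s)"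
    by (auto simp: trie_inv_def trie_def kidsok_def oclique_def)
  then show ?thesis unfolding level_inv_def by (intro exI[of _ "[[]]"] exI[of _ 0]) auto
qed

lemma pTrie_spec:
  assumes "base 0 s" "s 32 0 = m + 1"
  shows "\<exists>os. built os (run (pTrieInit ;; pTrie) s)"
proof -
  let ?s = "run pTrieInit s"
  have l: "?s 32 0 = m + 1" using assms by (simp add: run_frame)
  obtain s1 where 1: "level_inv (?s 32 0) s1" "run pTrie ?s = setv 13 (?s 32 0) s1"
    unfolding pTrie_def
    by (rule run_Fr[where I = level_inv and k = 13 and l = 32 and c = pLevel and s = ?s])
      (use level_inv_start[OF assms(1)] pLevel_spec in \<open>auto simp: level_inv_def\<close>)
  then obtain os p where os: "trie_inv os p 0 s1" "p \<le> length os"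
    "\<And>q. oclique q \<Longrightarrow> length q < m + 1 \<Longrightarrow> q \<in> set (take p os)"
    using l by (auto simp: level_inv_def)
  have all: "q \<in> set (take p os)" if "oclique q" for q using os(3)[OF that] length_oclique[OF that] by simp
  have d: "distinct os" "\<And>q. q \<in> set os \<Longrightarrow> oclique q" using os(1) by (auto simp: trie_inv_def trie_def)
  \<comment> \<open>An unexpanded entry would occur a second time among the first \<open>p\<close>,
    against distinctness.\<close>
  have pl: "p = length os"
  proof (rule ccontr)
    assume "p \<noteq> length os"
    then have "p < length os" using os(2) by simp
    then have "os ! p \<in> set (take p os)" using all d(2) by simp
    then obtain i where "i < p" "os ! i = os ! p" using \<open>p < length os\<close> by (auto simp: in_set_conv_nth)
    then show False using d(1) \<open>p < length os\<close> by (simp add: nth_eq_iff_index_eq)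
  qed
  have "set os = {q. oclique q}" using all d(2) pl by auto
  then have "built os s1" using os(1) pl by (simp add: built_def trie_inv_def)
  then have "built os (run (pTrieInit ;; pTrie) s)"
    unfolding run.simps(2) 1(2) by (subst built_cong[of _ s1]) auto
  then show ?thesis by blast
qed

text \<open>\<open>tm_bound\<close> does not apply to the outer loop, whose body rewrites the limit
  \<open>30\<close>. In each level the invariant bounds this limit by the number of ordered cliques;
  two inner loops and \<open>m + 1\<close> levels give the exponent 3.\<close>

lemma tm_pTrie:
  assumes "base 0 s" "s 32 0 = m + 1"
  shows "tm (pTrieInit ;; pTrie) s \<le> (kst pTrieInit + kst pTrie) * (card {q. oclique q} + m + 2) ^ 3"
proof -
  let ?s = "run pTrieInit s" and ?B = "card {q. oclique q} + m + 1"
  let ?T = "cost (addr 30 (Const 0)) + cost (cmpe (Mn (Sc 3) (Sc 31))) + 1 + kst (Fr 11 30 pExpand) * (?B + 1) ^ 2"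
  have l: "?s 32 0 = m + 1" using assms by (simp add: run_frame)
  have "tm pTrie ?s \<le> 9 + ?s 32 0 * (12 + ?T)"
    unfolding pTrie_def
  proof (rule tm_Fr[where I = level_inv])
    fix i s' assume level_inv: "level_inv i s'"
    then obtain os p where trie_inv: "trie_inv os p 0 s'" by (auto simp: level_inv_def)
    have s: "s' 3 0 = length os" "s' 31 0 = p" "s' 2 0 = m" using trie_inv by (auto simp: trie_inv_def trie_def base_def)
    have level_inv': "level_inv i (setv 13 i s')" using level_inv by (auto simp: level_inv_def)
    have "tm (Fr 11 30 pExpand) (run (Ws 30 (Mn (Sc 3) (Sc 31))) (setv 13 i s')) \<le>
        kst (Fr 11 30 pExpand) * (?B + 1) ^ dep (Fr 11 30 pExpand)"
    proof (rule tm_bound)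
      fix l assume "l \<in> lims (Fr 11 30 pExpand)"
      then have "l = 30 \<or> l = 2" by (simp add: pExpand_def pExtend_def)
      then show "run (Ws 30 (Mn (Sc 3) (Sc 31))) (setv 13 i s') l 0 \<le> ?B"
        using s trie_inv_length[OF trie_inv] by auto
    next
      show "lims (Fr 11 30 pExpand) \<inter> wr (Fr 11 30 pExpand) = {}" by (simp add: pExpand_def pExtend_def)
    qed
    also have "dep (Fr 11 30 pExpand) = 2" by (simp add: pExpand_def pExtend_def)
    finally have F: "tm (Fr 11 30 pExpand) (run (Ws 30 (Mn (Sc 3) (Sc 31))) (setv 13 i s')) \<le>
        kst (Fr 11 30 pExpand) * (?B + 1) ^ 2" .
    have "tm pLevel (setv 13 i s') = cost (addr 30 (Const 0)) + cost (cmpe (Mn (Sc 3) (Sc 31))) + 1 +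
        tm (Fr 11 30 pExpand) (run (Ws 30 (Mn (Sc 3) (Sc 31))) (setv 13 i s'))"
      by (simp only: pLevel_def tm.simps(1,2) cmpe.simps(1))
    also have "\<dots> \<le> ?T" by (rule add_left_mono[OF F])
    finally have "tm pLevel (setv 13 i s') \<le> ?T" .
    then show "level_inv (Suc i) (run pLevel (setv 13 i s')) \<and> tm pLevel (setv 13 i s') \<le> ?T"
      using pLevel_spec[OF level_inv'] by blast
  qed (use level_inv_start[OF assms(1)] in simp)
  also have "\<dots> \<le> kst pTrie * (?B + 1) ^ 3"
  proof -
    let ?D = "(?B + 1) ^ 2"
    have k: "kst pTrie = 21 + (cost (addr 30 (Const 0)) + cost (cmpe (Mn (Sc 3) (Sc 31))) + 1 + kst (Fr 11 30 pExpand))"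
      by (simp add: pTrie_def pLevel_def)
    have "1 \<le> ?D" by simp
    have "12 + ?T \<le> (12 + (cost (addr 30 (Const 0)) + cost (cmpe (Mn (Sc 3) (Sc 31))) + 1 + kst (Fr 11 30 pExpand))) * ?D"
      using mult_le_mono2[OF \<open>1 \<le> ?D\<close>, of "12 + (cost (addr 30 (Const 0)) + cost (cmpe (Mn (Sc 3) (Sc 31))) + 1)"]
      by (simp only: distrib_right mult_1_right)
    then have "?s 32 0 * (12 + ?T) \<le> (?B + 1) * ((kst pTrie - 9) * ?D)"
      unfolding l k by (intro mult_le_mono) auto
    moreover have "9 \<le> (?B + 1) * (9 * ?D)"
      using mult_le_mono[of 1 "?B + 1" 9 "9 * ?D"] \<open>1 \<le> ?D\<close> by simp
    ultimately have "9 + ?s 32 0 * (12 + ?T) \<le> (?B + 1) * (9 * ?D) + (?B + 1) * ((kst pTrie - 9) * ?D)" by linarith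
    also have "\<dots> = (?B + 1) * ((9 + (kst pTrie - 9)) * ?D)" by (simp only: distrib_left distrib_right)
    also have "9 + (kst pTrie - 9) = kst pTrie" unfolding k by simp
    finally show ?thesis by (simp only: power3_eq_cube power2_eq_square ac_simps)
  qed
  finally have 1: "tm pTrie ?s \<le> kst pTrie * (?B + 1) ^ 3" .
  have "tm pTrieInit s \<le> kst pTrieInit" by (simp add: pTrieInit_def)
  also have "\<dots> \<le> kst pTrieInit * (?B + 1) ^ 3" by simp
  finally have "tm (pTrieInit ;; pTrie) s \<le> kst pTrieInit * (?B + 1) ^ 3 + kst pTrie * (?B + 1) ^ 3" using 1 by simp
  then show ?thesis by (simp add: distrib_right)
qed

end

section \<open>Restrictions and patterns\<close>

text \<open>The leading bit \<open>1\<close> makes patterns of different lengths different.\<close>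

fun pat :: "bool list \<Rightarrow> nat" where
  "pat [] = 1"
| "pat (b # bs) = 2 * pat bs + of_bool b"

lemma pat_pos: "0 < pat bs"
  by (induction bs) auto

lemma pat_inj: "pat bs = pat cs \<longleftrightarrow> bs = cs"
proof (induction bs arbitrary: cs)
  case Nil
  show ?case using pat_pos by (cases cs) (auto simp: of_bool_def)
next
  case (Cons b bs)
  show ?case
  proof (cases cs)
    case Nil
    then show ?thesis using pat_pos[of bs] by (auto simp: of_bool_def)
  next
    case (Cons c ds)
    have "2 * pat bs + of_bool b = 2 * pat ds + of_bool c \<longleftrightarrow> pat bs = pat ds \<and> b = c"
      by (cases b; cases c; simp; presburger)
    then show ?thesis using Cons Cons.IH by auto
  qed
qed

text \<open>All entries for \<open>x # q\<close> come from those for \<open>q\<close>. If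
  \<open>v\<close> is adjacent to \<open>x\<close>, the restriction is \<open>x\<close> in front of
  that of \<open>q\<close>, and its index is found in the extension table \<open>16\<close>; the
  pattern number is doubled and receives the bit of \<open>x\<close>.\<close>

definition pRestrEntry :: cm where
  "pRestrEntry = Ifn (Sc 6)
     (Ifn (Dfx (Sc 7) (Rd 18 (Sc 6)))
        (Wr 19 (Pl (Rd 14 (Sc 6)) (Sc 7)) (Rd 19 (Pl (Rd 14 (Rd 17 (Sc 6))) (Sc 7))))
        (Wr 19 (Pl (Rd 14 (Sc 6)) (Sc 7)) (Cn 1)) ;;
      Ws 29 (Rd 21 (Pl (Rd 14 (Rd 17 (Sc 6))) (Sc 7))) ;;
      Ifn (Rd 15 (Pl (Rd 14 (Rd 18 (Sc 6))) (Sc 7)))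
        (Wr 20 (Pl (Rd 14 (Sc 6)) (Sc 7))
           (Rd 16 (Pl (Rd 14 (Rd 20 (Pl (Rd 14 (Rd 17 (Sc 6))) (Sc 7)))) (Rd 18 (Sc 6)))) ;;
         Wr 21 (Pl (Rd 14 (Sc 6)) (Sc 7)) (Pl (Pl (Sc 29) (Sc 29)) (Cn 1)))
        (Wr 20 (Pl (Rd 14 (Sc 6)) (Sc 7)) (Rd 20 (Pl (Rd 14 (Rd 17 (Sc 6))) (Sc 7))) ;;
         Wr 21 (Pl (Rd 14 (Sc 6)) (Sc 7)) (Pl (Sc 29) (Sc 29))))
     (Wr 19 (Pl (Rd 14 (Sc 6)) (Sc 7)) (Cn 0) ;; Wr 20 (Pl (Rd 14 (Sc 6)) (Sc 7)) (Cn 0) ;;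
      Wr 21 (Pl (Rd 14 (Sc 6)) (Sc 7)) (Cn 1))"
definition pRestr :: cm where "pRestr = Fr 6 3 (Fr 7 2 pRestrEntry)"

lemma wr_C [simp]: "wr pRestrEntry = {19, 20, 21, 29}" "wr pRestr = {6, 7, 19, 20, 21, 29}"
  by (auto simp: pRestrEntry_def pRestr_def)
lemma wf_C [simp]: "wf pRestrEntry" "wf pRestr"
  by (auto simp: pRestrEntry_def pRestr_def)

context tables begin

definition restr_entry :: "nat list list \<Rightarrow> nat \<Rightarrow> nat \<Rightarrow> st \<Rightarrow> bool" where
  "restr_entry os a b s \<longleftrightarrow> s 19 (a * m + b) = of_bool (b \<in> set (os ! a)) \<and>
     s 20 (a * m + b) < length os \<and> os ! s 20 (a * m + b) = filter (adj b) (os ! a) \<and>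
     s 21 (a * m + b) = pat (map (adj b) (os ! a))"

lemma oclique_filter_Cons: "oclique (x # q) \<Longrightarrow> oclique (x # filter P q)"
  unfolding oclique_Cons by (auto simp: oclique_filter)

lemma pRestrEntry_spec:
  assumes bu: "built os s" and ab: "a < length os" "b < m" "s 6 0 = a" "s 7 0 = b"
    and prev: "\<And>a'. a' < a \<Longrightarrow> restr_entry os a' b s"
  shows "\<exists>x y z t. run pRestrEntry s = s(29 := t, 19 := (s 19)(a * m + b := x), 20 := (s 20)(a * m + b := y),
      21 := (s 21)(a * m + b := z)) \<and> restr_entry os a b (run pRestrEntry s)"
proof -
  have tr: "trie os s" and ko: "kidsok os (length os) 0 s" and ba: "base (length os) s"
    and so: "set os = {q. oclique q}"
    using bu by (auto simp: built_def)
  have len: "s 3 0 = length os" "os ! 0 = []" "os \<noteq> []"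
    and st: "\<And>i. 0 < i \<Longrightarrow> i < length os \<Longrightarrow> s 17 i < i \<and> s 18 i < m \<and> os ! i = s 18 i # os ! s 17 i"
    using tr by (auto simp: trie_def)
  have row: "s 14 i = i * m" if "i < length os \<or> i \<le> m" for i using ba that by (auto simp: base_def)
  have ad: "s 15 (u * m + w) = of_bool (adj u w)" if "u < m" "w < m" for u w
    using ba that by (auto simp: base_def)
  show ?thesis
  proof (cases "a = 0")
    case True
    then have "run pRestrEntry s = s(19 := (s 19)(a * m + b := 0), 20 := (s 20)(a * m + b := 0),
      21 := (s 21)(a * m + b := 1))" using ab row[of 0] len by (simp add: pRestrEntry_def)
    then show ?thesis using True len
      by (intro exI[of _ 0] exI[of _ 1] exI[of _ "s 29"]) (auto simp: restr_entry_def fun_eq_iff)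
  next
    case False
    define x q where "x = s 18 a" and "q = os ! s 17 a"
    have s: "s 17 a < a" "x < m" "os ! a = x # q" using st[of a] ab False by (auto simp: x_def q_def)
    have pq: "restr_entry os (s 17 a) b s" by (rule prev) (rule s(1))
    have rw: "s 14 a = a * m" "s 14 (s 17 a) = s 17 a * m" "s 14 (s 18 a) = x * m"
      "s 14 (s 20 (s 17 a * m + b)) = s 20 (s 17 a * m + b) * m"
      using row s ab pq by (auto simp: x_def restr_entry_def)
    have A: "s 15 (x * m + b) = of_bool (adj x b)" using ad s ab by simp
    let ?f = "s 20 (s 17 a * m + b)"
    have f: "?f < length os" "os ! ?f = filter (adj b) q" using pq by (auto simp: restr_entry_def q_def)
    have "oclique (x # q)" using so ab s(3) nth_mem[of a os] by auto
    then have "oclique (x # filter (adj b) q)" by (rule oclique_filter_Cons)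
    then have c: "s 16 (?f * m + x) < length os" "os ! s 16 (?f * m + x) = x # filter (adj b) q"
      using ko f s(2) unfolding kidsok_def by (metis)+
    have ne: "s 17 a * m + b \<noteq> a * m + b" using s(1) idx_inj[of b m b] ab by auto
    define X where "X = (if b = x then 1 else s 19 (s 17 a * m + b))"
    define Y where "Y = (if adj x b then s 16 (?f * m + x) else ?f)"
    define Z where "Z = 2 * s 21 (s 17 a * m + b) + of_bool (adj x b)"
    have r: "run pRestrEntry s = s(29 := (s 29)(0 := s 21 (s 17 a * m + b)), 19 := (s 19)(a * m + b := X),
        20 := (s 20)(a * m + b := Y), 21 := (s 21)(a * m + b := Z))"
      using False ab rw A ne by (auto simp: pRestrEntry_def X_def Y_def Z_def x_def fun_eq_iff)
    have "restr_entry os a b (run pRestrEntry s)"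
      unfolding restr_entry_def r using pq s f c
      by (auto simp: X_def Y_def Z_def restr_entry_def adj_commute q_def[symmetric])
    then show ?thesis using r by blast
  qed
qed

lemma pRestr_spec:
  assumes bu: "built os s"
  shows "\<forall>a<length os. \<forall>b<m. restr_entry os a b (run pRestr s)"
  unfolding pRestr_def
proof (rule fill2)
  show "s 3 0 = length os" "s 2 0 = m" using bu by (auto simp: built_def trie_def base_def)
  show "wf (Fr 6 3 (Fr 7 2 pRestrEntry))" by simp
next
  fix a b s' assume ab: "a < length os" "b < m"
    and fr: "\<And>x. x \<notin> insert 6 (insert 7 (wr pRestrEntry)) \<Longrightarrow> s' x = s x"
    and st: "s' 6 0 = a" "s' 7 0 = b"
    and Q: "\<And>a' b'. b' < m \<Longrightarrow> a' < a \<or> a' = a \<and> b' < b \<Longrightarrow> restr_entry os a' b' s'"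
  have bu': "built os s'" using bu fr by (subst built_cong[of s' s]) auto
  obtain x y z t where r: "run pRestrEntry s' = s'(29 := t, 19 := (s' 19)(a * m + b := x), 20 := (s' 20)(a * m + b := y),
      21 := (s' 21)(a * m + b := z))" and restr_entry: "restr_entry os a b (run pRestrEntry s')"
    using pRestrEntry_spec[OF bu' ab st] Q ab by blast
  have "restr_entry os a' b' (run pRestrEntry s')" if "b' < m" "a' < a \<or> a' = a \<and> b' < b" for a' b'
  proof -
    have "a' * m + b' \<noteq> a * m + b" using idx_inj[OF that(1) ab(2)] that by auto
    then show ?thesis using Q[OF that] by (simp add: r restr_entry_def)
  qed
  then show "restr_entry os a b (run pRestrEntry s') \<and> (\<forall>a' b'. b' < m \<longrightarrow> (a' < a \<or> a' = a \<and> b' < b) \<longrightarrow> restr_entry os a' b' (run pRestrEntry s'))"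
    using restr_entry by blast
qed (auto simp: restr_entry_def)

end

section \<open>Components and children\<close>

definition Nop :: cm where "Nop = Ws 63 (Cn 0)"

lemma Nop_simps [simp]: "wr Nop = {63}" "wf Nop" "lims Nop = {}" "x \<noteq> 63 \<Longrightarrow> run Nop s x = s x"
  by (auto simp: Nop_def)

definition pMarkNbrs :: cm where
  "pMarkNbrs = Fr 9 2 (Ifn (Rd 15 (Pl (Rd 14 (Sc 8)) (Sc 9))) (Wr 22 (Sc 9) (Cn 1)) Nop)"
text \<open>Clique members receive marks but do not pass them on, in accordance with
  \<open>Cl\<close>.\<close>

definition pVisit :: cm where
  "pVisit = Ifn (Rd 22 (Sc 8)) (Ifn (Rd 19 (Pl (Rd 14 (Sc 6)) (Sc 8))) Nop pMarkNbrs) Nop"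
definition pComponent :: cm where
  "pComponent = Fr 9 2 (Wr 22 (Sc 9) (Cn 0)) ;; Wr 22 (Sc 7) (Cn 1) ;; Fr 10 4 (Fr 8 2 pVisit)"
definition pFull :: cm where
  "pFull = Ws 26 (Cn 1) ;;
     Fr 12 2 (Ifn (Rd 22 (Sc 12)) (Ifn (Rd 19 (Pl (Rd 14 (Sc 6)) (Sc 12)))
       (Ifn (Rd 15 (Pl (Rd 14 (Sc 7)) (Sc 12))) Nop (Ws 26 (Cn 0))) Nop) Nop)"
definition pKid :: cm where
  "pKid = Ws 29 (Cn 0) ;;
     Ifn (Sc 26) (Ifn (Rd 19 (Pl (Rd 14 (Sc 6)) (Sc 7))) Nop (Ifn (Sc 6)
       (Ifn (Rd 15 (Pl (Rd 14 (Rd 18 (Sc 6))) (Sc 7)))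
         (Ws 29 (Rd 16 (Pl (Rd 14 (Rd 20 (Pl (Rd 14 (Sc 6)) (Sc 7)))) (Sc 7)))) Nop) Nop)) Nop ;;
     Wr 23 (Pl (Rd 14 (Sc 6)) (Sc 7)) (Sc 29)"
definition pKids :: cm where "pKids = Fr 6 3 (Fr 7 2 (pComponent ;; pFull ;; pKid))"

lemma wr_D [simp]: "wr pMarkNbrs = {9, 22, 63}" "wr pVisit = {9, 22, 63}" "wr pComponent = {9, 22, 63, 10, 8}"
  "wr pFull = {26, 12, 63}" "wr pKid = {29, 63, 23}"
  "wr pKids = {6, 7, 9, 22, 63, 10, 8, 26, 12, 29, 23}"
  by (auto simp: pMarkNbrs_def pVisit_def pComponent_def pFull_def pKid_def pKids_def)
lemma wf_D [simp]: "wf pMarkNbrs" "wf pVisit" "wf pComponent" "wf pFull" "wf pKid" "wf pKids"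
  by (auto simp: pMarkNbrs_def pVisit_def pComponent_def pFull_def pKid_def pKids_def)

context tables begin

definition ready :: "nat list list \<Rightarrow> st \<Rightarrow> bool" where
  "ready os s \<longleftrightarrow> built os s \<and> s 4 0 = m * m \<and> (\<forall>a<length os. \<forall>b<m. restr_entry os a b s)"

lemma ready_cong:
  assumes "ready os s" "\<And>x. x \<in> {2, 3, 4, 14, 15, 16, 17, 18, 19, 20, 21} \<Longrightarrow> s' x = s x"
  shows "ready os s'"
proof -
  have e: "s' 4 = s 4" "s' 19 = s 19" "s' 20 = s 20" "s' 21 = s 21" using assms(2) by simp_all
  have "built os s'" using assms by (subst built_cong[of s' s]) (auto simp: ready_def)
  then show ?thesis using assms(1) unfolding ready_def restr_entry_def e by blast
qed

lemma readyD:
  assumes "ready os s"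
  shows "s 2 0 = m" "s 3 0 = length os" "s 4 0 = m * m" "os ! 0 = []" "os \<noteq> []" "set os = {q. oclique q}" "distinct os"
    "\<And>i. i < length os \<or> i < m \<Longrightarrow> s 14 i = i * m"
    "\<And>u v. u < m \<Longrightarrow> v < m \<Longrightarrow> s 15 (u * m + v) = of_bool (adj u v)"
    "\<And>a b. a < length os \<Longrightarrow> b < m \<Longrightarrow> s 19 (a * m + b) = of_bool (b \<in> set (os ! a))"
    "\<And>a. a < length os \<Longrightarrow> oclique (os ! a)"
  using assms nth_mem by (fastforce simp: ready_def built_def trie_def base_def restr_entry_def)+

definition marked :: "st \<Rightarrow> nat set" where "marked s = {v. v < m \<and> s 22 v \<noteq> 0}"

lemma marked_cong: "s' 22 = s 22 \<Longrightarrow> marked s' = marked s" by (simp add: marked_def)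

lemma pMarkNbrs_spec:
  assumes "ready os s" "s 8 0 = u" "u < m"
  shows "marked (run pMarkNbrs s) = marked s \<union> {v. v < m \<and> adj u v}"
proof -
  note R = readyD[OF assms(1)]
  let ?c = "Ifn (Rd 15 (Pl (Rd 14 (Sc 8)) (Sc 9))) (Wr 22 (Sc 9) (Cn 1)) Nop"
  obtain s1 where 1: "marked s1 = marked s \<union> {v. v < s 2 0 \<and> adj u v}" "run pMarkNbrs s = setv 9 (s 2 0) s1"
    unfolding pMarkNbrs_def
  proof (rule run_Fr[where I = "\<lambda>i s'. marked s' = marked s \<union> {v. v < i \<and> adj u v}" and k = 9 and l = 2 and c = ?c and s = s])
    fix i s' assume i: "i < s 2 0" and I: "marked s' = marked s \<union> {v. v < i \<and> adj u v}"
      and fr: "\<And>x. x \<notin> insert 9 (wr ?c) \<Longrightarrow> s' x = s x"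
    have e: "s' 14 = s 14" "s' 15 = s 15" "s' 8 = s 8" by (rule fr, simp)+
    have r: "run ?c (setv 9 i s') = (if adj u i then (setv 9 i s')(22 := (s' 22)(i := 1)) else run Nop (setv 9 i s'))"
      using i e R(1,8,9) assms by simp
    show "marked (run ?c (setv 9 i s')) = marked s \<union> {v. v < Suc i \<and> adj u v}"
    proof (cases "adj u i")
      case True
      then have "marked (run ?c (setv 9 i s')) = insert i (marked s')" using i R(1) unfolding r by (auto simp: marked_def)
      then show ?thesis using I True by (auto simp: less_Suc_eq)
    next
      case False
      then have "marked (run ?c (setv 9 i s')) = marked s'" unfolding r by (simp add: marked_def)
      then show ?thesis using I False by (auto simp: less_Suc_eq)
    qed
  qed auto
  then show ?thesis using R(1) by (simp add: marked_def)
qed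

lemma pVisit_spec:
  assumes "ready os s" "s 6 0 = a" "a < length os" "s 8 0 = u" "u < m"
  shows "marked (run pVisit s) = (if u \<in> marked s \<and> u \<notin> set (os ! a) then marked s \<union> {v. v < m \<and> adj u v} else marked s)"
proof -
  have "s 14 a = a * m" "s 19 (a * m + u) = of_bool (u \<in> set (os ! a))"
    using readyD[OF assms(1)] assms by auto
  then show ?thesis using assms pMarkNbrs_spec[OF assms(1,4,5)] marked_cong[of "run Nop s" s]
    by (auto simp: pVisit_def marked_def)
qed

text \<open>New marks may be passed on within the same round, so the result is only enclosed: it
  contains one further step and stays inside the closure.\<close>

lemma pComponent_loop:
  assumes "ready os s" "s 6 0 = a" "a < length os" "marked s \<subseteq> Cl (set (os ! a)) y"
  shows "marked s \<subseteq> marked (run (Fr 8 2 pVisit) s) \<and> marked (run (Fr 8 2 pVisit) s) \<subseteq> Cl (set (os ! a)) y \<and>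
    (\<forall>u v. u \<in> marked s \<longrightarrow> u \<notin> set (os ! a) \<longrightarrow> adj u v \<longrightarrow> v \<in> marked (run (Fr 8 2 pVisit) s))"
proof -
  note R = readyD[OF assms(1)]
  let ?Q = "set (os ! a)"
  let ?I = "\<lambda>i s'. marked s \<subseteq> marked s' \<and> marked s' \<subseteq> Cl ?Q y \<and>
    (\<forall>u v. u < i \<longrightarrow> u \<in> marked s \<longrightarrow> u \<notin> ?Q \<longrightarrow> adj u v \<longrightarrow> v \<in> marked s')"
  obtain s1 where 1: "?I (s 2 0) s1" "run (Fr 8 2 pVisit) s = setv 8 (s 2 0) s1"
  proof (rule run_Fr[where I = ?I and k = 8 and l = 2 and c = pVisit and s = s])
    fix i s' assume i: "i < s 2 0" and I: "?I i s'" and fr: "\<And>x. x \<notin> insert 8 (wr pVisit) \<Longrightarrow> s' x = s x"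
    let ?s = "setv 8 i s'"
    have rd: "ready os ?s" by (rule ready_cong[OF assms(1)]) (use fr in auto)
    have M: "marked (run pVisit ?s) = (if i \<in> marked s' \<and> i \<notin> ?Q then marked s' \<union> {v. v < m \<and> adj i v} else marked s')"
      using pVisit_spec[OF rd, of a i] assms i R(1) fr[of 6] marked_cong[of ?s s'] by auto
    have "v < m" if "adj u v" for u v using adj_V adj_sym that by blast
    then show "?I (Suc i) (run pVisit ?s)"
      using I unfolding M by (auto simp: less_Suc_eq intro: Cl_step)
  qed (use assms in auto)
  have "u < m" if "u \<in> marked s" for u using that by (simp add: marked_def)
  moreover have "?I m s1" using 1(1) R(1) by simp
  moreover have "marked (run (Fr 8 2 pVisit) s) = marked s1" unfolding 1(2) by (rule marked_cong) simp
  ultimately show ?thesis by blast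
qed

text \<open>A round marks at least the vertices that are one step further away, and the step relation has
  at most \<open>m * m\<close> pairs.\<close>

lemma pComponent_spec:
  assumes "ready os s" "s 6 0 = a" "a < length os" "s 7 0 = y" "y < m"
  shows "marked (run pComponent s) = Cl (set (os ! a)) y"
proof -
  note R = readyD[OF assms(1)]
  let ?Q = "set (os ! a)" and ?c = "Wr 22 (Sc 9) (Cn 0)"
  let ?R = "{(u, v). adj u v \<and> u \<notin> ?Q}"
  obtain s1 where 1: "\<forall>v<s 2 0. s1 22 v = 0" "run (Fr 9 2 ?c) s = setv 9 (s 2 0) s1"
    "\<And>x. x \<notin> insert 9 (wr ?c) \<Longrightarrow> s1 x = s x"
    by (rule run_Fr[where I = "\<lambda>i s'. \<forall>v<i. s' 22 v = 0" and k = 9 and l = 2 and c = ?c and s = s])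
      (auto simp: less_Suc_eq)
  let ?s = "run (Wr 22 (Sc 7) (Cn 1)) (run (Fr 9 2 ?c) s)"
  have fr1: "?s x = s x" if "x \<notin> {9, 22}" for x using 1(2,3) that by (simp del: run.simps(4))
  have M0: "marked ?s = {y}" using 1 assms R(1) by (auto simp: marked_def simp del: run.simps(4))
  have RV: "?R \<subseteq> {..<m} \<times> {..<m}" using adj_V adj_sym by blast
  then have fR: "finite ?R" by (rule finite_subset) simp
  have "card ?R \<le> card ({..<m} \<times> {..<m})" by (rule card_mono[OF _ RV]) simp
  then have cR: "card ?R \<le> m * m" by simp
  let ?I = "\<lambda>i s'. marked s' \<subseteq> Cl ?Q y \<and> (\<forall>k\<le>i. \<forall>z. (y, z) \<in> ?R ^^ k \<longrightarrow> z \<in> marked s')"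
  obtain s2 where 2: "?I (?s 4 0) s2" "run (Fr 10 4 (Fr 8 2 pVisit)) ?s = setv 10 (?s 4 0) s2"
  proof (rule run_Fr[where I = ?I and k = 10 and l = 4 and c = "Fr 8 2 pVisit" and s = ?s])
    fix i s' assume I: "?I i s'" and fr: "\<And>x. x \<notin> insert 10 (wr (Fr 8 2 pVisit)) \<Longrightarrow> s' x = ?s x"
    let ?t = "setv 10 i s'"
    have rd: "ready os ?t" by (rule ready_cong[OF assms(1)]) (use fr fr1 in \<open>auto simp del: run.simps\<close>)
    have Mt: "marked ?t = marked s'" by (rule marked_cong) simp
    have L: "marked ?t \<subseteq> marked (run (Fr 8 2 pVisit) ?t) \<and> marked (run (Fr 8 2 pVisit) ?t) \<subseteq> Cl ?Q y \<and>
      (\<forall>u v. u \<in> marked ?t \<longrightarrow> u \<notin> ?Q \<longrightarrow> adj u v \<longrightarrow> v \<in> marked (run (Fr 8 2 pVisit) ?t))"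
      by (rule pComponent_loop[OF rd _ assms(3)]) (use I Mt assms fr[of 6] fr1[of 6] in \<open>auto simp del: run.simps\<close>)
    have "z \<in> marked (run (Fr 8 2 pVisit) ?t)" if k: "k \<le> Suc i" "(y, z) \<in> ?R ^^ k" for k z
    proof (cases "k \<le> i")
      case True
      then show ?thesis using I L Mt k by blast
    next
      case False
      then have "k = Suc i" using k by simp
      then obtain w where "(y, w) \<in> ?R ^^ i" "(w, z) \<in> ?R" using k by auto
      then show ?thesis using I L Mt by blast
    qed
    then show "?I (Suc i) (run (Fr 8 2 pVisit) ?t)" using L by blast
  qed (use M0 in auto)
  have "z \<in> marked s2" if "z \<in> Cl ?Q y" for z
  proof -
    have "(y, z) \<in> ?R\<^sup>*" using that by (simp add: Cl_def)
    then obtain k where "(y, z) \<in> ?R ^^ k" using rtrancl_imp_relpow by blast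
    then obtain k where "(y, z) \<in> ?R ^^ k" "k \<le> card ?R" using relpow_finite_bounded[OF fR, of k] by auto
    moreover have "?s 4 0 = m * m" using fr1 R(3) by (simp del: run.simps)
    ultimately show ?thesis using 2(1) le_trans[OF _ cR, of k] by (simp only:) blast
  qed
  then have "marked s2 = Cl ?Q y" using 2(1) by blast
  moreover have "marked (run pComponent s) = marked s2"
    by (rule marked_cong) (use 2(2) in \<open>simp add: pComponent_def del: run.simps(1,4)\<close>)
  ultimately show ?thesis by simp
qed

lemma pFull_spec:
  assumes "ready os s" "s 6 0 = a" "a < length os" "s 7 0 = y" "y < m" "marked s = Cl (set (os ! a)) y"
  shows "run pFull s 26 0 = of_bool (full (set (os ! a)) y)"
proof -
  note R = readyD[OF assms(1)]
  let ?Q = "set (os ! a)"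
  let ?c = "Ifn (Rd 22 (Sc 12)) (Ifn (Rd 19 (Pl (Rd 14 (Sc 6)) (Sc 12)))
       (Ifn (Rd 15 (Pl (Rd 14 (Sc 7)) (Sc 12))) Nop (Ws 26 (Cn 0))) Nop) Nop"
  let ?s = "run (Ws 26 (Cn 1)) s"
  let ?I = "\<lambda>i s'. s' 26 0 = of_bool (\<forall>z<i. z \<in> ?Q \<longrightarrow> z \<in> Cl ?Q y \<longrightarrow> adj y z)"
  obtain s1 where 1: "?I (?s 2 0) s1" "run (Fr 12 2 ?c) ?s = setv 12 (?s 2 0) s1"
  proof (rule run_Fr[where I = ?I and k = 12 and l = 2 and c = ?c and s = ?s])
    fix i s' assume i: "i < ?s 2 0" and I: "?I i s'" and fr: "\<And>x. x \<notin> insert 12 (wr ?c) \<Longrightarrow> s' x = ?s x"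
    have im: "i < m" using i R(1) by simp
    have e: "s' x = s x" if "x \<in> {22, 6, 7, 19, 14, 15}" for x using fr[of x] that by auto
    have m: "s 22 i \<noteq> 0 \<longleftrightarrow> i \<in> Cl ?Q y" using assms(6) im by (auto simp: marked_def)
    have "run ?c (setv 12 i s') 26 0 = (if i \<in> ?Q \<and> i \<in> Cl ?Q y \<and> \<not> adj y i then 0 else s' 26 0)"
      using m e im assms R(8)[of a] R(8)[of y] R(9)[of y i] R(10)[of a i] by (auto simp del: One_nat_def)
    then show "?I (Suc i) (run ?c (setv 12 i s'))" using I by (auto simp: less_Suc_eq)
  qed auto
  have "?Q \<subseteq> {..<m}" using R(11)[OF assms(3)] by (simp add: oclique_def)
  then have "(\<forall>z<m. z \<in> ?Q \<longrightarrow> z \<in> Cl ?Q y \<longrightarrow> adj y z) \<longleftrightarrow> full ?Q y" by (auto simp: full_def)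
  then show ?thesis using 1 R(1) by (simp add: pFull_def del: run.simps(4) run.simps(3))
qed

text \<open>The empty clique has no head, so \<open>kids\<close> is meaningless for it and its row
  is set to \<open>0\<close>.\<close>

definition kid_entry :: "nat list list \<Rightarrow> nat \<Rightarrow> nat \<Rightarrow> st \<Rightarrow> bool" where
  "kid_entry os a b s \<longleftrightarrow> s 23 (a * m + b) < length os \<and>
     (if a \<noteq> 0 \<and> b \<in> kids (os ! a) then 0 < s 23 (a * m + b) \<and> os ! s 23 (a * m + b) = restr (os ! a) b
      else s 23 (a * m + b) = 0)"

lemma pKid_spec:
  assumes rd: "ready os s" and a: "s 6 0 = a" "a < length os" "s 7 0 = b" "b < m"
    and ok: "s 26 0 = of_bool (full (set (os ! a)) b)"
  shows "\<exists>x. run pKid s 23 = (s 23)(a * m + b := x) \<and> kid_entry os a b (run pKid s)"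
proof -
  note R = readyD[OF rd]
  have row: "s 14 a = a * m" using R a by simp
  have st: "s 17 a < a \<and> s 18 a < m \<and> os ! a = s 18 a # os ! s 17 a" if "a \<noteq> 0"
    using rd that a(2) by (auto simp: ready_def built_def trie_def)
  have Aa: "s 15 (s 18 a * m + b) = of_bool (adj b (hd (os ! a)))" "s 14 (s 18 a) = s 18 a * m" if "a \<noteq> 0"
    using st[OF that] R(8,9) a by (auto simp: adj_commute)
  let ?f = "s 20 (a * m + b)"
  have f: "?f < length os" "os ! ?f = filter (adj b) (os ! a)" using rd a by (auto simp: ready_def restr_entry_def)
  have "oclique (restr (os ! a) b)" using R(11)[OF a(2)] a by (intro oclique_restr) auto
  moreover have "kidsok os (length os) 0 s" using rd by (simp add: ready_def built_def)
  ultimately have c: "0 < s 16 (?f * m + b)" "s 16 (?f * m + b) < length os"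
    "os ! s 16 (?f * m + b) = restr (os ! a) b"
    using f a unfolding kidsok_def restr_def by (metis)+
  define x where "x = (if a \<noteq> 0 \<and> b \<in> kids (os ! a) then s 16 (?f * m + b) else 0)"
  have kid: "b \<in> kids (os ! a) \<longleftrightarrow> full (set (os ! a)) b \<and> b \<notin> set (os ! a) \<and> adj b (hd (os ! a))"
    using a by (auto simp: kids_def)
  have "run pKid s 23 = (s 23)(a * m + b := x)"
    using row a ok R(10)[OF a(2,4)] R(8)[of ?f] f Aa unfolding x_def kid
    by (auto simp: pKid_def fun_eq_iff)
  moreover from this have "kid_entry os a b (run pKid s)"
    using c R(5) by (auto simp: kid_entry_def x_def)
  ultimately show ?thesis by blast
qed

lemma pKids_spec:
  assumes rd: "ready os s"
  shows "\<forall>a<length os. \<forall>b<m. kid_entry os a b (run pKids s)"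
  unfolding pKids_def
proof (rule fill2)
  show "s 3 0 = length os" "s 2 0 = m" using readyD[OF rd] by auto
  show "wf (Fr 6 3 (Fr 7 2 (pComponent ;; pFull ;; pKid)))" by simp
next
  fix a b s' assume ab: "a < length os" "b < m"
    and fr: "\<And>x. x \<notin> insert 6 (insert 7 (wr (pComponent ;; pFull ;; pKid))) \<Longrightarrow> s' x = s x"
    and st: "s' 6 0 = a" "s' 7 0 = b"
    and Q: "\<And>a' b'. b' < m \<Longrightarrow> a' < a \<or> a' = a \<and> b' < b \<Longrightarrow> kid_entry os a' b' s'"
  let ?s1 = "run pComponent s'" and ?s2 = "run pFull (run pComponent s')"
  have f1: "?s1 x = s' x" if "x \<notin> {9, 22, 63, 10, 8}" for x using that by (intro run_frame) simp
  have f2: "?s2 x = ?s1 x" if "x \<notin> {26, 12, 63}" for x using that by (intro run_frame) simp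
  have r0: "ready os s'" by (rule ready_cong[OF rd]) (use fr in auto)
  have r1: "ready os ?s1" by (rule ready_cong[OF r0]) (use f1 in auto)
  have r2: "ready os ?s2" by (rule ready_cong[OF r1]) (use f2 in auto)
  have "marked ?s1 = Cl (set (os ! a)) b" by (rule pComponent_spec[OF r0 st(1) ab(1) st(2) ab(2)])
  then have "?s2 26 0 = of_bool (full (set (os ! a)) b)"
    by (intro pFull_spec[OF r1 _ ab(1) _ ab(2)]) (use f1 st in auto)
  then obtain x where x: "run pKid ?s2 23 = (?s2 23)(a * m + b := x)" "kid_entry os a b (run pKid ?s2)"
    using pKid_spec[OF r2 _ ab(1) _ ab(2)] f1 f2 st by auto
  have "kid_entry os a' b' (run pKid ?s2)" if "b' < m" "a' < a \<or> a' = a \<and> b' < b" for a' b'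
  proof -
    have "a' * m + b' \<noteq> a * m + b" using idx_inj[OF that(1) ab(2)] that by auto
    then have "run pKid ?s2 23 (a' * m + b') = s' 23 (a' * m + b')" using x(1) f1 f2 by simp
    then show ?thesis using Q[OF that] by (simp add: kid_entry_def)
  qed
  then show "kid_entry os a b (run (pComponent ;; pFull ;; pKid) s') \<and> (\<forall>a' b'. b' < m \<longrightarrow> (a' < a \<or> a' = a \<and> b' < b) \<longrightarrow>
      kid_entry os a' b' (run (pComponent ;; pFull ;; pKid) s'))"
    using x(2) by simp
qed (auto simp: kid_entry_def)

end

section \<open>Colour refinement\<close>

lemma count_image_mset_set:
  assumes "finite C"
  shows "count (image_mset h (mset_set C)) y = card {x \<in> C. h x = y}"
proof -
  have "count (image_mset h (mset_set C)) y = (\<Sum>x\<in>h -` {y} \<inter> C. 1)"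
    using assms by (simp add: count_image_mset)
  also have "h -` {y} \<inter> C = {x \<in> C. h x = y}" by auto
  finally show ?thesis by simp
qed

text \<open>Comparing multiplicities only at values that occur makes the test a finite loop over
  both sets.\<close>

lemma image_mset_eq_iff:
  assumes "finite A" "finite B"
  shows "image_mset f (mset_set A) = image_mset g (mset_set B) \<longleftrightarrow>
    (\<forall>a\<in>A. card {x \<in> A. f x = f a} = card {x \<in> B. g x = f a}) \<and>
    (\<forall>b\<in>B. card {x \<in> A. f x = g b} = card {x \<in> B. g x = g b})"
proof -
  note c = count_image_mset_set
  show ?thesis
  proof
    assume "image_mset f (mset_set A) = image_mset g (mset_set B)"
    then have "card {x \<in> A. f x = y} = card {x \<in> B. g x = y}" for y
      using c[OF assms(1), of f y] c[OF assms(2), of g y] by simp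
    then show "(\<forall>a\<in>A. card {x \<in> A. f x = f a} = card {x \<in> B. g x = f a}) \<and>
      (\<forall>b\<in>B. card {x \<in> A. f x = g b} = card {x \<in> B. g x = g b})" by blast
  next
    assume a: "(\<forall>a\<in>A. card {x \<in> A. f x = f a} = card {x \<in> B. g x = f a}) \<and>
      (\<forall>b\<in>B. card {x \<in> A. f x = g b} = card {x \<in> B. g x = g b})"
    show "image_mset f (mset_set A) = image_mset g (mset_set B)"
    proof (rule multiset_eqI)
      fix y
      consider a where "a \<in> A" "y = f a" | b where "b \<in> B" "y = g b" | "y \<notin> f ` A" "y \<notin> g ` B" by blast
      then have "card {x \<in> A. f x = y} = card {x \<in> B. g x = y}"
      proof cases
        case 3
        then have "{x \<in> A. f x = y} = {}" "{x \<in> B. g x = y} = {}" by auto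
        then show ?thesis by (simp only: card.empty)
      qed (use a in auto)
      then show "count (image_mset f (mset_set A)) y = count (image_mset g (mset_set B)) y"
        by (simp add: c assms)
    qed
  qed
qed

definition Andx :: "ex \<Rightarrow> ex \<Rightarrow> ex" where "Andx a b = Mn (Cn 1) (Pl a b)"

lemma ev_Andx [simp]: "ev (Andx (Dfx a b) (Dfx c d)) s = of_bool (ev a s = ev b s \<and> ev c s = ev d s)"
  by (auto simp: Andx_def Dfx_def)
lemma wfe_Andx [simp]: "wfe (Andx a b) \<longleftrightarrow> wfe a \<and> wfe b" by (auto simp: Andx_def)

text \<open>Compares the key of vertex \<open>7\<close> at the clique in scalar \<open>a\<close>
  with that of vertex \<open>12\<close> at the clique in scalar \<open>k\<close>.\<close>

definition samex :: "nat \<Rightarrow> nat \<Rightarrow> ex" where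
  "samex a k = Andx (Dfx (Rd 21 (Pl (Rd 14 (Sc a)) (Sc 7))) (Rd 21 (Pl (Rd 14 (Sc k)) (Sc 12))))
     (Dfx (Rd 24 (Pl (Sc 33) (Rd 23 (Pl (Rd 14 (Sc a)) (Sc 7)))))
          (Rd 24 (Pl (Sc 33) (Rd 23 (Pl (Rd 14 (Sc k)) (Sc 12))))))"
definition pCount :: "nat \<Rightarrow> nat \<Rightarrow> nat \<Rightarrow> cm" where
  "pCount a k c = Ifn (Rd 23 (Pl (Rd 14 (Sc k)) (Sc 12)))
     (Ifn (samex a k) (Ws c (Pl (Sc c) (Cn 1))) Nop) Nop"
definition pCompareKey :: "nat \<Rightarrow> cm" where
  "pCompareKey a = Ifn (Rd 23 (Pl (Rd 14 (Sc a)) (Sc 7)))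
     (Ws 27 (Cn 0) ;; Ws 28 (Cn 0) ;; Fr 12 2 (pCount a 6 27 ;; pCount a 11 28) ;;
      Ifn (Dfx (Sc 27) (Sc 28)) (Ws 26 (Cn 0)) Nop) Nop"
definition pCompare :: cm where "pCompare = Ws 26 (Cn 1) ;; Fr 7 2 (pCompareKey 6 ;; pCompareKey 11)"
definition pMerge :: cm where "pMerge = pCompare ;; Ifn (Sc 26) (Wr 24 (Pl (Sc 34) (Sc 6)) (Sc 11)) Nop"
text \<open>The new colours are written behind the old ones, so every comparison of the round still
  reads the old colours.\<close>

definition pRound :: cm where
  "pRound = Ws 34 (Pl (Sc 33) (Sc 3)) ;; Fr 6 3 (Fr 11 3 pMerge) ;; Ws 33 (Sc 34)"
definition pRefine :: cm where
  "pRefine = Ws 33 (Cn 0) ;; Fr 6 3 (Wr 24 (Sc 6) (Cn 0)) ;; Fr 10 2 pRound"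

lemma wr_E [simp]: "wr (pCount a k c) = {c, 63}" "wr (pCompareKey a) = {27, 28, 12, 63, 26}"
  "wr pCompare = {26, 7, 27, 28, 12, 63}" "wr pMerge = {26, 7, 27, 28, 12, 63, 24}"
  "wr pRound = {34, 6, 11, 26, 7, 27, 28, 12, 63, 24, 33}"
  "wr pRefine = {34, 6, 11, 26, 7, 27, 28, 12, 63, 24, 33, 10}"
  by (auto simp: pCount_def pCompareKey_def pCompare_def pMerge_def pRound_def pRefine_def)
lemma wf_E [simp]: "k < 64 \<Longrightarrow> a < 64 \<Longrightarrow> c < 64 \<Longrightarrow> wf (pCount a k c)"
  "a < 64 \<Longrightarrow> wf (pCompareKey a)" "wf pCompare" "wf pMerge" "wf pRound" "wf pRefine"
  by (auto simp: pCount_def pCompareKey_def pCompare_def pMerge_def pRound_def pRefine_def samex_def)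

context tables begin

definition final :: "nat list list \<Rightarrow> st \<Rightarrow> bool" where
  "final os s \<longleftrightarrow> ready os s \<and> (\<forall>a<length os. \<forall>b<m. kid_entry os a b s)"

lemma final_cong:
  assumes "final os s" "\<And>x. x \<in> {2, 3, 4, 14, 15, 16, 17, 18, 19, 20, 21, 23} \<Longrightarrow> s' x = s x"
  shows "final os s'"
proof -
  have e: "s' 23 = s 23" using assms(2) by simp
  have "ready os s'" by (rule ready_cong[of os s]) (use assms in \<open>auto simp: final_def\<close>)
  then show ?thesis using assms(1) unfolding final_def kid_entry_def e by blast
qed

definition kid_verts :: "st \<Rightarrow> nat \<Rightarrow> nat set" where "kid_verts s a = {y. y < m \<and> s 23 (a * m + y) \<noteq> 0}"
definition key :: "st \<Rightarrow> nat \<Rightarrow> nat \<Rightarrow> nat \<times> nat" where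
  "key s a y = (s 21 (a * m + y), s 24 (s 33 0 + s 23 (a * m + y)))"
definition key_mset :: "st \<Rightarrow> nat \<Rightarrow> (nat \<times> nat) multiset" where
  "key_mset s a = image_mset (key s a) (mset_set (kid_verts s a))"

lemma finite_kid_verts [simp]: "finite (kid_verts s a)" by (simp add: kid_verts_def)

lemma pCompareKey_spec:
  assumes fin: "final os s" and a: "a = 6 \<or> a = 11" "s a 0 < length os" and ij: "s 6 0 < length os" "s 11 0 < length os"
    and y: "s 7 0 < m"
  shows "run (pCompareKey a) s 26 0 = (if s 7 0 \<in> kid_verts s (s a 0) \<and>
      card {z \<in> kid_verts s (s 6 0). key s (s 6 0) z = key s (s a 0) (s 7 0)} \<noteq>
      card {z \<in> kid_verts s (s 11 0). key s (s 11 0) z = key s (s a 0) (s 7 0)} then 0 else s 26 0)"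
proof -
  have rd: "ready os s" using fin by (simp add: final_def)
  note R = readyD[OF rd]
  have row: "s 14 (s a 0) = s a 0 * m" "s 14 (s 6 0) = s 6 0 * m" "s 14 (s 11 0) = s 11 0 * m"
    using R(8) a ij by auto
  let ?\<kappa> = "key s (s a 0) (s 7 0)"
  let ?C = "\<lambda>k i. {z \<in> kid_verts s k. z < i \<and> key s k z = ?\<kappa>}"
  let ?c = "pCount a 6 27 ;; pCount a 11 28"
  let ?s = "run (Ws 28 (Cn 0)) (run (Ws 27 (Cn 0)) s)"
  have fs: "?s x = s x" if "x \<noteq> 27" "x \<noteq> 28" for x using that by simp
  have step: "run (pCount a k c) t c 0 = (if i \<in> kid_verts s (s k 0) \<and> key s (s k 0) i = ?\<kappa> then Suc (t c 0) else t c 0)"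
    if k: "k = 6 \<or> k = 11" and c: "c = 27 \<or> c = 28" and i: "t 12 0 = i" "i < m"
      and fr: "\<And>x. x \<in> {6, 7, 11, 14, 21, 23, 24, 33} \<Longrightarrow> t x = s x" for k c i t
  proof -
    have e: "t 6 = s 6" "t 7 = s 7" "t 11 = s 11" "t 14 = s 14" "t 21 = s 21" "t 23 = s 23" "t 24 = s 24"
      "t 33 = s 33" by (simp_all add: fr)
    show ?thesis using k c a(1) i row
      by (auto simp: pCount_def samex_def kid_verts_def key_def e)
  qed
  let ?I = "\<lambda>i s'. s' 27 0 = card (?C (s 6 0) i) \<and> s' 28 0 = card (?C (s 11 0) i)"
  have CS: "card (?C k (Suc i)) = (if i \<in> kid_verts s k \<and> key s k i = ?\<kappa> then Suc (card (?C k i)) else card (?C k i))" for k i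
  proof (cases "i \<in> kid_verts s k \<and> key s k i = ?\<kappa>")
    case True
    then have "?C k (Suc i) = insert i (?C k i)" by (auto simp: less_Suc_eq)
    then show ?thesis using True by simp
  next
    case False
    then have "?C k (Suc i) = ?C k i" by (auto simp: less_Suc_eq)
    then show ?thesis using False by (simp only: if_False)
  qed
  obtain s1 where 1: "?I (?s 2 0) s1" "run (Fr 12 2 ?c) ?s = setv 12 (?s 2 0) s1"
    "\<And>x. x \<notin> insert 12 (wr ?c) \<Longrightarrow> s1 x = ?s x"
  proof (rule run_Fr[where I = ?I and k = 12 and l = 2 and c = ?c and s = ?s])
    fix i s' assume i: "i < ?s 2 0" and I: "?I i s'" and fr: "\<And>x. x \<notin> insert 12 (wr ?c) \<Longrightarrow> s' x = ?s x"
    let ?t = "setv 12 i s'"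
    have im: "i < m" using i R(1) by simp
    have ft: "?t x = s x" if "x \<in> {6, 7, 11, 14, 21, 23, 24, 33}" for x using fr[of x] that by auto
    have 1: "run (pCount a 6 27) ?t 27 0 = card (?C (s 6 0) (Suc i))"
      using step[of 6 27 ?t i] ft im I by (simp add: CS)
    let ?u = "run (pCount a 6 27) ?t"
    have fu: "?u x = ?t x" if "x \<notin> {27, 63}" for x using that by (intro run_frame) simp
    have "?u x = s x" if "x \<in> {6, 7, 11, 14, 21, 23, 24, 33}" for x using fu[of x] ft[OF that] that by auto
    then have 2: "run (pCount a 11 28) ?u 28 0 = card (?C (s 11 0) (Suc i))"
      using step[of 11 28 ?u i] fu im I by (simp add: CS)
    have "run (pCount a 11 28) ?u 27 = ?u 27" by (rule run_frame) simp
    then show "?I (Suc i) (run ?c ?t)" using 1 2 by simp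
  qed auto
  have CC: "?C k m = {z \<in> kid_verts s k. key s k z = ?\<kappa>}" for k by (auto simp: kid_verts_def)
  have "s1 26 = s 26" using 1(3)[of 26] by simp
  moreover have "s 23 (s a 0 * m + s 7 0) \<noteq> 0 \<longleftrightarrow> s 7 0 \<in> kid_verts s (s a 0)" using y by (simp add: kid_verts_def)
  ultimately show ?thesis
    using 1(1,2) R(1) row CC[of "s 6 0"] CC[of "s 11 0"] by (simp add: pCompareKey_def del: run.simps(4))
qed

lemma key_mset_cong:
  assumes "s' 21 = s 21" "s' 23 = s 23" "s' 33 = s 33"
    "\<And>y. y < m \<Longrightarrow> s' 24 (s 33 0 + s 23 (a * m + y)) = s 24 (s 33 0 + s 23 (a * m + y))"
  shows "key_mset s' a = key_mset s a" "kid_verts s' a = kid_verts s a" "\<And>y. y < m \<Longrightarrow> key s' a y = key s a y"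
proof -
  show k: "kid_verts s' a = kid_verts s a" by (simp add: kid_verts_def assms)
  show key: "\<And>y. y < m \<Longrightarrow> key s' a y = key s a y" by (simp add: key_def assms)
  show "key_mset s' a = key_mset s a" unfolding key_mset_def k by (rule image_mset_cong) (use key in \<open>simp add: kid_verts_def\<close>)
qed

lemma pCompare_spec:
  assumes fin: "final os s" and ij: "s 6 0 < length os" "s 11 0 < length os"
  shows "run pCompare s 26 0 = of_bool (key_mset s (s 6 0) = key_mset s (s 11 0))"
proof -
  have rd: "ready os s" using fin by (simp add: final_def)
  note R = readyD[OF rd]
  let ?i = "s 6 0" and ?j = "s 11 0"
  let ?c = "pCompareKey 6 ;; pCompareKey 11"
  let ?P = "\<lambda>\<kappa>. card {z \<in> kid_verts s ?i. key s ?i z = \<kappa>} = card {z \<in> kid_verts s ?j. key s ?j z = \<kappa>}"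
  let ?s = "run (Ws 26 (Cn 1)) s"
  let ?I = "\<lambda>n s'. s' 26 0 = of_bool (\<forall>y<n. (y \<in> kid_verts s ?i \<longrightarrow> ?P (key s ?i y)) \<and> (y \<in> kid_verts s ?j \<longrightarrow> ?P (key s ?j y)))"
  obtain s1 where 1: "?I (?s 2 0) s1" "run (Fr 7 2 ?c) ?s = setv 7 (?s 2 0) s1"
  proof (rule run_Fr[where I = ?I and k = 7 and l = 2 and c = ?c and s = ?s])
    fix n s' assume n: "n < ?s 2 0" and I: "?I n s'" and fr: "\<And>x. x \<notin> insert 7 (wr ?c) \<Longrightarrow> s' x = ?s x"
    have nm: "n < m" using n R(1) by simp
    let ?t = "setv 7 n s'" and ?u = "run (pCompareKey 6) (setv 7 n s')"
    have ft: "?t x = s x" if "x \<notin> {7, 26, 27, 28, 12, 63}" for x using fr[of x] that by auto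
    have fu: "?u x = ?t x" if "x \<notin> {27, 28, 12, 63, 26}" for x using that by (intro run_frame) simp
    have ks: "kid_verts v = kid_verts s" "key v = key s" if "\<And>x. x \<in> {21, 23, 24, 33} \<Longrightarrow> v x = s x" for v
    proof -
      have "v 21 = s 21" "v 23 = s 23" "v 24 = s 24" "v 33 = s 33" using that by simp_all
      then show "kid_verts v = kid_verts s" "key v = key s" by (auto simp: kid_verts_def key_def fun_eq_iff)
    qed
    have kt: "kid_verts ?t = kid_verts s" "key ?t = key s" by (rule ks; use ft in auto)+
    have ku: "kid_verts ?u = kid_verts s" "key ?u = key s" by (rule ks; use ft fu in auto)+
    have f1: "final os ?t" by (rule final_cong[OF fin]) (use ft in auto)
    have f2: "final os ?u" by (rule final_cong[OF f1]) (use fu in auto)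
    have et: "?t 6 = s 6" "?t 11 = s 11" using ft by simp_all
    have eu: "?u 6 = s 6" "?u 11 = s 11" "?u 7 0 = n" using ft fu by simp_all
    have 1: "?u 26 0 = (if n \<in> kid_verts s ?i \<and> \<not> ?P (key s ?i n) then 0 else s' 26 0)"
      using pCompareKey_spec[OF f1, of 6] ij nm unfolding kt et by simp
    have 2: "run (pCompareKey 11) ?u 26 0 = (if n \<in> kid_verts s ?j \<and> \<not> ?P (key s ?j n) then 0 else ?u 26 0)"
      using pCompareKey_spec[OF f2, of 11] ij nm unfolding ku eu by simp
    show "?I (Suc n) (run ?c ?t)" using I unfolding run.simps(2) 2 1 by (auto simp: less_Suc_eq)
  qed (simp, blast)
  have "(\<forall>y<m. (y \<in> kid_verts s ?i \<longrightarrow> ?P (key s ?i y)) \<and> (y \<in> kid_verts s ?j \<longrightarrow> ?P (key s ?j y))) \<longleftrightarrow> key_mset s ?i = key_mset s ?j"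
    unfolding key_mset_def image_mset_eq_iff[OF finite_kid_verts finite_kid_verts] by (auto simp: kid_verts_def)
  then show ?thesis using 1 R(1) by (simp add: pCompare_def del: run.simps(4))
qed

text \<open>The new colour of a clique is the largest index of a clique with the same multiset of keys.\<close>

lemma pRound_spec:
  assumes fin: "final os s"
  shows "\<forall>i<length os. \<forall>j<length os.
      run pRound s 24 (run pRound s 33 0 + i) = run pRound s 24 (run pRound s 33 0 + j) \<longleftrightarrow> key_mset s i = key_mset s j"
proof -
  have rd: "ready os s" using fin by (simp add: final_def)
  note R = readyD[OF rd]
  let ?N = "length os"
  let ?nb = "s 33 0 + ?N"
  have kidlt: "s 23 (a * m + y) < ?N" if "a < ?N" "y < m" for a y
    using fin that by (auto simp: final_def kid_entry_def)
  let ?s = "run (Ws 34 (Pl (Sc 33) (Sc 3))) s"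
  define ctx where "ctx s' \<longleftrightarrow> (\<forall>x. x \<notin> {34, 6, 11, 26, 7, 27, 28, 12, 63, 24} \<longrightarrow> s' x = s x) \<and>
    s' 34 0 = ?nb \<and> (\<forall>k<?N. s' 24 (s 33 0 + k) = s 24 (s 33 0 + k))" for s'
  have ctx_ms: "key_mset s' a = key_mset s a" if "ctx s'" "a < ?N" for s' a
    by (rule key_mset_cong) (use that kidlt in \<open>auto simp: ctx_def\<close>)
  have ctx_fin: "final os s'" if "ctx s'" for s'
    by (rule final_cong[OF fin]) (use that in \<open>auto simp: ctx_def\<close>)
  \<comment> \<open>Here \<open>w\<close> is the largest index below \<open>n\<close> in the class
    of \<open>i\<close>. The condition is empty until such an index is met, since the cell is not
    initialised; in the full loop \<open>i\<close> itself is met.\<close>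
  define W where "W i n w \<longleftrightarrow> (\<forall>j<n. key_mset s j = key_mset s i \<longrightarrow> j \<le> w \<and> w < n \<and> key_mset s w = key_mset s i)" for i n w
  let ?I = "\<lambda>i s'. ctx s' \<and> (\<forall>i'<i. W i' ?N (s' 24 (?nb + i')))"
  have ctx0: "ctx ?s" using R(2) by (simp add: ctx_def)
  obtain s1 where 1: "?I (?s 3 0) s1" "run (Fr 6 3 (Fr 11 3 pMerge)) ?s = setv 6 (?s 3 0) s1"
  proof (rule run_Fr[where I = ?I and k = 6 and l = 3 and c = "Fr 11 3 pMerge" and s = ?s])
    fix i s' assume i: "i < ?s 3 0" and I: "?I i s'"
    have iN: "i < ?N" using i R(2) by simp
    let ?t = "setv 6 i s'"
    let ?J = "\<lambda>j s''. ctx s'' \<and> s'' 6 0 = i \<and> (\<forall>i'<i. W i' ?N (s'' 24 (?nb + i'))) \<and> W i j (s'' 24 (?nb + i))"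
    have t3: "?t 3 0 = ?N" using I R(2) by (auto simp: ctx_def)
    obtain s2 where 2: "?J (?t 3 0) s2" "run (Fr 11 3 pMerge) ?t = setv 11 (?t 3 0) s2"
    proof (rule run_Fr[where I = ?J and k = 11 and l = 3 and c = pMerge and s = ?t])
      show "?J 0 ?t" using I by (auto simp: ctx_def W_def)
    next
      fix j s'' assume j: "j < ?t 3 0" and J: "?J j s''"
      have jN: "j < ?N" using j t3 by simp
      let ?v = "setv 11 j s''"
      have cv: "ctx ?v" using J by (auto simp: ctx_def)
      have v: "?v 6 0 = i" "?v 11 0 = j" using J by simp_all
      have c: "run pCompare ?v 26 0 = of_bool (key_mset s i = key_mset s j)"
        using pCompare_spec[OF ctx_fin[OF cv]] v iN jN ctx_ms[OF cv] by simp
      have fc: "run pCompare ?v x = ?v x" if "x \<notin> {26, 7, 27, 28, 12, 63}" for x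
        using that by (intro run_frame) simp
      have e: "run pCompare ?v 24 = s'' 24" "run pCompare ?v 34 0 = ?nb" "run pCompare ?v 6 0 = i" "run pCompare ?v 11 0 = j"
        using fc[of 24] fc[of 34] fc[of 6] fc[of 11] v cv by (auto simp: ctx_def)
      have r24: "run pMerge ?v 24 = (if key_mset s i = key_mset s j then (s'' 24)(?nb + i := j) else s'' 24)"
        using c e by (simp add: pMerge_def)
      have "run pMerge ?v x = s'' x" if "x \<notin> {26, 7, 27, 28, 12, 63, 24, 11}" for x
        using that by (subst run_frame) auto
      then have "ctx (run pMerge ?v)" "run pMerge ?v 6 0 = i"
        using J r24 unfolding ctx_def by auto
      moreover have "W i (Suc j) (run pMerge ?v 24 (?nb + i))"
        using J r24 unfolding W_def by (auto simp: less_Suc_eq)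
      moreover have "\<forall>i'<i. W i' ?N (run pMerge ?v 24 (?nb + i'))" using J r24 by auto
      ultimately show "?J (Suc j) (run pMerge ?v)" by blast
    qed blast
    have "ctx (setv 11 ?N s2)" using 2(1) by (auto simp: ctx_def)
    then show "?I (Suc i) (run (Fr 11 3 pMerge) ?t)" using 2 t3 by (auto simp: less_Suc_eq)
  qed (use ctx0 in auto)
  have r: "run pRound s = (setv 6 ?N s1)(33 := (s1 33)(0 := ?nb))"
    using 1 R(2) by (simp add: pRound_def ctx_def del: run.simps(4))
  have W: "W i ?N (s1 24 (?nb + i))" if "i < ?N" for i using 1(1) R(2) that by simp
  have "s1 24 (?nb + i) = s1 24 (?nb + j) \<longleftrightarrow> key_mset s i = key_mset s j" if ij: "i < ?N" "j < ?N" for i j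
  proof
    assume "s1 24 (?nb + i) = s1 24 (?nb + j)"
    then show "key_mset s i = key_mset s j" using W[OF ij(1)] W[OF ij(2)] ij unfolding W_def by metis
  next
    assume e: "key_mset s i = key_mset s j"
    have "s1 24 (?nb + i) \<le> s1 24 (?nb + j)" "s1 24 (?nb + j) \<le> s1 24 (?nb + i)"
      using W[OF ij(1)] W[OF ij(2)] ij e unfolding W_def by metis+
    then show "s1 24 (?nb + i) = s1 24 (?nb + j)" by simp
  qed
  then show ?thesis unfolding r by simp
qed

text \<open>A stored number only names a class and does not encode the nested multiset, so
  equalities are all that is compared. Index \<open>0\<close> is left out because the empty clique
  has no head.\<close>

definition colours_inv :: "nat list list \<Rightarrow> nat \<Rightarrow> st \<Rightarrow> bool" where
  "colours_inv os k s \<longleftrightarrow> (\<forall>i<length os. \<forall>j<length os. 0 < i \<longrightarrow> 0 < j \<longrightarrow>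
     (s 24 (s 33 0 + i) = s 24 (s 33 0 + j) \<longleftrightarrow> colour k (os ! i) = colour k (os ! j)))"

text \<open>Pattern numbers are injective codes, and old class numbers separate restrictions exactly
  as their colours do; hence all multiplicities compare alike.\<close>

lemma key_mset_colour:
  assumes fin: "final os s" and colours_inv: "colours_inv os k s" and ij: "0 < i" "i < length os" "0 < j" "j < length os"
  shows "key_mset s i = key_mset s j \<longleftrightarrow> colour (Suc k) (os ! i) = colour (Suc k) (os ! j)"
proof -
  have kid_verts: "kid_verts s a = kids (os ! a)" if "0 < a" "a < length os" for a
  proof -
    have "s 23 (a * m + y) \<noteq> 0 \<longleftrightarrow> y \<in> kids (os ! a)" if "y < m" for y
    proof -
      have "kid_entry os a y s" using fin that \<open>a < length os\<close> by (auto simp: final_def)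
      then show ?thesis using \<open>0 < a\<close> by (simp add: kid_entry_def split: if_splits)
    qed
    then show ?thesis using kids_V by (auto simp: kid_verts_def)
  qed
  let ?ck = "\<lambda>a y. (map (adj y) (os ! a), colour k (restr (os ! a) y))"
  have key: "key s a y = key s b z \<longleftrightarrow> ?ck a y = ?ck b z"
    if ab: "0 < a" "a < length os" "0 < b" "b < length os" "y \<in> kids (os ! a)" "z \<in> kids (os ! b)" for a b y z
  proof -
    have yz: "y < m" "z < m" using ab kids_V by auto
    have "s 21 (a * m + y) = pat (map (adj y) (os ! a))" "s 21 (b * m + z) = pat (map (adj z) (os ! b))"
      using fin ab yz by (auto simp: final_def ready_def restr_entry_def)
    moreover have "0 < s 23 (a * m + y)" "s 23 (a * m + y) < length os" "os ! s 23 (a * m + y) = restr (os ! a) y"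
      "0 < s 23 (b * m + z)" "s 23 (b * m + z) < length os" "os ! s 23 (b * m + z) = restr (os ! b) z"
      using fin ab yz by (auto simp: final_def kid_entry_def)
    ultimately show ?thesis using colours_inv unfolding colours_inv_def key_def by (auto simp: pat_inj)
  qed
  show ?thesis
    unfolding key_mset_def kid_verts[OF ij(1,2)] kid_verts[OF ij(3,4)] colour.simps colour.inject
      image_mset_eq_iff[OF finite_kids finite_kids]
    using key ij by (auto cong: conj_cong)
qed

text \<open>The union has \<open>m\<close> vertices, so \<open>m\<close> rounds meet the requirement
  of \<open>colour_iff_liso\<close>.\<close>

lemma pRefine_spec:
  assumes fin: "final os s"
  shows "colours_inv os m (run pRefine s)"
proof -
  have rd: "ready os s" using fin by (simp add: final_def)
  note R = readyD[OF rd]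
  let ?s0 = "run (Ws 33 (Cn 0)) s" and ?c = "Wr 24 (Sc 6) (Cn 0)"
  obtain s1 where 1: "\<forall>i<?s0 3 0. s1 24 i = 0" "run (Fr 6 3 ?c) ?s0 = setv 6 (?s0 3 0) s1"
    "\<And>x. x \<notin> insert 6 (wr ?c) \<Longrightarrow> s1 x = ?s0 x"
    by (rule run_Fr[where I = "\<lambda>n s'. \<forall>i<n. s' 24 i = 0" and k = 6 and l = 3 and c = ?c and s = ?s0])
      (auto simp: less_Suc_eq)
  let ?s = "run (Fr 6 3 ?c) ?s0"
  have fs: "?s x = s x" if "x \<notin> {33, 6, 24}" for x using 1(2,3) that by (simp del: run.simps(4))
  have "?s 33 0 = 0" using 1(2,3) by (simp del: run.simps(4))
  then have C0: "colours_inv os 0 ?s" using 1 R(2) by (simp add: colours_inv_def del: run.simps(4))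
  have F0: "final os ?s" by (rule final_cong[OF fin]) (use fs in \<open>auto simp del: run.simps\<close>)
  obtain s2 where 2: "colours_inv os (?s 2 0) s2 \<and> final os s2" "run (Fr 10 2 pRound) ?s = setv 10 (?s 2 0) s2"
  proof (rule run_Fr[where I = "\<lambda>k s'. colours_inv os k s' \<and> final os s'" and k = 10 and l = 2 and c = pRound and s = ?s])
    fix k s' assume I: "colours_inv os k s' \<and> final os s'"
    let ?t = "setv 10 k s'"
    have t: "colours_inv os k ?t" "final os ?t"
      using I by (simp add: colours_inv_def, intro final_cong[of os s' ?t]) auto
    have "colours_inv os (Suc k) (run pRound ?t)"
      unfolding colours_inv_def using pRound_spec[OF t(2)] key_mset_colour[OF t(2,1)] by blast
    moreover have "final os (run pRound ?t)"
      by (rule final_cong[OF t(2)]) (rule run_frame, auto)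
    ultimately show "colours_inv os (Suc k) (run pRound ?t) \<and> final os (run pRound ?t)" by blast
  qed (use C0 F0 in auto)
  have "run pRefine s = setv 10 (?s 2 0) s2" using 2(2) by (simp add: pRefine_def del: run.simps(1,4))
  moreover have "?s 2 0 = m" using fs R(1) by (simp del: run.simps)
  ultimately show ?thesis using 2(1) by (simp add: colours_inv_def)
qed

end

section \<open>The isomorphism test\<close>

text \<open>Row \<open>0\<close> of the extension table belongs to the empty clique, so its columns
  \<open>2 * n\<close> and \<open>2 * n + 1\<close> lead to the singletons of the apices.\<close>

definition pOutput :: cm where
  "pOutput = Ws 0 (Eqx
     (Rd 24 (Pl (Sc 33) (Rd 16 (Pl (Rd 14 (Cn 0)) (Pl (Sc 0) (Sc 0))))))
     (Rd 24 (Pl (Sc 33) (Rd 16 (Pl (Rd 14 (Cn 0)) (Pl (Pl (Sc 0) (Sc 0)) (Cn 1)))))))"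
definition pMain :: cm where
  "pMain = pInit ;; pOffsets ;; pAdj ;; pTrieInit ;; pTrie ;; pRestr ;; pKids ;; pRefine ;; pOutput"

lemma wf_main: "wf pMain"
  by (simp add: pMain_def pOutput_def)

lemma length_adj_rows: "length (concat (map (\<lambda>i. map (f i) [0..<n]) [0..<k])) = k * n"
  by (induction k) auto

lemma nth_adj_rows:
  "i < k \<Longrightarrow> j < n \<Longrightarrow> concat (map (\<lambda>i. map (f i) [0..<n]) [0..<k]) ! (i * n + j) = f i j"
proof (induction k)
  case (Suc k)
  show ?case
  proof (cases "i = k")
    case True
    then show ?thesis using Suc.prems by (simp add: nth_append length_adj_rows)
  next
    case False
    then have "i < k" using Suc.prems by simp
    then have "Suc i * n \<le> k * n" by (intro mult_le_mono1) simp
    then have "i * n + j < k * n" using Suc.prems by simp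
    then show ?thesis using Suc.IH[OF \<open>i < k\<close>] Suc.prems by (simp add: nth_append length_adj_rows)
  qed
qed simp

lemma input_encode:
  assumes "i < n" "j < n"
  shows "input_mem (encode_pair n G H) (1 + (i * n + j)) = of_bool ((i, j) \<in> parcs G)"
    "input_mem (encode_pair n G H) (1 + n * n + (i * n + j)) = of_bool ((i, j) \<in> parcs H)"
    "i * n + j < n * n"
proof -
  have "Suc i * n \<le> n * n" using assms by (intro mult_le_mono1) simp
  then show l: "i * n + j < n * n" using assms by simp
  have len: "length (adj_matrix n F) = n * n" for F unfolding adj_matrix_def by (rule length_adj_rows)
  have nth: "adj_matrix n F ! (i * n + j) = of_bool ((i, j) \<in> parcs F)" for F
    unfolding adj_matrix_def using nth_adj_rows[OF assms, of "\<lambda>i j. of_bool ((i, j) \<in> parcs F)"] by simp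
  show "input_mem (encode_pair n G H) (1 + (i * n + j)) = of_bool ((i, j) \<in> parcs G)"
    using l len nth by (simp add: input_mem_def encode_pair_def nth_append)
  show "input_mem (encode_pair n G H) (1 + n * n + (i * n + j)) = of_bool ((i, j) \<in> parcs H)"
    using l len nth by (simp add: input_mem_def encode_pair_def nth_append)
qed

lemma input_beyond:
  "2 * (n * n) < i \<Longrightarrow> input_mem (encode_pair n G H) i = 0"
proof -
  assume "2 * (n * n) < i"
  moreover have "length (adj_matrix n F) = n * n" for F unfolding adj_matrix_def by (rule length_adj_rows)
  ultimately show ?thesis by (simp add: input_mem_def encode_pair_def)
qed

text \<open>Since \<open>2 * n + 2 \<le> 4 * max 1 n\<close>, the four summands contribute
  \<open>4 + 16 + 4 + 2 = 26\<close>.\<close>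

lemma max_pow_bound:
  assumes "N \<le> (2 * n + 2) * E" "1 \<le> (E :: nat)"
  shows "N + (2 * n + 2) * (2 * n + 2) + (2 * n + 2) + 2 \<le> 26 * (max 1 n ^ 2 * E)"
proof -
  define M where "M = max 1 n"
  have M: "2 * n + 2 \<le> 4 * M" "1 \<le> M" by (auto simp: M_def)
  have MM: "M \<le> M * M" using M(2) by simp
  have "M * E \<le> M * M * E" using MM by (intro mult_le_mono1)
  moreover have "(2 * n + 2) * E \<le> 4 * M * E" using M by (intro mult_le_mono1)
  ultimately have 1: "N \<le> 4 * (M * M * E)" using assms(1) by linarith
  have e: "M * M \<le> M * M * E" using assms(2) by simp
  have "(2 * n + 2) * (2 * n + 2) \<le> (4 * M) * (4 * M)" using M by (intro mult_le_mono)
  then have 2: "(2 * n + 2) * (2 * n + 2) \<le> 16 * (M * M * E)" using e by linarith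
  have 3: "(2 * n + 2) \<le> 4 * (M * M * E)" using M MM e by linarith
  have 4: "2 \<le> 2 * (M * M * E)" using M MM e by linarith
  show ?thesis using 1 2 3 4 unfolding M_def[symmetric] power2_eq_square by linarith
qed

definition bigK :: nat where
  "bigK = kst pInit + kst pOffsets + kst pAdj + (kst pTrieInit + kst pTrie) + kst pRestr + kst pKids + kst pRefine + kst pOutput"

text \<open>With \<open>e = (p + 2) * (p + 2)\<close>, a factor \<open>L\<close> moves into the
  exponent by \<open>L \<le> 2 ^ L \<le> 2 ^ (L * e)\<close>. Here \<open>3000\<close> stems from
  the prelude, \<open>bigK * 26 ^ 5\<close> from the main program and the last \<open>5\<close> from
  the fifth power of \<open>2 ^ e\<close>.\<close>

definition expK :: nat where "expK = 3000 + bigK * 26 ^ 5 + 5"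

lemma time_bound:
  assumes "t1 \<le> 1000 * (n * n + n + 1)" "t2 \<le> bigK * (26 * (max 1 n ^ 2 * 2 ^ ((p + 2) * (p + 2)))) ^ 5"
  shows "t1 + t2 \<le> fbound expK p * max 1 n ^ 10"
proof -
  define M where "M = max 1 n"
  define e where "e = (p + 2) * (p + 2)"
  have M: "n \<le> M" "1 \<le> M" by (auto simp: M_def)
  have e1: "1 \<le> e" by (simp add: e_def)
  have "n * n \<le> M * M" "n \<le> M * M" "1 \<le> M * M"
    using M mult_le_mono[OF M(1) M(1)] mult_le_mono[OF M(2) M(2)] mult_le_mono[OF M(1) M(2)] by simp_all
  then have "n * n + n + 1 \<le> 3 * (M * M)" by linarith
  then have "1000 * (n * n + n + 1) \<le> 1000 * (3 * (M * M))" by (rule mult_le_mono2)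
  then have "t1 \<le> 3000 * (M * M)" using assms(1) by simp
  also have "M * M \<le> M ^ 10" using M(2) power_increasing[of 2 10 M] by (simp add: power2_eq_square)
  finally have 1: "t1 \<le> 3000 * M ^ 10" by simp
  have "3000 * M ^ 10 \<le> 3000 * (M ^ 10 * 2 ^ (5 * e))" by simp
  then have 1: "t1 \<le> 3000 * (M ^ 10 * 2 ^ (5 * e))" using 1 by (rule le_trans[rotated])
  have "(26 * (M ^ 2 * 2 ^ e)) ^ 5 = 26 ^ 5 * (M ^ 10 * 2 ^ (5 * e))"
    by (simp add: power_mult_distrib power_mult[symmetric] mult.commute)
  then have 2: "t2 \<le> bigK * 26 ^ 5 * (M ^ 10 * 2 ^ (5 * e))"
    using assms(2) unfolding M_def[symmetric] e_def[symmetric] by (simp only: mult.assoc)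
  let ?L = "3000 + bigK * 26 ^ 5"
  have "t1 + t2 \<le> 3000 * (M ^ 10 * 2 ^ (5 * e)) + bigK * 26 ^ 5 * (M ^ 10 * 2 ^ (5 * e))"
    using 1 2 by (rule add_mono)
  also have "\<dots> = ?L * (M ^ 10 * 2 ^ (5 * e))" by (rule distrib_right[symmetric])
  also have "?L \<le> 2 ^ ?L" by (rule less_imp_le[OF less_exp])
  also have "(2::nat) ^ ?L \<le> 2 ^ (?L * e)"
    by (rule power_increasing) (use mult_le_mono2[OF e1, of ?L] in simp_all)
  finally have "t1 + t2 \<le> 2 ^ (?L * e) * (M ^ 10 * 2 ^ (5 * e))" by simp
  also have "\<dots> = 2 ^ (?L * e + 5 * e) * M ^ 10" by (simp only: power_add ac_simps)
  also have "?L * e + 5 * e = expK * e" by (simp only: expK_def distrib_right)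
  finally show ?thesis by (simp only: fbound_def e_def M_def)
qed

context star_pair
begin

lemma main_correct:
  assumes m: "m = 2 * n + 2" and s: "adj_input n m (parcs G) (parcs H) s"
  shows "run pMain s 0 0 = of_bool (digraph_iso (with_proj G) (with_proj H)) \<and>
    tm pMain s \<le> bigK * (26 * (max 1 n ^ 2 * 2 ^ ((p + 2) * (p + 2)))) ^ 5"
proof -
  interpret tables m U unfolding m by (rule tables.intro[OF U_sgraph])
  interpret adj_input n m "parcs G" "parcs H" s by (rule s)
  define sA1 where "sA1 = run pInit s"
  define sA2 where "sA2 = run pOffsets sA1"
  define sA where "sA = run pAdj sA2"
  define sB where "sB = run (pTrieInit ;; pTrie) sA"
  define sC where "sC = run pRestr sB"
  define sD where "sD = run pKids sC"
  define sE where "sE = run pRefine sD"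
  have r: "run pMain s = run pOutput sE"
    by (simp add: pMain_def sA1_def sA2_def sA_def sB_def sC_def sD_def sE_def)
  have sA': "sA = run (pInit ;; pOffsets ;; pAdj) s" by (simp add: sA_def sA1_def sA2_def)
  note A = adj_spec[folded sA']
  have bA: "base 0 sA" unfolding base_def using A(2,5,6) by (simp add: U_def)
  obtain os where bu: "built os sB" using pTrie_spec[OF bA A(3)] by (auto simp: sB_def)
  have fB: "sB x = sA x" if "x \<in> {0, 4, 2}" for x unfolding sB_def using that by (intro run_frame) auto
  have fC: "sC x = sB x" if "x \<notin> {6, 7, 19, 20, 21, 29}" for x unfolding sC_def using that by (intro run_frame) auto
  have "built os sC" using bu by (subst built_cong[of sC sB]) (auto simp: fC)
  moreover have "sC 4 0 = m * m" using A(4) fB[of 4] fC[of 4] by simp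
  ultimately have rd: "ready os sC" using pRestr_spec[OF bu] by (simp add: ready_def sC_def)
  have fD: "sD x = sC x" if "x \<notin> {6, 7, 9, 22, 63, 10, 8, 26, 12, 29, 23}" for x
    unfolding sD_def using that by (intro run_frame) auto
  have "ready os sD" by (rule ready_cong[OF rd]) (rule fD, auto)
  then have fin: "final os sD" using pKids_spec[OF rd] by (simp add: final_def sD_def)
  have colours_inv: "colours_inv os m sE" using pRefine_spec[OF fin] by (simp add: sE_def)
  have fE: "sE x = sD x" if "x \<notin> {34, 6, 11, 26, 7, 27, 28, 12, 63, 24, 33, 10}" for x
    unfolding sE_def using that by (intro run_frame) auto
  have bD: "built os sD" using fin by (simp add: final_def ready_def)
  have s0: "sE 0 0 = n" using A(1) fB[of 0] fC[of 0] fD[of 0] fE[of 0] by simp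
  have o0: "os ! 0 = []" "0 < length os" using bD by (auto simp: built_def trie_def)
  have id: "0 < sE 16 v \<and> sE 16 v < length os \<and> os ! sE 16 v = [v]" if "v < m" for v
  proof -
    have "kidsok os (length os) 0 sD" using bD by (simp add: built_def)
    moreover have "oclique (v # os ! 0)" using that o0 by (simp add: oclique_def)
    ultimately have "0 < sD 16 (0 * m + v) \<and> sD 16 (0 * m + v) < length os \<and> os ! sD 16 (0 * m + v) = v # os ! 0"
      using o0 that unfolding kidsok_def by (metis)
    then show ?thesis using fE[of 16] o0 by simp
  qed
  have lt: "2 * n < m" "2 * n + 1 < m" by (simp_all add: m)
  have row: "sE 14 0 = 0" using bD fE[of 14] by (simp add: built_def base_def)
  have "run pMain s 0 0 = of_bool (sE 24 (sE 33 0 + sE 16 (2 * n)) = sE 24 (sE 33 0 + sE 16 (2 * n + 1)))"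
    unfolding r by (simp add: pOutput_def s0 row mult_2)
  also have "\<dots> = of_bool (colour m [2 * n] = colour m [2 * n + 1])"
  proof -
    note a = id[OF lt(1)] id[OF lt(2)]
    show ?thesis using colours_inv[unfolded colours_inv_def, rule_format, of "sE 16 (2 * n)" "sE 16 (2 * n + 1)"] a by simp
  qed
  also have "colour m [2 * n] = colour m [2 * n + 1] \<longleftrightarrow> (\<exists>\<phi>. liso \<phi> [2 * n] [2 * n + 1])"
    by (rule helly_graph.colour_iff_liso[OF U_helly[folded m]]) (use lt in \<open>auto simp: oclique_def\<close>)
  also have "\<dots> \<longleftrightarrow> digraph_iso (with_proj G) (with_proj H)" by (rule U_iso[symmetric])
  finally have 1: "run pMain s 0 0 = of_bool (digraph_iso (with_proj G) (with_proj H))" .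
  let ?N = "card {q. oclique q}"
  \<comment> \<open>Dominates the loop limits \<open>n\<close>, \<open>m\<close>,
    \<open>m + 1\<close>, \<open>m * m\<close> and the number of cliques.\<close>
  define B where "B = ?N + m * m + m + 1"
  have mm: "m \<le> B" "m * m \<le> B" "m + 1 \<le> B" "n \<le> B" by (auto simp: B_def m)
  \<comment> \<open>The deepest nesting, in \<open>pKids\<close> and in \<open>pRefine\<close>, has
    five loops.\<close>
  have mult: "k * (B + 1) ^ d \<le> k * (B + 1) ^ 5" if "d \<le> 5" for k d
    using that by (intro mult_le_mono2 power_increasing) auto
  have lB: "length os = ?N"
  proof -
    have "distinct os" "set os = {q. oclique q}" using bu by (auto simp: built_def trie_def)
    then show ?thesis by (metis distinct_card)
  qed
  have s3: "sB 3 0 = ?N" using bu lB by (simp add: built_def trie_def)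
  have A1: "sA1 0 0 = n" "sA1 32 0 = m + 1" "sA2 2 0 = m"
    using A(3) offsets_spec(2) adj_input.s0[OF s] run_frame[of 32 pAdj sA2] run_frame[of 32 pOffsets sA1] run_frame[of 0 pInit s]
    by (simp_all add: sA_def sA1_def sA2_def)
  have t1: "tm pInit s \<le> kst pInit * (B + 1) ^ 5"
  proof (rule le_trans[OF tm_bound mult])
    show "\<And>l. l \<in> lims pInit \<Longrightarrow> s l 0 \<le> B" "lims pInit \<inter> wr pInit = {}" "dep pInit \<le> 5"
      by (auto simp: pInit_def)
  qed
  have t2: "tm pOffsets sA1 \<le> kst pOffsets * (B + 1) ^ 5"
  proof (rule le_trans[OF tm_bound mult])
    show "\<And>l. l \<in> lims pOffsets \<Longrightarrow> sA1 l 0 \<le> B" "lims pOffsets \<inter> wr pOffsets = {}" "dep pOffsets \<le> 5"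
      using A1 mm by (auto simp: pOffsets_def)
  qed
  have t3: "tm pAdj sA2 \<le> kst pAdj * (B + 1) ^ 5"
  proof (rule le_trans[OF tm_bound mult])
    show "\<And>l. l \<in> lims pAdj \<Longrightarrow> sA2 l 0 \<le> B" "lims pAdj \<inter> wr pAdj = {}" "dep pAdj \<le> 5"
      using A1 mm by (auto simp: pAdj_def pAdjEntry_def)
  qed
  have t4: "tm (pTrieInit ;; pTrie) sA \<le> (kst pTrieInit + kst pTrie) * (B + 1) ^ 5"
  proof -
    have "?N + m + 2 \<le> B + 1" unfolding B_def by linarith
    then have "(?N + m + 2) ^ 3 \<le> (B + 1) ^ 3" by (rule power_mono) simp
    then have "(kst pTrieInit + kst pTrie) * (?N + m + 2) ^ 3 \<le> (kst pTrieInit + kst pTrie) * (B + 1) ^ 3"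
      by (rule mult_le_mono2)
    also have "\<dots> \<le> (kst pTrieInit + kst pTrie) * (B + 1) ^ 5" by (rule mult) simp
    finally show ?thesis by (rule le_trans[OF tm_pTrie[OF bA A(3)]])
  qed
  have lim: "l \<in> {2, 3, 4} \<Longrightarrow> sB l 0 \<le> B" for l
  proof -
    have "sB 2 0 \<le> B" "sB 4 0 \<le> B" using fB[of 2] fB[of 4] A(2,4) mm(1,2) by simp_all
    moreover have "sB 3 0 \<le> B" unfolding s3 B_def by linarith
    moreover assume "l \<in> {2, 3, 4}"
    ultimately show "sB l 0 \<le> B" by blast
  qed
  have t5: "tm pRestr sB \<le> kst pRestr * (B + 1) ^ 5"
  proof (rule le_trans[OF tm_bound mult])
    show "\<And>l. l \<in> lims pRestr \<Longrightarrow> sB l 0 \<le> B" "lims pRestr \<inter> wr pRestr = {}" "dep pRestr \<le> 5"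
      using lim by (auto simp: pRestr_def pRestrEntry_def)
  qed
  have t6: "tm pKids sC \<le> kst pKids * (B + 1) ^ 5"
  proof (rule le_trans[OF tm_bound mult])
    show "lims pKids \<inter> wr pKids = {}" "dep pKids \<le> 5"
      by (auto simp: pKids_def pComponent_def pFull_def pKid_def pVisit_def pMarkNbrs_def Nop_def)
    fix l assume "l \<in> lims pKids"
    then have "l \<in> {2, 3, 4}" by (auto simp: pKids_def pComponent_def pFull_def pKid_def pVisit_def pMarkNbrs_def)
    then show "sC l 0 \<le> B" using lim[of l] fC[of l] by auto
  qed
  have t7: "tm pRefine sD \<le> kst pRefine * (B + 1) ^ 5"
  proof (rule le_trans[OF tm_bound mult])
    show "lims pRefine \<inter> wr pRefine = {}" "dep pRefine \<le> 5"
      by (auto simp: pRefine_def pRound_def pMerge_def pCompare_def pCompareKey_def pCount_def Nop_def)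
    fix l assume "l \<in> lims pRefine"
    then have "l \<in> {2, 3, 4}" by (auto simp: pRefine_def pRound_def pMerge_def pCompare_def pCompareKey_def pCount_def)
    then show "sD l 0 \<le> B" using lim[of l] fC[of l] fD[of l] by auto
  qed
  have t8: "tm pOutput sE \<le> kst pOutput * (B + 1) ^ 5"
  proof (rule le_trans[OF tm_bound mult])
    show "\<And>l. l \<in> lims pOutput \<Longrightarrow> sE l 0 \<le> B" "lims pOutput \<inter> wr pOutput = {}" "dep pOutput \<le> 5"
      by (auto simp: pOutput_def)
  qed
  have "tm pMain s = tm pInit s + tm pOffsets sA1 + tm pAdj sA2 + tm (pTrieInit ;; pTrie) sA + tm pRestr sB +
      tm pKids sC + tm pRefine sD + tm pOutput sE"
    by (simp add: pMain_def sA1_def sA2_def sA_def sB_def sC_def sD_def sE_def)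
  also have "\<dots> \<le> bigK * (B + 1) ^ 5"
    unfolding bigK_def distrib_right[of _ _ "(B + 1) ^ 5"]
    using t1 t2 t3 t4 t5 t6 t7 t8 unfolding distrib_right[of _ _ "(B + 1) ^ 5"] by linarith
  also have "(B + 1) ^ 5 \<le> (26 * (max 1 n ^ 2 * 2 ^ ((p + 2) * (p + 2)))) ^ 5"
  proof (rule power_mono)
    have "?N + m * m + m + 2 \<le> 26 * (max 1 n ^ 2 * 2 ^ ((p + 2) * (p + 2)))"
      unfolding m by (rule max_pow_bound) (use U_card_oclique in auto)
    then show "B + 1 \<le> 26 * (max 1 n ^ 2 * 2 ^ ((p + 2) * (p + 2)))" by (simp add: B_def)
  qed simp
  finally show ?thesis using 1 by simp
qed

lemma outputs:
  "outputs_within (Seq prelude (cmp pMain)) (encode_pair n G H)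
     (of_bool (digraph_iso (with_proj G) (with_proj H))) (fbound expK p * max 1 n ^ 10)"
proof -
  let ?m = "input_mem (encode_pair n G H)"
  have m0: "?m 0 = n" by (simp add: input_mem_def encode_pair_def)
  have m1: "?m 1 = 0"
  proof (cases "n = 0")
    case True
    then show ?thesis by (intro input_beyond) simp
  next
    case False
    then show ?thesis using input_encode(1)[of 0 n 0 G H] GP(2) by simp
  qed
  \<comment> \<open>For \<open>n \<ge> 2\<close>, register \<open>n + 2 = 1 + (1 * n + 1)\<close>
    holds the diagonal entry \<open>(1, 1)\<close> of the first matrix.\<close>
  have m2: "?m (n + 2) = 0"
  proof (cases "n < 2")
    case True
    then have "n = 0 \<or> n = 1" by auto
    then show ?thesis by (intro input_beyond) auto
  next
    case False
    then show ?thesis using input_encode(1)[of 1 n 1 G H] GP(2) by simp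
  qed
  obtain t1 ma where a: "exec prelude ?m t1 ma" "t1 \<le> 1000 * (n * n + n + 1)" "ma 0 = n"
    "\<And>i. 2 \<le> i \<Longrightarrow> i \<le> 2 * (n * n) \<Longrightarrow> ma (64 * i + 1) = ?m i"
    using exec_prelude[OF m0 m1 m2] by blast
  define s where "s = (\<lambda>k i. ma (64 * i + k))"
  have rep: "rep ma s" by (simp add: rep_def s_def)
  have ai: "adj_input n (2 * n + 2) (parcs G) (parcs H) s"
  proof
    show "s 0 0 = n" using a(3) by (simp add: s_def)
    show "(0, 0) \<notin> parcs G" by (rule GP(2))
  next
    fix i j assume ij: "i < n" "j < n" "0 < i * n + j"
    have "s 1 (1 + (i * n + j)) = ?m (1 + (i * n + j))"
      unfolding s_def using input_encode(3)[OF ij(1,2)] ij(3) by (intro a(4)) linarith+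
    then show "s 1 (1 + (i * n + j)) = of_bool ((i, j) \<in> parcs G)" using input_encode(1)[OF ij(1,2)] by simp
  next
    fix i j assume ij: "i < n" "j < n"
    have "0 < n * n" using ij by simp
    then have "s 1 (1 + n * n + (i * n + j)) = ?m (1 + n * n + (i * n + j))"
      unfolding s_def using input_encode(3)[OF ij] by (intro a(4)) linarith+
    then show "s 1 (1 + n * n + (i * n + j)) = of_bool ((i, j) \<in> parcs H)" using input_encode(2)[OF ij] by simp
  qed simp
  obtain t2 mb where b: "exec (cmp pMain) ma t2 mb" "t2 \<le> tm pMain s" "rep mb (run pMain s)"
    using exec_cmp[OF wf_main rep] by blast
  have "mb 0 = of_bool (digraph_iso (with_proj G) (with_proj H))"
    using rep_scalar[OF b(3), of 0] main_correct[OF refl ai] by simp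
  moreover have "t1 + t2 \<le> fbound expK p * max 1 n ^ 10"
    by (rule time_bound[OF a(2)]) (use b(2) main_correct[OF refl ai] in linarith)
  ultimately show ?thesis unfolding outputs_within_def using exec.Seq[OF a(1) b(1)] by blast
qed

end

theorem theorem1:
  shows "\<exists>(P :: prog) (f :: nat \<Rightarrow> nat) (c :: nat).
    computable f \<and>
    (\<forall>(d :: nat) (p :: nat) (n :: nat) (G :: nat pair_pre_digraph) (H :: nat pair_pre_digraph).
       pverts G = {..<n} \<longrightarrow> pverts H = {..<n} \<longrightarrow>
       is_H_graph (star d) G \<longrightarrow> is_H_graph (star d) H \<longrightarrow>
       (\<forall>C. clique G C \<longrightarrow> card C \<le> p) \<longrightarrow> (\<forall>C. clique H C \<longrightarrow> card C \<le> p) \<longrightarrow>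
       outputs_within P (encode_pair n G H)
         (of_bool (digraph_iso (with_proj G) (with_proj H))) (f p * max 1 n ^ c))"
proof (intro exI conjI allI impI)
  show "computable (fbound expK)" by (rule computable_fbound)
next
  fix d p n :: nat and G H :: "nat pair_pre_digraph"
  assume "pverts G = {..<n}" "pverts H = {..<n}" "is_H_graph (star d) G" "is_H_graph (star d) H"
    "\<forall>C. clique G C \<longrightarrow> card C \<le> p" "\<forall>C. clique H C \<longrightarrow> card C \<le> p"
  then interpret star_pair d p n G H by unfold_locales auto
  show "outputs_within (Seq prelude (cmp pMain)) (encode_pair n G H)
      (of_bool (digraph_iso (with_proj G) (with_proj H))) (fbound expK p * max 1 n ^ 10)"
    by (rule outputs)
qed

end
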